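(* Let $n\ge 2$ and $1\le d_1<\dots<d_s\le n-1$. Let $U\subset \prod_{r=1}^s\mathbb P(V^a_{\omega_{d_r}})$ be the $\mathbb G_a^M$-orbit of $[v_{\omega_{d_1}}]\times\dots\times[v_{\omega_{d_s}}]$ and let $\mathcal F^a=\overline U$ be its closure (the degenerate flag variety $\mathcal F^a(d_1,\dots,d_s)$). For a subset $R\subset\prod_{r=1}^s\mathbb P(V^a_{\omega_{d_r}})$ let $I(R)\subset\mathbb C[X^a_J]$ be the ideal of multi-homogeneous polynomials vanishing on $R$ (i.e. the ideal generated by them). Let $I^a=I^a(d_1,\dots,d_s)$ be the ideal generated by the degenerate Plücker relations $R^{k;a}_{L,J}$. Then $I(U)=I^a$. Equivalently, $I(\mathcal F^a)=I^a$.
   Context: Work over $\mathbb C$ with $\mathfrak g=\mathfrak{sl}_n$, $\mathfrak n^-$ the strictly lower triangular matrices, $M=n(n-1)/2$. For $1\le i\le j\le n-1$ let $f_{i,j}\in\mathfrak n^-$ be the root vector with $f_{i,j}v_m=\delta_{i,m}v_{j+1}$ on $\mathbb C^n$ with standard basis $v_1,\dots,v_n$. For a fundamental weight $\omega_d$, $V_{\omega_d}=\Lambda^d\mathbb C^n$ has highest weight vector $v_{\omega_d}=v_1\wedge\dots\wedge v_d$ and basis $v_J=v_{j_1}\wedge\dots\wedge v_{j_d}$, $J=(1\le j_1<\dots<j_d\le n)$. PBW filtration: $F_t=\mathrm{span}\{x_1\cdots x_k v_{\omega_d}: k\le t,\ x_i\in\mathfrak n^-\}$, $F_{-1}=0$,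 and $V^a_{\omega_d}=\bigoplus_{t\ge0}F_t/F_{t-1}$. The $f_{i,j}$ map $F_t$ to $F_{t+1}$ and so induce pairwise commuting operators on $V^a_{\omega_d}$. Put $\deg J=\#\{r: j_r>d\}$. The image $v_J^a$ of $v_J$ in $F_{\deg J}/F_{\deg J-1}$ is nonzero and the $v^a_J$ form a basis of $V^a_{\omega_d}$; $X_J^a$ denotes the dual coordinates. Explicitly, $f_{i,j}v_J^a=\sum_{r}\delta_{i,j_r}v^a_{j_1,\dots,j_{r-1},j+1,j_{r+1},\dots,j_d}$ if $i\le d\le j$ and $0$ otherwise (with $v^a$ alternating in its indices). The group $\mathbb G_a^M=\mathbb C^M$ acts through the operators $\exp(\sum_{i\le j}c_{i,j}f_{i,j})$, diagonally on $\prod_r\mathbb P(V^a_{\omega_{d_r}})$. Variables $X^a_{j_1,\dots,j_d}$ ($d\in\{d_1,\dots,d_s\}$, $1\le j_1<\dots<j_d\le n$) are extended to arbitrary index sequences by being alternating in the indices (zero if an index repeats). Multi-homogeneous means homogeneous separately in each group of variables with fixed $d$. Degenerate Plücker relations: for $p\ge q$ in $\{d_1,\dots,d_s\}$, $1\le k\le q$, and sequences $L=(l_1,\dots,l_p)$, $J=(j_1,\dots,j_q)$, each consisting of pairwise distinct elements of $\{1,\dots,n\}$ in arbitrary order, and for $\mathbf r=(1\le r_1<\dots<r_k\le p)$, let $L^{\mathbf r}$ be $L$ with the entry $l_{r_i}$ replaced by $j_i$ for $i=1,\dots,k$, and $J^{\mathbf r}=(l_{r_1},\dots,l_{r_k},j_{k+1},\dots,j_q)$.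 Then $$R^{k;a}_{L,J}=\varepsilon X^a_LX^a_J-\sum_{\mathbf r:\ \{l_{r_1},\dots,l_{r_k}\}\cap\{q+1,\dots,p\}=\emptyset}X^a_{L^{\mathbf r}}X^a_{J^{\mathbf r}},$$ where $\varepsilon=1$ if $\{j_1,\dots,j_k\}\cap\{q+1,\dots,p\}=\emptyset$ and $\varepsilon=0$ otherwise. $I^a(d_1,\dots,d_s)$ is the ideal of $\mathbb C[X^a_J]$ generated by all $R^{k;a}_{L,J}$. *)

theory Defs
  imports Complex_Main "HOL-Library.Poly_Mapping" "HOL-Library.FuncSet"
    "HOL-Library.Set_Algebras" "HOL-Algebra.Ideal"
begin

section \<open>The exterior algebra of \<open>\<complex>\<^sup>n\<close>\<close>

text \<open>
  The exterior algebra is the free complex vector space on the finite subsets \<open>J\<close> of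
  \<open>{1..n}\<close>: if \<open>j\<^sub>1 < \<dots> < j\<^sub>d\<close> are the elements of \<open>J\<close>, the basis vector
  \<^term>\<open>Poly_Mapping.single J 1\<close> is \<open>v\<^sub>J = v\<^bsub>j\<^sub>1\<^esub> \<and> \<dots> \<and> v\<^bsub>j\<^sub>d\<^esub>\<close>. In the same way a strictly
  increasing index sequence of a Pluecker variable is encoded by the set of its entries.
\<close>

type_synonym ext = "nat set \<Rightarrow>\<^sub>0 complex"

definition ext_scale :: "complex \<Rightarrow> ext \<Rightarrow> ext"
  where "ext_scale c v = Poly_Mapping.map ((*) c) v"

lemma lookup_ext_scale [simp]:
  "Poly_Mapping.lookup (ext_scale c v) J = c * Poly_Mapping.lookup v J"
  by (simp add: ext_scale_def Poly_Mapping.map.rep_eq when_def)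

global_interpretation ext: vector_space ext_scale
  by unfold_locales (auto intro!: poly_mapping_eqI simp: lookup_add algebra_simps)

definition idx :: "nat \<Rightarrow> nat \<Rightarrow> nat set set"
  where "idx n d = {J. J \<subseteq> {1..n} \<and> card J = d}"

text \<open>The sign of the permutation that sorts a sequence of distinct numbers.\<close>

definition seq_sign :: "nat list \<Rightarrow> complex"
  where "seq_sign js = (-1) ^ card {(a, b). a < b \<and> b < length js \<and> js ! b < js ! a}"

definition wedge :: "nat list \<Rightarrow> ext"
  where "wedge js = (if distinct js then Poly_Mapping.single (set js) (seq_sign js) else 0)"

text \<open>
  A matrix \<open>x\<close> acts on \<open>\<complex>\<^sup>n\<close> by \<open>x v\<^sub>j = \<Sum>\<^sub>i x i j v\<^sub>i\<close> and on the exterior algebra as a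
  derivation.
\<close>

definition ext_act :: "nat \<Rightarrow> (nat \<Rightarrow> nat \<Rightarrow> complex) \<Rightarrow> ext \<Rightarrow> ext"
  where "ext_act n x v =
    (\<Sum>J\<in>Poly_Mapping.keys v. ext_scale (Poly_Mapping.lookup v J)
      (let js = sorted_list_of_set J in
        \<Sum>r<length js. \<Sum>i\<in>{1..n}. ext_scale (x i (js ! r)) (wedge (js[r := i]))))"

definition nminus :: "nat \<Rightarrow> (nat \<Rightarrow> nat \<Rightarrow> complex) set"
  where "nminus n = {x. \<forall>a b. x a b \<noteq> 0 \<longrightarrow> 1 \<le> b \<and> b < a \<and> a \<le> n}"

definition root_vec :: "nat \<Rightarrow> nat \<Rightarrow> nat \<Rightarrow> nat \<Rightarrow> complex"
  where "root_vec i j = (\<lambda>a b. if a = j + 1 \<and> b = i then 1 else 0)"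

definition hw_vec :: "nat \<Rightarrow> ext"
  where "hw_vec d = wedge [1..<d + 1]"


section \<open>The PBW filtration and its associated graded space\<close>

text \<open>Since the span of the empty set is \<open>{0}\<close>, this includes \<open>F\<^bsub>-1\<^esub> = 0\<close>.\<close>

definition pbw :: "nat \<Rightarrow> nat \<Rightarrow> int \<Rightarrow> ext set"
  where "pbw n d t = ext.span
    {foldr (ext_act n) xs (hw_vec d) |xs. set xs \<subseteq> nminus n \<and> int (length xs) \<le> t}"

text \<open>
  An element of \<open>V\<^sup>a = \<Oplus>\<^sub>t F\<^sub>t / F\<^bsub>t-1\<^esub>\<close> is the family \<open>x\<close> of its homogeneous components, where
  \<open>x t\<close> is a coset of \<open>F\<^bsub>t-1\<^esub>\<close> contained in \<open>F\<^sub>t\<close>. Cosets are added by the elementwise sum of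
  sets. For a scalar multiple and for the image under an induced operator, \<open>F\<^bsub>t-1\<^esub>\<close> has to be
  added, since the elementwise image of a coset need not be a full coset.
\<close>

type_synonym gr = "nat \<Rightarrow> ext set"

definition gr_space :: "nat \<Rightarrow> nat \<Rightarrow> gr set"
  where "gr_space n d =
    {x. (\<forall>t. \<exists>u \<in> pbw n d (int t). x t = u +o pbw n d (int t - 1)) \<and>
        finite {t. x t \<noteq> pbw n d (int t - 1)}}"

definition gr_zero :: "nat \<Rightarrow> nat \<Rightarrow> gr"
  where "gr_zero n d = (\<lambda>t. pbw n d (int t - 1))"

definition gr_scale :: "nat \<Rightarrow> nat \<Rightarrow> complex \<Rightarrow> gr \<Rightarrow> gr"
  where "gr_scale n d c x = (\<lambda>t. ext_scale c ` x t + pbw n d (int t - 1))"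

definition gr_sum :: "('i \<Rightarrow> gr) \<Rightarrow> 'i set \<Rightarrow> gr"
  where "gr_sum x A = (\<lambda>t. \<Sum>a\<in>A. x a t)"

definition gr_act :: "nat \<Rightarrow> nat \<Rightarrow> (nat \<Rightarrow> nat \<Rightarrow> complex) \<Rightarrow> gr \<Rightarrow> gr"
  where "gr_act n d f x = (\<lambda>t. case t of
      0 \<Rightarrow> pbw n d (-1)
    | Suc s \<Rightarrow> ext_act n f ` x s + pbw n d (int s))"

text \<open>
  The exponential series; it is cut off at \<open>k = t\<close> because the induced operator raises the
  degree by one, so that its \<open>k\<close>-th power contributes nothing to degree \<open>t < k\<close>.
\<close>

definition gr_exp :: "nat \<Rightarrow> nat \<Rightarrow> (nat \<Rightarrow> nat \<Rightarrow> complex) \<Rightarrow> gr \<Rightarrow> gr"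
  where "gr_exp n d f x =
    (\<lambda>t. \<Sum>k\<le>t. gr_scale n d (1 / fact k) ((gr_act n d f ^^ k) x) t)"

definition deg :: "nat \<Rightarrow> nat set \<Rightarrow> nat"
  where "deg d J = card {j \<in> J. d < j}"

definition gr_vec :: "nat \<Rightarrow> nat \<Rightarrow> nat set \<Rightarrow> gr"
  where "gr_vec n d J =
    (\<lambda>t. (if t = deg d J then Poly_Mapping.single J 1 else 0) +o pbw n d (int t - 1))"

text \<open>\<^term>\<open>gr_coord n d x J\<close> is the value of \<open>X\<^sup>a\<^sub>J\<close>, the coordinate dual to the basis of the
  \<^term>\<open>gr_vec n d J\<close>, at the vector \<open>x\<close>.\<close>

definition gr_coord :: "nat \<Rightarrow> nat \<Rightarrow> gr \<Rightarrow> nat set \<Rightarrow> complex"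
  where "gr_coord n d x = (THE c. (\<forall>J. J \<notin> idx n d \<longrightarrow> c J = 0) \<and>
    x = gr_sum (\<lambda>J. gr_scale n d (c J) (gr_vec n d J)) (idx n d))"


section \<open>The product of projective spaces and the orbit\<close>

text \<open>A sequence \<open>d\<^sub>1 < \<dots> < d\<^sub>s\<close> enters through the set \<open>D\<close> of its members. The product of the
  projective spaces is indexed by these members.\<close>

definition gr_line :: "nat \<Rightarrow> nat \<Rightarrow> gr \<Rightarrow> gr set"
  where "gr_line n d x = {gr_scale n d c x |c. c \<noteq> 0}"

definition proj_space :: "nat \<Rightarrow> nat \<Rightarrow> gr set set"
  where "proj_space n d = gr_line n d ` (gr_space n d - {gr_zero n d})"

definition proj_prod :: "nat \<Rightarrow> nat set \<Rightarrow> (nat \<Rightarrow> gr set) set"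
  where "proj_prod n D = (\<Pi>\<^sub>E d\<in>D. proj_space n d)"

definition group_elt :: "nat \<Rightarrow> (nat \<Rightarrow> nat \<Rightarrow> complex) \<Rightarrow> nat \<Rightarrow> nat \<Rightarrow> complex"
  where "group_elt n c = (\<lambda>a b. \<Sum>j\<in>{1..n - 1}. \<Sum>i\<in>{1..j}. c i j * root_vec i j a b)"

definition group_act ::
  "nat \<Rightarrow> nat set \<Rightarrow> (nat \<Rightarrow> nat \<Rightarrow> complex) \<Rightarrow> (nat \<Rightarrow> gr set) \<Rightarrow> nat \<Rightarrow> gr set"
  where "group_act n D c \<pi> = (\<lambda>d\<in>D. gr_exp n d (group_elt n c) ` \<pi> d)"

definition base_point :: "nat \<Rightarrow> nat set \<Rightarrow> nat \<Rightarrow> gr set"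
  where "base_point n D = (\<lambda>d\<in>D. gr_line n d (gr_vec n d {1..d}))"

definition orbit :: "nat \<Rightarrow> nat set \<Rightarrow> (nat \<Rightarrow> gr set) set"
  where "orbit n D = {group_act n D c (base_point n D) |c. True}"


section \<open>Multi-homogeneous polynomials\<close>

type_synonym mpoly = "(nat set \<Rightarrow>\<^sub>0 nat) \<Rightarrow>\<^sub>0 complex"

definition plucker_ring :: "nat \<Rightarrow> nat set \<Rightarrow> mpoly ring"
  where "plucker_ring n D =
    \<lparr>carrier = {p. \<forall>m\<in>Poly_Mapping.keys p. Poly_Mapping.keys m \<subseteq> (\<Union>d\<in>D. idx n d)},
     monoid.mult = (*), one = 1, ring.zero = 0, add = (+)\<rparr>"

lemma cring_plucker_ring: "cring (plucker_ring n D)"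
proof -
  define V where "V = (\<Union>d\<in>D. idx n d)"
  define C where "C = {p::mpoly. \<forall>m\<in>Poly_Mapping.keys p. Poly_Mapping.keys m \<subseteq> V}"
  have add: "p + q \<in> C" if "p \<in> C" "q \<in> C" for p q
    using that Poly_Mapping.keys_add[of p q] unfolding C_def by blast
  have mult: "p * q \<in> C" if pq: "p \<in> C" "q \<in> C" for p q
  proof -
    have "Poly_Mapping.keys m \<subseteq> V" if m: "m \<in> Poly_Mapping.keys (p * q)" for m
    proof -
      obtain a b where "m = a + b" "a \<in> Poly_Mapping.keys p" "b \<in> Poly_Mapping.keys q"
        using m keys_mult[of p q] by auto
      then show ?thesis
        using pq Poly_Mapping.keys_add[of a b] unfolding C_def by blast
    qed
    then show ?thesis unfolding C_def by blast
  qed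
  have neg: "- p \<in> C" if "p \<in> C" for p
    using that by (simp add: C_def)
  have zero: "0 \<in> C" and one: "1 \<in> C" by (simp_all add: C_def)
  have R: "plucker_ring n D = \<lparr>carrier = C, monoid.mult = (*), one = 1, ring.zero = 0, add = (+)\<rparr>"
    by (simp add: plucker_ring_def C_def V_def)
  show ?thesis
    unfolding R
  proof (rule cringI)
    show "abelian_group \<lparr>carrier = C, monoid.mult = (*), one = 1, ring.zero = 0, add = (+)\<rparr>"
    proof (rule abelian_groupI, goal_cases)
      case (6 p)
      then show ?case using neg[of p] by (intro bexI[of _ "-p"]) simp_all
    qed (simp_all add: add zero add.assoc add.commute)
    show "comm_monoid \<lparr>carrier = C, monoid.mult = (*), one = 1, ring.zero = 0, add = (+)\<rparr>"
      by (rule comm_monoidI) (simp_all add: mult one mult.assoc mult.commute)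
  qed (simp add: distrib_right)
qed

definition eval_mpoly :: "(nat set \<Rightarrow> complex) \<Rightarrow> mpoly \<Rightarrow> complex"
  where "eval_mpoly x p = (\<Sum>m\<in>Poly_Mapping.keys p. Poly_Mapping.lookup p m *
    (\<Prod>J\<in>Poly_Mapping.keys m. x J ^ Poly_Mapping.lookup m J))"

definition multi_homogeneous :: "nat set \<Rightarrow> mpoly \<Rightarrow> bool"
  where "multi_homogeneous D p \<longleftrightarrow> (\<exists>e. \<forall>m\<in>Poly_Mapping.keys p. \<forall>d\<in>D.
    (\<Sum>J\<in>{J \<in> Poly_Mapping.keys m. card J = d}. Poly_Mapping.lookup m J) = e d)"

definition mh_polys :: "nat \<Rightarrow> nat set \<Rightarrow> mpoly set"
  where "mh_polys n D = {p \<in> carrier (plucker_ring n D). multi_homogeneous D p}"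

definition vanishes_at :: "nat \<Rightarrow> nat set \<Rightarrow> mpoly \<Rightarrow> (nat \<Rightarrow> gr set) \<Rightarrow> bool"
  where "vanishes_at n D p \<pi> \<longleftrightarrow>
    (\<forall>x. (\<forall>d\<in>D. x d \<in> \<pi> d) \<longrightarrow>
      eval_mpoly (\<lambda>J. gr_coord n (card J) (x (card J)) J) p = 0)"

definition vanishing_ideal :: "nat \<Rightarrow> nat set \<Rightarrow> (nat \<Rightarrow> gr set) set \<Rightarrow> mpoly set"
  where "vanishing_ideal n D R =
    Idl\<^bsub>plucker_ring n D\<^esub> {p \<in> mh_polys n D. \<forall>\<pi>\<in>R. vanishes_at n D p \<pi>}"

definition zariski_closed :: "nat \<Rightarrow> nat set \<Rightarrow> (nat \<Rightarrow> gr set) set \<Rightarrow> bool"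
  where "zariski_closed n D Z \<longleftrightarrow> (\<exists>S \<subseteq> mh_polys n D.
    Z = {\<pi> \<in> proj_prod n D. \<forall>p\<in>S. vanishes_at n D p \<pi>})"

definition degenerate_flag_variety :: "nat \<Rightarrow> nat set \<Rightarrow> (nat \<Rightarrow> gr set) set"
  where "degenerate_flag_variety n D = zariski_closed n D hull orbit n D"


section \<open>Degenerate Pluecker relations\<close>

definition plucker_var :: "nat list \<Rightarrow> mpoly"
  where "plucker_var js = (if distinct js
    then Poly_Mapping.single (Poly_Mapping.single (set js) 1) (seq_sign js) else 0)"

text \<open>
  List positions count from 0, so \<open>rs\<close> lists the numbers \<open>r\<^sub>1 - 1 < \<dots> < r\<^sub>k - 1\<close>. The list
  \<^term>\<open>zip rs J\<close> has length \<open>k\<close> and pairs the \<open>i\<close>-th entry of \<open>rs\<close> with \<open>j\<^sub>i\<close>.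
\<close>

definition exch_left :: "nat list \<Rightarrow> nat list \<Rightarrow> nat list \<Rightarrow> nat list"
  where "exch_left L J rs = fold (\<lambda>(r, j) M. M[r := j]) (zip rs J) L"

definition exch_right :: "nat list \<Rightarrow> nat list \<Rightarrow> nat list \<Rightarrow> nat list"
  where "exch_right L J rs = map ((!) L) rs @ drop (length rs) J"

definition plucker_rel :: "nat \<Rightarrow> nat list \<Rightarrow> nat list \<Rightarrow> mpoly"
  where "plucker_rel k L J = (let p = length L; q = length J in
    (if set (take k J) \<inter> {q + 1..p} = {} then plucker_var L * plucker_var J else 0)
    - (\<Sum>rs \<in> {rs. sorted_wrt (<) rs \<and> length rs = k \<and> set rs \<subseteq> {..<p} \<and>
                  (!) L ` set rs \<inter> {q + 1..p} = {}}.
        plucker_var (exch_left L J rs) * plucker_var (exch_right L J rs)))"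

definition plucker_ideal :: "nat \<Rightarrow> nat set \<Rightarrow> mpoly set"
  where "plucker_ideal n D = Idl\<^bsub>plucker_ring n D\<^esub>
    {plucker_rel k L J |k L J.
      length L \<in> D \<and> length J \<in> D \<and> length J \<le> length L \<and> 1 \<le> k \<and> k \<le> length J \<and>
      distinct L \<and> distinct J \<and> set L \<subseteq> {1..n} \<and> set J \<subseteq> {1..n}}"

end

theory Submission
  imports Defs "Jordan_Normal_Form.Char_Poly"
begin

text \<open>
  On the orbit, \<open>X\<^sup>a\<^sub>J\<close> is the minor with columns \<open>J\<close> of the matrix with rows
  \<open>v\<^sub>i + \<Sum>\<^bsub>j>d\<^esub> z\<^sub>i\<^sub>j v\<^sub>j\<close>, \<open>i \<le> d\<close>, where the \<open>z\<^sub>i\<^sub>j\<close> are independent variables. The relations hold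
  there by Cramer's rule, because the first \<open>q\<close> rows of the matrix for \<open>p \<ge> q\<close> are the rows of the
  matrix for \<open>q\<close> with the columns \<open>q + 1, \<dots>, p\<close> set to zero.

  Conversely, fill the entries of \<open>J\<close> into a column of length \<open>d\<close> such that the elements up to \<open>d\<close> stay
  in their own row and the others decrease downwards. If a pair of columns is not standard (some entry
  of the shorter column is not dominated by an entry of the longer column in the same row or below),
  exchanging the top part of the shorter column by a relation makes that column smaller in the
  lexicographic order from the bottom, so standard monomials span modulo the relations. They are
  linearly independent on the orbit: for a suitable one-parameter substitution the leading term of the
  minor of \<open>J\<close> is the product of the \<open>z\<^sub>i\<^sub>j\<close> over the rows \<open>i\<close> with entry \<open>j > d\<close>, and a standard
  monomial is recovered from the multiset of these pairs \<open>(i, j)\<close>, since its largest column consists of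
  the maximal pairs that fit.
\<close>

text \<open>A relation drops every product that would move an index from \<open>{q + 1..p}\<close>
  into the shorter column, so straightening must choose a top part avoiding these indices. A
  violation in row \<open>i\<close> with entry \<open>b > p\<close> suggests the window of all
  indices below \<open>i\<close> or at least \<open>b\<close>. The shorter column has exactly
  \<open>i\<close> members there and the longer one fewer than \<open>i\<close>; hence any
  \<open>i\<close> indices coming back from the longer column include one outside the window, and
  this is what makes the shorter column smaller. The other column produced by the exchange is not
  controlled. The termination measure must tolerate any partner: columns are weighted by powers of
  3, so that the gain on the improved column alone outweighs the loss of both old ones. For
  independence the obstacle is that different monomials might share a leading term. Exponents that
  are powers of a large base \<open>Q\<close> turn the degree of a product of minors into a number
  whose digits count the pairs \<open>(i, j)\<close>, so that within one multi-degree equal degrees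
  force equal standard monomials.\<close>

abbreviation "keys \<equiv> Poly_Mapping.keys"
abbreviation "lookup \<equiv> Poly_Mapping.lookup"
abbreviation "single \<equiv> Poly_Mapping.single"

section \<open>Signs of sequences\<close>

lemma seq_sign_Cons:
  assumes "distinct (x # L)"
  shows "seq_sign (x # L) = (-1) ^ card {y \<in> set L. y < x} * seq_sign L"
proof -
  let ?I = "\<lambda>js. {(a, b). a < b \<and> b < length js \<and> js ! b < (js ! a :: nat)}"
  let ?X = "(\<lambda>b. (0::nat, Suc b)) ` {b. b < length L \<and> L ! b < x}"
  let ?Y = "(\<lambda>(a, b). (Suc a, Suc b)) ` ?I L"
  have fin: "finite (?I js)" for js
    by (rule finite_subset[of _ "{..<length js} \<times> {..<length js}"]) auto
  have "?I (x # L) = ?X \<union> ?Y"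
  proof (rule Set.set_eqI)
    fix ab :: "nat \<times> nat"
    obtain a b where ab: "ab = (a, b)" by fastforce
    show "ab \<in> ?I (x # L) \<longleftrightarrow> ab \<in> ?X \<union> ?Y"
      unfolding ab by (cases a; cases b) (auto simp: image_iff)
  qed
  moreover have "?X \<inter> ?Y = {}" by auto
  ultimately have "card (?I (x # L)) = card ?X + card ?Y"
    using fin by (simp add: card_Un_disjoint)
  moreover have "card ?Y = card (?I L)"
    by (rule card_image) (auto simp: inj_on_def)
  moreover have "card ?X = card {b. b < length L \<and> L ! b < x}"
    by (rule card_image) (auto simp: inj_on_def)
  moreover have "card {b. b < length L \<and> L ! b < x} = card ((!) L ` {b. b < length L \<and> L ! b < x})"
    using assms by (intro card_image[symmetric]) (auto simp: inj_on_def nth_eq_iff_index_eq)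
  moreover have "(!) L ` {b. b < length L \<and> L ! b < x} = {y \<in> set L. y < x}"
    by (auto simp: in_set_conv_nth)
  ultimately show ?thesis
    by (simp add: seq_sign_def power_add)
qed

lemma seq_sign_sorted: "sorted js \<Longrightarrow> seq_sign js = 1"
proof -
  assume "sorted js"
  then have "{(a, b). a < b \<and> b < length js \<and> js ! b < js ! a} = {}"
    by (auto simp: sorted_iff_nth_mono) (metis leD less_imp_le)
  then show ?thesis unfolding seq_sign_def by (simp only: card.empty power_0)
qed

lemma seq_sign_square: "seq_sign js * seq_sign js = 1"
  by (simp add: seq_sign_def flip: power_add)

lemma seq_sign_nonzero: "seq_sign js \<noteq> 0"
  by (simp add: seq_sign_def)

text \<open>The sign is pulled out by insertion sort.\<close>

lemma alternating_eq_seq_sign: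
  fixes F :: "nat list \<Rightarrow> complex"
  assumes alt: "\<And>xs x y ys. length xs + length ys + 2 = d \<Longrightarrow> F (xs @ x # y # ys) = - F (xs @ y # x # ys)"
  assumes "distinct L" "length L = d"
  shows "F L = seq_sign L * F (sorted_list_of_set (set L))"
proof -
  have move: "F (xs @ x # ys @ zs) = (-1) ^ length ys * F (xs @ ys @ x # zs)"
    if "length xs + length ys + length zs + 1 = d" for xs x ys zs
    using that
  proof (induction ys arbitrary: xs)
    case (Cons y ys)
    have "F (xs @ x # y # ys @ zs) = - F (xs @ y # x # ys @ zs)"
      using Cons.prems by (intro alt) simp
    also have "\<dots> = - ((-1) ^ length ys * F ((xs @ [y]) @ ys @ x # zs))"
      using Cons.IH[of "xs @ [y]"] Cons.prems by simp
    finally show ?case by simp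
  qed simp
  have "F (xs @ L) = seq_sign L * F (xs @ sorted_list_of_set (set L))"
    if "distinct L" "length xs + length L = d" for xs
    using that
  proof (induction L arbitrary: xs)
    case (Cons x L)
    define S where "S = sorted_list_of_set (set L)"
    define ys where "ys = filter (\<lambda>y. y < x) S"
    define zs where "zs = filter (\<lambda>y. \<not> y < x) S"
    have "sorted S" "set S = set L" "distinct S" by (simp_all add: S_def)
    have lenS: "length S = length L"
      using Cons.prems by (simp add: S_def distinct_card)
    have S: "S = ys @ zs"
      unfolding ys_def zs_def using \<open>sorted S\<close>
    proof (induction S)
      case (Cons a S)
      show ?case
      proof (cases "a < x")
        case False
        with Cons.prems have "filter (\<lambda>y. y < x) S = []" "filter (\<lambda>y. \<not> y < x) S = S"
          by (auto simp: filter_empty_conv filter_id_conv)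
        with False show ?thesis by simp
      qed (use Cons in simp)
    qed simp
    have "sorted_list_of_set (set (x # L)) = ys @ x # zs"
    proof (rule sorted_distinct_set_unique)
      show "sorted (ys @ x # zs)"
        using \<open>sorted S\<close> unfolding S by (auto simp: sorted_append ys_def zs_def)
      show "distinct (ys @ x # zs)"
        using \<open>distinct S\<close> Cons.prems \<open>set S = set L\<close> unfolding S
        by (auto simp: ys_def zs_def)
      show "set (sorted_list_of_set (set (x # L))) = set (ys @ x # zs)"
        using \<open>set S = set L\<close> unfolding S by (simp del: sorted_list_of_set_insert_remove)
    qed (rule sorted_sorted_list_of_set distinct_sorted_list_of_set)+
    moreover have "card {y \<in> set L. y < x} = length ys"
    proof -
      have "{y \<in> set L. y < x} = set ys" using \<open>set S = set L\<close> by (auto simp: ys_def)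
      then show ?thesis using \<open>distinct S\<close> by (metis distinct_card distinct_filter ys_def)
    qed
    moreover have "F (xs @ x # L) = seq_sign L * F ((xs @ [x]) @ S)"
      using Cons.IH[of "xs @ [x]"] Cons.prems by (simp add: S_def)
    moreover have "F ((xs @ [x]) @ S) = (-1) ^ length ys * F (xs @ ys @ x # zs)"
      using move[of xs ys zs x] Cons.prems lenS unfolding S by simp
    moreover have "seq_sign (x # L) = (-1) ^ card {y \<in> set L. y < x} * seq_sign L"
      using Cons.prems by (intro seq_sign_Cons) simp
    ultimately show ?case by simp
  qed (simp add: seq_sign_sorted)
  from this[of "[]"] assms show ?thesis by simp
qed

lemma seq_sign_swap:
  assumes "distinct (xs @ x # y # ys)"
  shows "seq_sign (xs @ x # y # ys) = - seq_sign (xs @ y # x # ys)"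
  using assms
proof (induction xs)
  case Nil
  let ?n = "\<lambda>x. card {z \<in> set ys. z < x}"
  have c: "card {z \<in> set (b # ys). z < a} = (if b < a then Suc (?n a) else ?n a)" if "b \<notin> set ys" for a b
  proof -
    have "{z \<in> set (b # ys). z < a} = (if b < a then insert b {z \<in> set ys. z < a} else {z \<in> set ys. z < a})"
      by auto
    then show ?thesis using that by simp
  qed
  have "distinct (x # y # ys)" "distinct (y # x # ys)" "distinct (y # ys)" "distinct (x # ys)"
    using Nil by auto
  note sgn = this[THEN seq_sign_Cons]
  show ?case
  proof (cases "x < y")
    case True
    with Nil have "card {z \<in> set (x # ys). z < y} = Suc (?n y)" "card {z \<in> set (y # ys). z < x} = ?n x"
      by (subst c; simp)+
    then show ?thesis by (simp add: sgn del: set_simps)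
  next
    case False
    with Nil have "card {z \<in> set (y # ys). z < x} = Suc (?n x)" "card {z \<in> set (x # ys). z < y} = ?n y"
      by (subst c; simp)+
    then show ?thesis by (simp add: sgn del: set_simps)
  qed
next
  case (Cons z xs)
  then show ?case by (simp add: seq_sign_Cons insert_commute)
qed

text \<open>The sign of a list after substituting \<open>b\<close> for \<open>a\<close> alternates
  in the list. On the sorted \<open>J\<close> with \<open>b\<close> turned back into
  \<open>a\<close> it equals 1, and sorting that list compares this value with the one at the sorted
  \<open>K\<close>. The lemma lets the coefficient of the basis vector of \<open>J\<close> in the
  image of that of \<open>K\<close> be read off from the list of \<open>J\<close>.\<close>

lemma seq_sign_replace:
  assumes "finite K" "a \<in> K" "b \<notin> K"
  defines "J \<equiv> insert b (K - {a})"
  shows "seq_sign (map (\<lambda>x. if x = a then b else x) (sorted_list_of_set K))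
    = seq_sign (map (\<lambda>x. if x = b then a else x) (sorted_list_of_set J))"
proof -
  let ?f = "\<lambda>x. if x = a then b else x" and ?g = "\<lambda>x. if x = b then a else x"
  \<comment> \<open>The value 0 on lists with a repetition or containing \<open>b\<close> makes
    \<open>F\<close> alternate on all lists, as \<open>alternating_eq_seq_sign\<close>
    requires.\<close>
  define F where "F L = (if distinct L \<and> b \<notin> set L then seq_sign (map ?f L) else 0)" for L
  define L where "L = map ?g (sorted_list_of_set J)"
  have "finite J" using assms by (simp add: J_def)
  have inj: "inj_on ?g J" using assms by (auto simp: J_def inj_on_def)
  have "set L = ?g ` J" using \<open>finite J\<close> by (simp add: L_def)
  also have "\<dots> = K" unfolding J_def using assms(2,3) by (auto simp: image_iff)
  finally have L: "distinct L" "set L = K"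
    using inj \<open>finite J\<close> by (simp_all add: L_def distinct_map)
  have fg: "map ?f L = sorted_list_of_set J"
    unfolding L_def map_map
  proof (rule map_idI)
    fix x assume "x \<in> set (sorted_list_of_set J)"
    then have "x \<in> J" using \<open>finite J\<close> by simp
    then show "(?f \<circ> ?g) x = x" using assms(2,3) by (auto simp: J_def)
  qed
  have alt: "F (xs @ x # y # ys) = - F (xs @ y # x # ys)" for xs x y ys
  proof (cases "distinct (xs @ x # y # ys) \<and> b \<notin> set (xs @ x # y # ys)")
    case True
    let ?l = "xs @ x # y # ys"
    have "inj_on ?f (- {b})" by (auto simp: inj_on_def)
    then have "inj_on ?f (set ?l)" by (rule inj_on_subset) (use True in blast)
    then have "distinct (map ?f ?l)" using True by (simp only: distinct_map)
    then have "seq_sign (map ?f ?l) = - seq_sign (map ?f (xs @ y # x # ys))"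
      unfolding map_append list.map by (rule seq_sign_swap)
    moreover have "distinct (xs @ y # x # ys) \<and> b \<notin> set (xs @ y # x # ys)"
      using True by auto
    ultimately show ?thesis using True unfolding F_def by presburger
  next
    case False
    then have "\<not> (distinct (xs @ y # x # ys) \<and> b \<notin> set (xs @ y # x # ys))" by auto
    with False show ?thesis unfolding F_def by (simp only: if_False minus_zero)
  qed
  have "F L = seq_sign L * F (sorted_list_of_set K)"
    using alternating_eq_seq_sign[of "length L" F L, OF alt] L by simp
  moreover have "F L = 1"
    using L assms(3) by (simp add: F_def fg seq_sign_sorted)
  moreover have "F (sorted_list_of_set K) = seq_sign (map ?f (sorted_list_of_set K))"
    using assms by (simp add: F_def)
  ultimately have "1 = seq_sign L * seq_sign (map ?f (sorted_list_of_set K))" by simp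
  then have "seq_sign L = (seq_sign L * seq_sign L) * seq_sign (map ?f (sorted_list_of_set K))"
    by simp
  then show ?thesis by (simp add: seq_sign_square L_def)
qed

section \<open>Determinants given by rows\<close>

text \<open>With rows as functions, replacing or exchanging a row is a function update. Only the
  block of size \<open>p\<close> is read, so the same rows serve for minors of different
  sizes.\<close>

definition rows_det :: "nat \<Rightarrow> (nat \<Rightarrow> nat \<Rightarrow> 'a::comm_ring_1) \<Rightarrow> 'a"
  where "rows_det p f = det (mat p p (\<lambda>(i, j). f i j))"

lemma rows_det_cong:
  "(\<And>i j. i < p \<Longrightarrow> j < p \<Longrightarrow> f i j = g i j) \<Longrightarrow> rows_det p f = rows_det p g"
  unfolding rows_det_def by (rule arg_cong[of _ _ det]) (auto intro!: eq_matI)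

lemma rows_det_expand:
  "rows_det p f = (\<Sum>\<pi> | \<pi> permutes {0..<p}. signof \<pi> * (\<Prod>i = 0..<p. f i (\<pi> i)))"
proof -
  have "(\<Prod>i = 0..<p. mat p p (\<lambda>(i, j). f i j) $$ (i, \<pi> i)) = (\<Prod>i = 0..<p. f i (\<pi> i))"
    if "\<pi> permutes {0..<p}" for \<pi>
  proof (rule prod.cong)
    fix i assume "i \<in> {0..<p}"
    moreover from this have "\<pi> i \<in> {0..<p}" using permutes_in_image[OF that, of i] by simp
    ultimately show "mat p p (\<lambda>(i, j). f i j) $$ (i, \<pi> i) = f i (\<pi> i)" by simp
  qed simp
  then show ?thesis unfolding rows_det_def by (subst det_def'[of _ p]) (auto intro!: sum.cong)
qed

lemma rows_det_linear:
  assumes "m < p"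
  shows "rows_det p (f(m := \<lambda>j. \<Sum>r\<in>S. c r * u r j)) = (\<Sum>r\<in>S. c r * rows_det p (f(m := u r)))"
proof -
  have split: "(\<Prod>i = 0..<p. (f(m := v)) i (\<pi> i)) = v (\<pi> m) * (\<Prod>i\<in>{0..<p} - {m}. f i (\<pi> i))" for v \<pi>
  proof -
    have "(\<Prod>i = 0..<p. (f(m := v)) i (\<pi> i))
        = (f(m := v)) m (\<pi> m) * (\<Prod>i\<in>{0..<p} - {m}. (f(m := v)) i (\<pi> i))"
      using assms by (intro prod.remove) auto
    also have "(\<Prod>i\<in>{0..<p} - {m}. (f(m := v)) i (\<pi> i)) = (\<Prod>i\<in>{0..<p} - {m}. f i (\<pi> i))"
      by (rule prod.cong) auto
    finally show ?thesis by simp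
  qed
  show ?thesis
    unfolding rows_det_expand split sum_distrib_right sum_distrib_left
    by (subst sum.swap) (simp add: algebra_simps)
qed

lemma rows_det_zero_row:
  assumes "m < p" "\<And>j. j < p \<Longrightarrow> f m j = 0"
  shows "rows_det p f = 0"
proof -
  have "rows_det p f = rows_det p (f(m := \<lambda>j. \<Sum>r\<in>{}. 0 * f r j))"
    by (rule rows_det_cong) (use assms in auto)
  then show ?thesis using rows_det_linear[OF assms(1), of f "\<lambda>_. 0" f "{}"] by simp
qed

lemma rows_det_swap:
  assumes "i \<noteq> j" "i < p" "j < p"
  shows "rows_det p (f(i := f j, j := f i)) = - rows_det p f"
proof -
  have "mat p p (\<lambda>(a, b). (f(i := f j, j := f i)) a b) = swaprows i j (mat p p (\<lambda>(a, b). f a b))"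
    using assms by (auto intro!: eq_matI simp: mat_swaprows_def)
  then show ?thesis
    unfolding rows_det_def by (simp only:) (rule det_swaprows[where n = p], use assms in auto)
qed

lemma rows_det_eq_rows:
  assumes "i \<noteq> j" "i < p" "j < p" "\<And>b. b < p \<Longrightarrow> f i b = f j b"
  shows "rows_det p f = 0"
  unfolding rows_det_def
  by (rule det_identical_rows[of _ p i j]) (use assms in \<open>auto intro!: eq_vecI\<close>)

lemma rows_det_id: "(\<And>i j. i < p \<Longrightarrow> j < p \<Longrightarrow> f i j = (if i = j then 1 else 0)) \<Longrightarrow> rows_det p f = 1"
proof -
  assume "\<And>i j. i < p \<Longrightarrow> j < p \<Longrightarrow> f i j = (if i = j then 1 else 0)"
  then have "mat p p (\<lambda>(i, j). f i j) = 1\<^sub>m p" by (intro eq_matI) auto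
  then show ?thesis by (simp add: rows_det_def)
qed

lemma poly_rows_det: "poly (rows_det p F) t = rows_det p (\<lambda>i j. poly (F i j) t)"
proof -
  have "poly (signof \<pi> :: 'a poly) t = signof \<pi>" for \<pi> :: "nat \<Rightarrow> nat"
    by (cases \<pi> rule: sign_cases) simp_all
  then show ?thesis by (simp add: rows_det_expand poly_sum poly_prod)
qed

section \<open>The exchange identity\<close>

definition pos :: "nat list \<Rightarrow> nat \<Rightarrow> nat"
  where "pos rs j = (THE m. m < length rs \<and> rs ! m = j)"

lemma pos_nth: "distinct rs \<Longrightarrow> m < length rs \<Longrightarrow> pos rs (rs ! m) = m"
  unfolding pos_def by (rule the_equality) (auto simp: nth_eq_iff_index_eq)

definition replace_rows :: "nat list \<Rightarrow> (nat \<Rightarrow> 'a) \<Rightarrow> (nat \<Rightarrow> 'a) \<Rightarrow> nat \<Rightarrow> 'a"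
  where "replace_rows rs w l j = (if j \<in> set rs then w (pos rs j) else l j)"

definition append_rows :: "nat \<Rightarrow> (nat \<Rightarrow> 'a) \<Rightarrow> (nat \<Rightarrow> 'a) \<Rightarrow> nat \<Rightarrow> 'a"
  where "append_rows k w y j = (if j < k then w j else y j)"

lemma replace_rows_upd:
  assumes "distinct rs" "m < length rs"
  shows "replace_rows rs (w(m := x)) l = (replace_rows rs w l)(rs ! m := x)"
proof
  fix j
  show "replace_rows rs (w(m := x)) l j = ((replace_rows rs w l)(rs ! m := x)) j"
  proof (cases "j \<in> set rs")
    case True
    then obtain m' where "m' < length rs" "j = rs ! m'" by (auto simp: in_set_conv_nth)
    then show ?thesis using assms
      by (auto simp: replace_rows_def pos_nth nth_eq_iff_index_eq)
  next
    case False
    then have "j \<noteq> rs ! m" using assms by auto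
    with False show ?thesis by (simp add: replace_rows_def)
  qed
qed

lemma append_rows_upd: "m < k \<Longrightarrow> append_rows k (w(m := x)) y = (append_rows k w y)(m := x)"
  by (auto simp: append_rows_def)

definition index_seqs :: "nat \<Rightarrow> nat \<Rightarrow> nat list set"
  where "index_seqs p k = {rs. sorted_wrt (<) rs \<and> length rs = k \<and> set rs \<subseteq> {..<p}}"

lemma index_seqsD:
  assumes "rs \<in> index_seqs p k"
  shows "distinct rs" "length rs = k" "set rs \<subseteq> {..<p}" "sorted_wrt (<) rs" "m < k \<Longrightarrow> rs ! m < p"
  using assms nth_mem[of m rs] by (auto simp: index_seqs_def strict_sorted_iff simp del: nth_mem)

lemma finite_index_seqs: "finite (index_seqs p k)"
  by (rule finite_subset[OF _ finite_lists_length_eq[of "{..<p}" k]])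
    (auto simp: index_seqs_def)

text \<open>As a function of \<open>w\<close> the defect is multilinear and alternating, so it can
  be tested on rows of \<open>l\<close>. The rows \<open>l\<close> and \<open>w\<close> are meant to
  have \<open>p\<close> entries; \<open>rows_det q\<close> reads the first \<open>q\<close> of them,
  which is the truncation relating two column sizes.\<close>

definition exchange_defect ::
  "nat \<Rightarrow> nat \<Rightarrow> nat \<Rightarrow> (nat \<Rightarrow> nat \<Rightarrow> 'a) \<Rightarrow> (nat \<Rightarrow> nat \<Rightarrow> 'a) \<Rightarrow> (nat \<Rightarrow> nat \<Rightarrow> 'a) \<Rightarrow> 'a::comm_ring_1"
  where "exchange_defect p q k l y w =
    rows_det p l * rows_det q (append_rows k w y)
    - (\<Sum>rs\<in>index_seqs p k.
        rows_det p (replace_rows rs w l) * rows_det q (append_rows k (\<lambda>m. l (rs ! m)) y))"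

lemma exchange_defect_linear:
  assumes "m < k" "k \<le> q"
  shows "exchange_defect p q k l y (w(m := \<lambda>j. \<Sum>r\<in>S. c r * u r j))
    = (\<Sum>r\<in>S. c r * exchange_defect p q k l y (w(m := u r)))"
proof -
  have a: "rows_det q (append_rows k (w(m := \<lambda>j. \<Sum>r\<in>S. c r * u r j)) y)
      = (\<Sum>r\<in>S. c r * rows_det q (append_rows k (w(m := u r)) y))"
    using assms by (simp add: append_rows_upd rows_det_linear)
  have b: "rows_det p (replace_rows rs (w(m := \<lambda>j. \<Sum>r\<in>S. c r * u r j)) l)
      = (\<Sum>r\<in>S. c r * rows_det p (replace_rows rs (w(m := u r)) l))"
    if "rs \<in> index_seqs p k" for rs
  proof -
    have "distinct rs" "m < length rs" "rs ! m < p"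
      using index_seqsD[OF that] assms by auto
    then show ?thesis by (simp add: replace_rows_upd rows_det_linear)
  qed
  let ?Q = "\<lambda>rs. rows_det q (append_rows k (\<lambda>m. l (rs ! m)) y)"
  have "(\<Sum>rs\<in>index_seqs p k.
        rows_det p (replace_rows rs (w(m := \<lambda>j. \<Sum>r\<in>S. c r * u r j)) l) * ?Q rs)
      = (\<Sum>rs\<in>index_seqs p k. \<Sum>r\<in>S. c r * (rows_det p (replace_rows rs (w(m := u r)) l) * ?Q rs))"
    by (rule sum.cong) (simp_all add: b sum_distrib_right mult.assoc)
  also have "\<dots> = (\<Sum>r\<in>S. c r * (\<Sum>rs\<in>index_seqs p k. rows_det p (replace_rows rs (w(m := u r)) l) * ?Q rs))"
    by (subst sum.swap) (simp add: sum_distrib_left)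
  finally show ?thesis
    unfolding exchange_defect_def a
    by (simp add: sum_distrib_left sum_subtractf right_diff_distrib mult.left_commute)
qed

lemma exchange_defect_swap:
  assumes "m < k" "m' < k" "m \<noteq> m'" "k \<le> q"
  shows "exchange_defect p q k l y (w(m := w m', m' := w m)) = - exchange_defect p q k l y w"
proof -
  have "rows_det q (append_rows k (w(m := w m', m' := w m)) y) = - rows_det q (append_rows k w y)"
  proof -
    have "append_rows k (w(m := w m', m' := w m)) y
        = (append_rows k w y)(m := append_rows k w y m', m' := append_rows k w y m)"
      using assms by (auto simp: append_rows_def fun_eq_iff)
    then show ?thesis using assms by (simp add: rows_det_swap)
  qed
  moreover have "rows_det p (replace_rows rs (w(m := w m', m' := w m)) l)
      = - rows_det p (replace_rows rs w l)" if "rs \<in> index_seqs p k" for rs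
  proof -
    have *: "distinct rs" "m < length rs" "rs ! m < p" "m' < length rs" "rs ! m' < p"
      using index_seqsD[OF that] assms by auto
    then have "rs ! m \<noteq> rs ! m'" using assms by (simp add: nth_eq_iff_index_eq)
    moreover have "replace_rows rs (w(m := w m', m' := w m)) l
        = (replace_rows rs w l)(rs ! m := replace_rows rs w l (rs ! m'),
            rs ! m' := replace_rows rs w l (rs ! m))"
      using * by (simp add: replace_rows_upd) (simp add: replace_rows_def pos_nth)
    ultimately show ?thesis using * by (simp add: rows_det_swap)
  qed
  ultimately show ?thesis
    by (simp add: exchange_defect_def sum_negf)
qed

text \<open>If \<open>rs\<close> differs from \<open>s\<close>, some row \<open>s ! m\<close> of
  \<open>l\<close> stays in place and is also inserted elsewhere, so the minor has two equal rows.
  The term of \<open>s\<close> itself changes nothing and equals the leading product.\<close>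

lemma exchange_defect_rows_sorted:
  assumes "sorted_wrt (<) s" "length s = k" "set s \<subseteq> {..<p}"
  shows "exchange_defect p q k l y (\<lambda>m. l (s ! m)) = 0"
proof -
  have s: "s \<in> index_seqs p k" "distinct s"
    using assms by (auto simp: index_seqs_def strict_sorted_iff)
  have zero: "rows_det p (replace_rows rs (\<lambda>m. l (s ! m)) l) = 0"
    if rs: "rs \<in> index_seqs p k" "rs \<noteq> s" for rs
  proof -
    have rs': "distinct rs" "length rs = k" "set rs \<subseteq> {..<p}" "sorted_wrt (<) rs"
      using index_seqsD[OF rs(1)] by auto
    have "\<not> set s \<subseteq> set rs"
    proof
      assume "set s \<subseteq> set rs"
      then have "set s = set rs"
        using s rs' assms by (intro card_subset_eq) (auto simp: distinct_card)
      then have "s = rs"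
        using assms rs' by (intro sorted_distinct_set_unique) (auto simp: strict_sorted_iff)
      with rs show False by simp
    qed
    then obtain m where m: "m < k" "s ! m \<notin> set rs"
      using assms by (metis in_set_conv_nth subsetI)
    have "rs ! m \<in> set rs" using m rs' by simp
    moreover have "s ! m < p" "rs ! m < p"
      using m index_seqsD(5)[OF s(1)] index_seqsD(5)[OF rs(1)] by auto
    ultimately show ?thesis
      using m rs' assms
      by (intro rows_det_eq_rows[of "s ! m" "rs ! m"]) (auto simp: replace_rows_def pos_nth)
  qed
  have "replace_rows s (\<lambda>m. l (s ! m)) l = l"
  proof
    fix j show "replace_rows s (\<lambda>m. l (s ! m)) l j = l j"
    proof (cases "j \<in> set s")
      case True
      then obtain m' where "m' < length s" "j = s ! m'" by (auto simp: in_set_conv_nth)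
      then show ?thesis using s by (simp add: replace_rows_def pos_nth)
    qed (simp add: replace_rows_def)
  qed
  moreover have "(\<Sum>rs\<in>index_seqs p k. rows_det p (replace_rows rs (\<lambda>m. l (s ! m)) l)
        * rows_det q (append_rows k (\<lambda>m. l (rs ! m)) y))
      = (\<Sum>rs\<in>{s}. rows_det p (replace_rows rs (\<lambda>m. l (s ! m)) l)
        * rows_det q (append_rows k (\<lambda>m. l (rs ! m)) y))"
    using s zero by (intro sum.mono_neutral_right) (auto simp: finite_index_seqs)
  ultimately show ?thesis by (simp add: exchange_defect_def)
qed

text \<open>Alternation reduces distinct sequences to increasing ones. A repetition in
  \<open>s\<close> gives two equal rows in the smaller minor and in every larger minor of the
  sum.\<close>

lemma exchange_defect_rows:
  fixes l :: "nat \<Rightarrow> nat \<Rightarrow> complex"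
  assumes "length s = k" "set s \<subseteq> {..<p}" "k \<le> q"
  shows "exchange_defect p q k l y (\<lambda>m. l (s ! m)) = 0"
proof (cases "distinct s")
  case True
  define F where "F s = exchange_defect p q k l y (\<lambda>m. l (s ! m))" for s
  have "F s = seq_sign s * F (sorted_list_of_set (set s))"
  proof (rule alternating_eq_seq_sign)
    fix xs ys :: "nat list" and x y' :: nat
    assume len: "length xs + length ys + 2 = k"
    let ?w = "\<lambda>m. l ((xs @ y' # x # ys) ! m)" and ?m = "length xs"
    have "(\<lambda>m. l ((xs @ x # y' # ys) ! m)) = ?w(?m := ?w (Suc ?m), Suc ?m := ?w ?m)"
    proof
      fix m
      consider "m < ?m" | "m = ?m" | "m = Suc ?m" | d where "m = Suc (Suc ?m) + d"
        by (metis Suc_lessI less_iff_Suc_add not_less_eq add_Suc nat_neq_iff)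
      then show "l ((xs @ x # y' # ys) ! m) = (?w(?m := ?w (Suc ?m), Suc ?m := ?w ?m)) m"
        by cases (simp_all add: nth_append)
    qed
    then show "F (xs @ x # y' # ys) = - F (xs @ y' # x # ys)"
      unfolding F_def using len assms(3) exchange_defect_swap[of ?m k "Suc ?m" q p l y ?w]
      by (simp only:)
  qed (use True assms in auto)
  moreover have "F (sorted_list_of_set (set s)) = 0"
    unfolding F_def using True assms
    by (intro exchange_defect_rows_sorted) (auto simp: distinct_card)
  ultimately show ?thesis by (simp add: F_def)
next
  case False
  then obtain a b where ab: "a < k" "b < k" "a \<noteq> b" "s ! a = s ! b"
    using assms by (auto simp: distinct_conv_nth)
  let ?w = "\<lambda>m. l (s ! m)"
  have "rows_det q (append_rows k ?w y) = 0"
    using ab assms by (intro rows_det_eq_rows[of a b]) (auto simp: append_rows_def)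
  moreover have "rows_det p (replace_rows rs ?w l) = 0" if "rs \<in> index_seqs p k" for rs
  proof -
    have *: "distinct rs" "length rs = k" "rs ! a < p" "rs ! b < p"
      using index_seqsD[OF that] ab by auto
    then show ?thesis
      using ab by (intro rows_det_eq_rows[of "rs ! a" "rs ! b"])
        (auto simp: replace_rows_def pos_nth nth_eq_iff_index_eq)
  qed
  ultimately show ?thesis by (simp add: exchange_defect_def)
qed

lemma exchange_defect_cong:
  assumes "\<And>m j. m < k \<Longrightarrow> j < p \<Longrightarrow> w m j = w' m j" "q \<le> p"
  shows "exchange_defect p q k l y w = exchange_defect p q k l y w'"
proof -
  have "rows_det q (append_rows k w y) = rows_det q (append_rows k w' y)"
    using assms by (intro rows_det_cong) (auto simp: append_rows_def)
  moreover have "rows_det p (replace_rows rs w l) = rows_det p (replace_rows rs w' l)"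
    if "rs \<in> index_seqs p k" for rs
  proof (rule rows_det_cong)
    fix i j assume "i < p" "j < p"
    moreover have "pos rs i < k" if "i \<in> set rs"
      using \<open>rs \<in> _\<close> that by (auto simp: index_seqs_def in_set_conv_nth pos_nth strict_sorted_iff)
    ultimately show "replace_rows rs w l i j = replace_rows rs w' l i j"
      using assms by (simp add: replace_rows_def)
  qed
  ultimately show ?thesis by (simp add: exchange_defect_def)
qed

text \<open>The rows of a nonsingular \<open>l\<close> span, so each \<open>w m\<close> agrees on
  the first \<open>p\<close> coordinates with a combination of them, with coefficients from the
  adjugate; multilinearity then reduces to \<open>exchange_defect_rows\<close>.\<close>

lemma exchange_defect_nonsingular:
  fixes l :: "nat \<Rightarrow> nat \<Rightarrow> complex"
  assumes "rows_det p l \<noteq> 0" "k \<le> q" "q \<le> p"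
  shows "exchange_defect p q k l y w = 0"
proof -
  define A where "A = mat p p (\<lambda>(i, j). l i j)"
  have A: "A \<in> carrier_mat p p" by (simp add: A_def)
  have det: "det A \<noteq> 0" using assms by (simp add: A_def rows_det_def)
  define c where "c m r = (\<Sum>i<p. w m i * adj_mat A $$ (i, r)) / det A" for m r
  define w' where "w' m = (\<lambda>j. \<Sum>r<p. c m r * l r j)" for m
  have "w m j = w' m j" if "j < p" for m j
  proof -
    have "(\<Sum>r<p. adj_mat A $$ (i, r) * l r j) = (if i = j then det A else 0)" if "i < p" for i
    proof -
      have "(\<Sum>r<p. adj_mat A $$ (i, r) * l r j) = (adj_mat A * A) $$ (i, j)"
        using that \<open>j < p\<close> A adj_mat(1)[OF A]
        by (auto simp: scalar_prod_def A_def lessThan_atLeast0 intro!: sum.cong)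
      also have "\<dots> = (if i = j then det A else 0)"
        using that \<open>j < p\<close> by (simp add: adj_mat(3)[OF A])
      finally show ?thesis .
    qed
    then have "(\<Sum>i<p. w m i * (\<Sum>r<p. adj_mat A $$ (i, r) * l r j)) = w m j * det A"
      using that by (simp add: if_distrib[of "(*) _"] cong: if_cong)
    moreover have "w' m j * det A = (\<Sum>i<p. w m i * (\<Sum>r<p. adj_mat A $$ (i, r) * l r j))"
    proof -
      have "w' m j * det A = (\<Sum>r<p. \<Sum>i<p. w m i * (adj_mat A $$ (i, r) * l r j))"
      proof -
        have "c m r * det A = (\<Sum>i<p. w m i * adj_mat A $$ (i, r))" for r
          using det by (simp add: c_def)
        moreover have "(c m r * l r j) * det A = (c m r * det A) * l r j" for r
          by (simp only: mult_ac)
        ultimately have "(c m r * l r j) * det A = (\<Sum>i<p. w m i * (adj_mat A $$ (i, r) * l r j))" for r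
          by (simp only: sum_distrib_right mult.assoc)
        then show ?thesis by (simp add: w'_def sum_distrib_right)
      qed
      then show ?thesis by (subst (asm) sum.swap) (simp add: sum_distrib_left)
    qed
    ultimately show ?thesis using det by simp
  qed
  then have "exchange_defect p q k l y w = exchange_defect p q k l y w'"
    using assms by (intro exchange_defect_cong) auto
  also have "exchange_defect p q k l y w' = 0"
  proof -
    \<comment> \<open>The combinations are expanded one row at a time: the first \<open>i\<close>
      rows are still combinations, the others are rows of \<open>l\<close> listed by
      \<open>s\<close>.\<close>
    have "exchange_defect p q k l y (\<lambda>m. if m < i then w' m else l (s ! m)) = 0"
      if "i \<le> k" "length s = k" "set s \<subseteq> {..<p}" for i s
      using that
    proof (induction i arbitrary: s)
      case 0
      then show ?case using assms by (simp add: exchange_defect_rows)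
    next
      case (Suc i)
      let ?v = "\<lambda>m. if m < i then w' m else l (s ! m)"
      have "(\<lambda>m. if m < Suc i then w' m else l (s ! m)) = ?v(i := \<lambda>j. \<Sum>r<p. c i r * l r j)"
        by (auto simp: w'_def fun_eq_iff less_Suc_eq)
      moreover have "exchange_defect p q k l y (?v(i := l r)) = 0" if "r < p" for r
      proof -
        have "?v(i := l r) = (\<lambda>m. if m < i then w' m else l (s[i := r] ! m))"
          using Suc.prems by (auto simp: fun_eq_iff)
        then show ?thesis
          using Suc.IH[of "s[i := r]"] Suc.prems that set_update_subset_insert[of s i r] by auto
      qed
      ultimately show ?case
        using Suc.prems assms by (simp add: exchange_defect_linear)
    qed
    moreover have "set [0..<k] \<subseteq> {..<p}" using assms by auto
    ultimately have "exchange_defect p q k l y (\<lambda>m. if m < k then w' m else l ([0..<k] ! m)) = 0"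
      by (metis diff_zero length_upt order_refl)
    moreover have "exchange_defect p q k l y w' = exchange_defect p q k l y (\<lambda>m. if m < k then w' m else l ([0..<k] ! m))"
      using assms by (intro exchange_defect_cong) auto
    ultimately show ?thesis by simp
  qed
  finally show ?thesis .
qed

text \<open>A singular matrix is replaced by \<open>A + t\<close>; as polynomials in \<open>t\<close>, the defect times the
  determinant vanishes identically, and the determinant is a characteristic polynomial.\<close>

lemma exchange_defect_zero:
  fixes l :: "nat \<Rightarrow> nat \<Rightarrow> complex"
  assumes "k \<le> q" "q \<le> p"
  shows "exchange_defect p q k l y w = 0"
proof -
  define l' where "l' i j = (if i = j then [:l i j, 1:] else [:l i j:])" for i j
  define D where "D = rows_det p l'"
  define P where "P = exchange_defect p q k l' (\<lambda>i j. [:y i j:]) (\<lambda>i j. [:w i j:])"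
  have poly_app: "(\<lambda>i j. poly (append_rows k f g i j) t) = append_rows k (\<lambda>i j. poly (f i j) t) (\<lambda>i j. poly (g i j) t)"
    for f g :: "nat \<Rightarrow> nat \<Rightarrow> complex poly" and t
    by (auto simp: append_rows_def)
  have poly_rep: "(\<lambda>i j. poly (replace_rows rs f g i j) t) = replace_rows rs (\<lambda>i j. poly (f i j) t) (\<lambda>i j. poly (g i j) t)"
    for f g :: "nat \<Rightarrow> nat \<Rightarrow> complex poly" and t rs
    by (auto simp: replace_rows_def)
  have P: "poly P t = exchange_defect p q k (\<lambda>i j. poly (l' i j) t) y w" for t
    by (simp add: P_def exchange_defect_def poly_sum poly_rows_det poly_app poly_rep)
  have D: "poly D t = rows_det p (\<lambda>i j. poly (l' i j) t)" for t
    by (simp add: D_def poly_rows_det)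
  have "poly (P * D) t = 0" for t
    using exchange_defect_nonsingular[OF _ assms, of "\<lambda>i j. poly (l' i j) t" y w] by (auto simp: P D)
  then have "P * D = 0" using poly_all_0_iff_0 by blast
  moreover have "D \<noteq> 0"
  proof -
    \<comment> \<open>A characteristic polynomial is the determinant of \<open>t - A\<close>, hence
      the sign.\<close>
    define A where "A = mat p p (\<lambda>(i, j). - l i j)"
    have "mat p p (\<lambda>(i, j). l' i j) = char_poly_matrix A"
      by (rule eq_matI) (auto simp: A_def l'_def char_poly_matrix_def)
    then have "D = char_poly A" by (simp add: D_def rows_det_def char_poly_def)
    moreover have "A \<in> carrier_mat p p" by (simp add: A_def)
    ultimately show ?thesis using degree_monic_char_poly[of A p] by auto
  qed
  ultimately have "P = 0" by simp
  then have "exchange_defect p q k (\<lambda>i j. poly (l' i j) 0) y w = 0" by (simp flip: P)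
  moreover have "(\<lambda>i j. poly (l' i j) 0) = l" by (auto simp: l'_def fun_eq_iff)
  ultimately show ?thesis by simp
qed

section \<open>PBW columns\<close>

definition gaps :: "nat \<Rightarrow> nat set \<Rightarrow> nat set"
  where "gaps d J = {1..d} - J"

definition tails :: "nat \<Rightarrow> nat set \<Rightarrow> nat set"
  where "tails d J = J - {1..d}"

text \<open>The entry in row \<open>i\<close> of the PBW column with entries \<open>J\<close>: elements of \<open>J\<close> up to \<open>d\<close> stay in
  their own row, the others decrease downwards in the remaining rows.\<close>

definition col_entry :: "nat \<Rightarrow> nat set \<Rightarrow> nat \<Rightarrow> nat"
  where "col_entry d J i =
    (if i \<in> J then i else sorted_list_of_set (tails d J) ! card {a \<in> gaps d J. i < a})"

lemma idxD:
  assumes "J \<in> idx n d"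
  shows "J \<subseteq> {1..n}" "card J = d" "finite J" "d \<le> n"
proof -
  show J: "J \<subseteq> {1..n}" "card J = d" using assms by (auto simp: idx_def)
  show "finite J" using J(1) finite_subset by blast
  show "d \<le> n" using card_mono[OF _ J(1)] J(2) by simp
qed

lemma card_gaps:
  assumes "finite J" "card J = d"
  shows "card (gaps d J) = card (tails d J)"
proof -
  have "card J = card (J \<inter> {1..d}) + card (tails d J)"
    unfolding tails_def using assms(1) by (metis card_Int_Diff)
  moreover have "card {1..d} = card ({1..d} \<inter> J) + card (gaps d J)"
    unfolding gaps_def by (metis card_Int_Diff finite_atLeastAtMost)
  ultimately show ?thesis using assms(2) by (simp add: Int_commute)
qed

lemma card_less_nth_sorted:
  fixes B :: "nat set"
  assumes "finite B" "c < card B"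
  shows "card {y \<in> B. y < sorted_list_of_set B ! c} = c"
proof -
  let ?xs = "sorted_list_of_set B"
  have xs: "sorted_wrt (<) ?xs" "length ?xs = card B" "set ?xs = B"
    using assms by (simp_all add: strict_sorted_iff)
  have "{y \<in> B. y < ?xs ! c} = (!) ?xs ` {..<c}"
  proof (intro Set.set_eqI iffI)
    fix y assume "y \<in> {y \<in> B. y < ?xs ! c}"
    then obtain i where i: "i < length ?xs" "y = ?xs ! i" "y < ?xs ! c"
      using xs(3) by (metis (mono_tags, lifting) in_set_conv_nth mem_Collect_eq)
    have "i < c"
      using i xs assms sorted_wrt_nth_less[OF xs(1), of c i] by (metis less_asym nat_neq_iff)
    with i show "y \<in> (!) ?xs ` {..<c}" by blast
  next
    fix y assume "y \<in> (!) ?xs ` {..<c}"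
    then obtain i where "i < c" "y = ?xs ! i" by auto
    then show "y \<in> {y \<in> B. y < ?xs ! c}"
      using sorted_wrt_nth_less[OF xs(1), of i c] xs assms nth_mem[of i ?xs] by simp
  qed
  moreover have "inj_on ((!) ?xs) {..<c}"
    using xs assms by (auto simp: inj_on_def nth_eq_iff_index_eq)
  ultimately show ?thesis by (simp add: card_image)
qed

lemma nth_sorted_le:
  fixes B :: "nat set"
  assumes "finite B" "c < card {y \<in> B. y \<le> x}"
  shows "sorted_list_of_set B ! c \<le> x"
proof (rule ccontr)
  assume "\<not> sorted_list_of_set B ! c \<le> x"
  then have "{y \<in> B. y \<le> x} \<subseteq> {y \<in> B. y < sorted_list_of_set B ! c}" by auto
  then have "card {y \<in> B. y \<le> x} \<le> card {y \<in> B. y < sorted_list_of_set B ! c}"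
    using assms by (intro card_mono) auto
  moreover have "c < card B"
    using assms card_mono[of B "{y \<in> B. y \<le> x}"] by auto
  ultimately show False using card_less_nth_sorted[OF assms(1), of c] assms by simp
qed

section \<open>Rows and entries of a single PBW column\<close>

context
  fixes n d :: nat and J :: "nat set"
  assumes J: "J \<in> idx n d"
begin

lemma finite_tails: "finite (tails d J)" "finite (gaps d J)"
  using idxD[OF J] by (auto simp: tails_def gaps_def)

lemma card_gaps_less:
  assumes "i \<in> gaps d J"
  shows "card {a \<in> gaps d J. i < a} < card (tails d J)"
proof -
  have "card {a \<in> gaps d J. i < a} < card (gaps d J)"
    using assms finite_tails by (intro psubset_card_mono) auto
  then show ?thesis using card_gaps[of J d] idxD[OF J] by simp
qed

lemma col_entry_mem: "i \<in> gaps d J \<Longrightarrow> col_entry d J i \<in> tails d J"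
  using card_gaps_less[of i] finite_tails nth_mem[of _ "sorted_list_of_set (tails d J)"]
  by (auto simp: col_entry_def gaps_def)

lemma col_entry_count:
  "i \<in> gaps d J \<Longrightarrow> card {b \<in> tails d J. b < col_entry d J i} = card {a \<in> gaps d J. i < a}"
  using card_less_nth_sorted[OF finite_tails(1) card_gaps_less[of i]]
  by (auto simp: col_entry_def gaps_def)

lemma col_entry_antimono:
  assumes "i \<in> gaps d J" "i' \<in> gaps d J" "i < i'"
  shows "col_entry d J i' < col_entry d J i"
proof (rule ccontr)
  assume "\<not> col_entry d J i' < col_entry d J i"
  then have "card {b \<in> tails d J. b < col_entry d J i} \<le> card {b \<in> tails d J. b < col_entry d J i'}"
    using finite_tails by (intro card_mono) auto
  then have "card {a \<in> gaps d J. i < a} \<le> card {a \<in> gaps d J. i' < a}"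
    using assms by (simp add: col_entry_count)
  moreover have "card {a \<in> gaps d J. i' < a} < card {a \<in> gaps d J. i < a}"
    using assms finite_tails by (intro psubset_card_mono) auto
  ultimately show False by simp
qed

lemma col_entry_le_iff:
  "i \<in> gaps d J \<Longrightarrow> i' \<in> gaps d J \<Longrightarrow> col_entry d J i \<le> col_entry d J i' \<longleftrightarrow> i' \<le> i"
  using col_entry_antimono[of i i'] col_entry_antimono[of i' i] by (cases i i' rule: linorder_cases) auto

lemma inj_on_col_entry: "inj_on (col_entry d J) (gaps d J)"
  by (rule inj_onI) (metis col_entry_le_iff le_antisym order_refl)

lemma col_entry_image: "col_entry d J ` gaps d J = tails d J"
  using finite_tails col_entry_mem card_gaps[of J d] idxD[OF J] inj_on_col_entry
  by (intro card_subset_eq) (auto simp: card_image)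

lemma col_entry_le: "i \<in> {1..d} \<Longrightarrow> col_entry d J i \<le> n"
  using col_entry_mem[of i] idxD[OF J] by (cases "i \<in> J") (auto simp: col_entry_def tails_def gaps_def)

lemma col_entry_gt: "i \<in> gaps d J \<Longrightarrow> d < col_entry d J i"
  using col_entry_mem[of i] idxD[OF J] by (auto simp: tails_def subset_iff)

text \<open>The window cuts out exactly the entries of rows \<open>1\<close> to \<open>i\<close>: a
  row above row \<open>i\<close> holds its own number, which is below \<open>i\<close>, or an entry
  larger than that of row \<open>i\<close>, since entries in gaps decrease downwards.\<close>

lemma card_window:
  assumes "i \<in> gaps d J"
  shows "card (J \<inter> ({1..<i} \<union> {col_entry d J i..n})) = i"
proof -
  let ?b = "col_entry d J i"
  have i: "1 \<le> i" "i \<le> d" using assms by (auto simp: gaps_def)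
  have up: "{b \<in> tails d J. ?b \<le> b} = col_entry d J ` {a \<in> gaps d J. a \<le> i}"
    using assms by (auto simp: col_entry_le_iff col_entry_mem col_entry_image[symmetric])
  have "J \<inter> ({1..<i} \<union> {?b..n}) = (J \<inter> {1..<i}) \<union> {b \<in> tails d J. ?b \<le> b}"
    using idxD[OF J] col_entry_gt[OF assms] by (auto simp: tails_def)
  moreover have "(J \<inter> {1..<i}) \<inter> {b \<in> tails d J. ?b \<le> b} = {}"
    using i col_entry_gt[OF assms] by auto
  ultimately have "card (J \<inter> ({1..<i} \<union> {?b..n})) = card (J \<inter> {1..<i}) + card {b \<in> tails d J. ?b \<le> b}"
    using finite_tails by (simp add: card_Un_disjoint)
  also have "card {b \<in> tails d J. ?b \<le> b} = card {a \<in> gaps d J. a \<le> i}"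
    unfolding up by (intro card_image inj_on_subset[OF inj_on_col_entry]) auto
  also have "{a \<in> gaps d J. a \<le> i} = insert i ({1..<i} - J)"
    using assms by (auto simp: gaps_def)
  also have "card (insert i ({1..<i} - J)) = Suc (card ({1..<i} - J))" by simp
  also have "card (J \<inter> {1..<i}) + Suc (card ({1..<i} - J)) = Suc (card {1..<i})"
    using card_Int_Diff[of "{1..<i}" J] by (simp add: Int_commute)
  finally show ?thesis using i by simp
qed

end

text \<open>Only entries above \<open>p\<close> can fail to be dominated: an entry \<open>b\<close>
  between \<open>q + 1\<close> and \<open>p\<close> is dominated by row \<open>b\<close> of
  \<open>L\<close>, which holds \<open>b\<close> or something above \<open>p\<close>. Rows of
  \<open>L\<close> keeping their own index hold at most \<open>p\<close>, so comparing with the gaps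
  of \<open>L\<close> suffices.\<close>

definition nonstandard :: "nat \<Rightarrow> nat \<Rightarrow> nat set \<Rightarrow> nat set \<Rightarrow> bool"
  where "nonstandard p q L J \<longleftrightarrow> (\<exists>i\<in>gaps q J. p < col_entry q J i \<and>
    (\<forall>i1\<in>gaps p L. i \<le> i1 \<longrightarrow> col_entry p L i1 < col_entry q J i))"

text \<open>Domination fails from row \<open>i\<close> on, so every element of \<open>L\<close> that
  is at least \<open>b\<close> sits in a gap above row \<open>i\<close>. Together with the elements
  below \<open>i\<close> they occupy distinct rows among the first \<open>i - 1\<close>.\<close>

lemma card_window_less:
  assumes L: "L \<in> idx n p" and "1 \<le> i" "i \<le> p" "p < b"
    and dom: "\<And>i1. i1 \<in> gaps p L \<Longrightarrow> i \<le> i1 \<Longrightarrow> col_entry p L i1 < b"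
  shows "card (L \<inter> ({1..<i} \<union> {b..n})) < i"
proof -
  have up: "{c \<in> tails p L. b \<le> c} \<subseteq> col_entry p L ` ({1..<i} - L)"
  proof
    fix c assume "c \<in> {c \<in> tails p L. b \<le> c}"
    then obtain a where a: "a \<in> gaps p L" "c = col_entry p L a" "b \<le> c"
      using col_entry_image[OF L] by auto
    with dom[of a] have "a < i" by force
    with a show "c \<in> col_entry p L ` ({1..<i} - L)" by (auto simp: gaps_def)
  qed
  have "L \<inter> ({1..<i} \<union> {b..n}) = (L \<inter> {1..<i}) \<union> {c \<in> tails p L. b \<le> c}"
    using idxD[OF L] assms by (auto simp: tails_def)
  then have "card (L \<inter> ({1..<i} \<union> {b..n})) \<le> card (L \<inter> {1..<i}) + card {c \<in> tails p L. b \<le> c}"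
    by (metis card_Un_le)
  also have "card {c \<in> tails p L. b \<le> c} \<le> card ({1..<i} - L)"
    using up by (meson card_image_le card_mono finite_Diff finite_atLeastLessThan finite_imageI order_trans)
  also have "card (L \<inter> {1..<i}) + card ({1..<i} - L) = card {1..<i}"
    using card_Int_Diff[of "{1..<i}" L] by (simp add: Int_commute)
  finally show ?thesis using assms by simp
qed

text \<open>Consider the lowest row where the columns differ, among the rows from \<open>i\<close>
  on. Such a row exists, since otherwise both columns would have equally many tails below the entry
  of row \<open>i\<close>, while \<open>J'\<close> has an extra one. It is a gap of
  \<open>J\<close>, because \<open>J'\<close> contains every element of \<open>J\<close> outside the
  window. There \<open>J'\<close> either keeps the number of the row, which is smaller than any
  entry in a gap, or its additional elements push the entry down.\<close>

lemma col_entry_lex_less: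
  assumes J: "J \<in> idx n q" and J': "J' \<in> idx n q" and i: "i \<in> gaps q J"
    and sub: "J - ({1..<i} \<union> {col_entry q J i..n}) \<subset> J' - ({1..<i} \<union> {col_entry q J i..n})"
  shows "\<exists>t\<in>{1..q}. col_entry q J' t < col_entry q J t \<and>
    (\<forall>t'\<in>{t<..q}. col_entry q J' t' = col_entry q J t')"
proof -
  let ?T = "col_entry q J" and ?T' = "col_entry q J'"
  let ?b = "?T i" and ?I = "{1..<i} \<union> {?T i..n}"
  have iq: "1 \<le> i" "i \<le> q" "q < ?b" "i \<notin> J"
    using i col_entry_gt[OF J i] by (auto simp: gaps_def)
  have keep: "x \<in> J'" if "x \<in> J" "i \<le> x" "x < ?b" for x
    using sub that by auto
  have eq_gap: "x \<in> J \<longleftrightarrow> x \<in> J'" if "?T' x = ?T x" "x \<in> {1..q}" for x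
    using that col_entry_gt[OF J, of x] col_entry_gt[OF J', of x]
    by (auto simp: col_entry_def gaps_def split: if_splits)
  \<comment> \<open>The rows below \<open>t\<close> agree, so both entries are read at the same
    index of the sorted tails. It is enough that \<open>J'\<close> has more than that many tails up
    to \<open>?T t\<close>. For \<open>t\<close> different from \<open>i\<close> the additional one
    is \<open>?T t\<close> itself; for \<open>t = i\<close> that entry lies in the window and may be
    lost, which is why \<open>cnt\<close> supplies another.\<close>
  have le: "?T' t \<le> ?T t" if t: "t \<in> {i..q}" "t \<notin> J" "t \<notin> J'"
    and above: "\<And>t'. t' \<in> {t<..q} \<Longrightarrow> ?T' t' = ?T t'"
    and cnt: "t = i \<Longrightarrow> \<exists>x\<in>tails q J'. x < ?b \<and> x \<notin> tails q J"
    for t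
  proof -
    have tg: "t \<in> gaps q J" "t \<in> gaps q J'" using t iq by (auto simp: gaps_def)
    have "{a \<in> gaps q J'. t < a} = {a \<in> gaps q J. t < a}"
      using above eq_gap t by (auto simp: gaps_def)
    then have c: "card {b \<in> tails q J. b < ?T t} = card {a \<in> gaps q J'. t < a}"
      using col_entry_count[OF J tg(1)] by simp
    have sub': "{b \<in> tails q J. b < ?T t} \<subseteq> {b \<in> tails q J'. b \<le> ?T t}"
    proof
      fix x assume x: "x \<in> {b \<in> tails q J. b < ?T t}"
      moreover have "?T t \<le> ?b" using t tg i col_entry_le_iff[OF J tg(1) i] by simp
      moreover have "i \<le> x" using x iq idxD(1)[OF J] by (auto simp: tails_def)
      ultimately show "x \<in> {b \<in> tails q J'. b \<le> ?T t}"
        using keep[of x] by (auto simp: tails_def)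
    qed
    have "\<exists>x. x \<in> {b \<in> tails q J'. b \<le> ?T t} \<and> x \<notin> {b \<in> tails q J. b < ?T t}"
    proof (cases "t = i")
      case True
      with cnt show ?thesis by auto
    next
      case False
      then have "?T t < ?b" using t tg i col_entry_antimono[OF J i tg(1)] by auto
      moreover have "?T t \<in> tails q J" by (rule col_entry_mem[OF J tg(1)])
      moreover have "q < ?T t" by (rule col_entry_gt[OF J tg(1)])
      ultimately have "?T t \<in> tails q J'" using keep[of "?T t"] iq by (auto simp: tails_def)
      then show ?thesis by auto
    qed
    then have "{b \<in> tails q J. b < ?T t} \<subset> {b \<in> tails q J'. b \<le> ?T t}"
      using sub' by blast
    then have "card {a \<in> gaps q J'. t < a} < card {b \<in> tails q J'. b \<le> ?T t}"
      unfolding c[symmetric] using finite_tails[OF J'] by (intro psubset_card_mono) auto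
    then show ?thesis
      using tg nth_sorted_le[OF finite_tails(1)[OF J']] by (simp add: col_entry_def gaps_def)
  qed
  \<comment> \<open>an element gained outside the window is a tail below \<open>?b\<close> or a row
    number from \<open>i\<close> to \<open>q\<close>. In the second case the columns differ in that
    row, so if \<open>i\<close> is the only possible difference, the element is
    \<open>i\<close>.\<close>
  define S where "S = {t \<in> {i..q}. ?T' t \<noteq> ?T t}"
  have extra: "i \<in> J' \<or> (\<exists>x\<in>tails q J'. x < ?b \<and> x \<notin> J)" if "S \<subseteq> {i}"
  proof -
    obtain x where x: "x \<in> J'" "x \<notin> J" "x \<notin> ?I" using sub by blast
    have xn: "1 \<le> x" "x \<le> n" using x idxD(1)[OF J'] by auto
    show ?thesis
    proof (cases "x \<le> q")
      case True
      then have "?T' x \<noteq> ?T x" using x xn eq_gap[of x] by auto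
      then have "x \<in> S" using True x xn by (auto simp: S_def)
      then have "x = i" using that by auto
      with x show ?thesis by simp
    qed (use x xn in \<open>auto simp: tails_def\<close>)
  qed
  have "S \<noteq> {}"
  proof
    assume S: "S = {}"
    then have T: "?T' i = ?T i" using iq by (auto simp: S_def)
    then have "i \<notin> J'" using eq_gap[of i] iq by auto
    moreover obtain x where x: "x \<in> tails q J'" "x < ?b" "x \<notin> J"
      using extra S calculation by auto
    have ig': "i \<in> gaps q J'" using \<open>i \<notin> J'\<close> iq by (auto simp: gaps_def)
    have "{a \<in> gaps q J'. i < a} = {a \<in> gaps q J. i < a}"
      using eq_gap S iq by (auto simp: gaps_def S_def)
    then have "card {b \<in> tails q J'. b < ?b} = card {b \<in> tails q J. b < ?b}"
      using col_entry_count[OF J i] col_entry_count[OF J' ig'] T by simp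
    moreover have "{b \<in> tails q J. b < ?b} \<subset> {b \<in> tails q J'. b < ?b}"
    proof
      show "{b \<in> tails q J. b < ?b} \<subseteq> {b \<in> tails q J'. b < ?b}"
        using keep iq idxD(1)[OF J] by (auto simp: tails_def subset_iff)
      show "{b \<in> tails q J. b < ?b} \<noteq> {b \<in> tails q J'. b < ?b}"
        using x by (auto simp: tails_def)
    qed
    then have "card {b \<in> tails q J. b < ?b} < card {b \<in> tails q J'. b < ?b}"
      using finite_tails[OF J'] by (intro psubset_card_mono) auto
    ultimately show False by simp
  qed
  define t where "t = Max S"
  have "finite S" by (simp add: S_def)
  then have tS: "t \<in> S" and tmax: "\<And>u. u \<in> S \<Longrightarrow> u \<le> t"
    using \<open>S \<noteq> {}\<close> by (auto simp: t_def)
  have above: "?T' t' = ?T t'" if "t' \<in> {t<..q}" for t'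
    using that tmax[of t'] tS by (force simp: S_def)
  have tr: "t \<in> {i..q}" "?T' t \<noteq> ?T t" using tS by (auto simp: S_def)
  have tJ: "t \<notin> J"
  proof
    assume "t \<in> J"
    moreover have "t < ?b" using tr iq by auto
    ultimately have "t \<in> J'" using keep tr by auto
    with \<open>t \<in> J\<close> tr show False by (simp add: col_entry_def)
  qed
  then have tg: "t \<in> gaps q J" using tr iq by (auto simp: gaps_def)
  have "?T' t < ?T t"
  proof (cases "t \<in> J'")
    case True
    then have "?T' t = t" by (simp add: col_entry_def)
    also have "t < ?T t" using col_entry_gt[OF J tg] tr by auto
    finally show ?thesis .
  next
    case False
    have "\<exists>x\<in>tails q J'. x < ?b \<and> x \<notin> tails q J" if "t = i"
    proof -
      have "x = i" if "x \<in> S" for x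
        using tmax[OF that] that \<open>t = i\<close> by (simp add: S_def)
      then have "S \<subseteq> {i}" by blast
      then show ?thesis using extra False that by (auto simp: tails_def)
    qed
    then have "?T' t \<le> ?T t" using le[of t] tr tJ False above by blast
    with tr show ?thesis by simp
  qed
  then show ?thesis using above tr iq by (intro bexI[of _ t]) auto
qed

text \<open>The size of a column comes first, then its entries from bottom to top, in base \<open>n + 1\<close>.\<close>

definition col_key :: "nat \<Rightarrow> nat set \<Rightarrow> nat"
  where "col_key n J =
    card J * (n + 1) ^ n + (\<Sum>i\<in>{1..card J}. col_entry (card J) J i * (n + 1) ^ (i - 1))"

section \<open>Column keys as numbers in base n + 1\<close>

lemma digit_sum_less:
  fixes f :: "nat \<Rightarrow> nat"
  assumes "\<And>i. i \<in> {1..t} \<Longrightarrow> f i \<le> n"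
  shows "(\<Sum>i\<in>{1..t}. f i * (n + 1) ^ (i - 1)) < (n + 1) ^ t"
  using assms
proof (induction t)
  case (Suc t)
  have "(\<Sum>i\<in>{1..Suc t}. f i * (n + 1) ^ (i - 1))
      = (\<Sum>i\<in>{1..t}. f i * (n + 1) ^ (i - 1)) + f (Suc t) * (n + 1) ^ t"
    by simp
  also have "\<dots> < (n + 1) ^ t + n * (n + 1) ^ t"
    using Suc by (intro add_less_le_mono mult_right_mono) auto
  finally show ?case by (simp add: algebra_simps)
qed simp

lemma digit_sum_lex_less:
  fixes f g :: "nat \<Rightarrow> nat"
  assumes "\<And>i. i \<in> {1..q} \<Longrightarrow> f i \<le> n" "t \<in> {1..q}" "f t < g t" "\<And>i. i \<in> {t<..q} \<Longrightarrow> f i = g i"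
  shows "(\<Sum>i\<in>{1..q}. f i * (n + 1) ^ (i - 1)) < (\<Sum>i\<in>{1..q}. g i * (n + 1) ^ (i - 1))"
proof -
  have split: "(\<Sum>i\<in>{1..q}. h i) = (\<Sum>i\<in>{1..t - 1}. h i) + h t + (\<Sum>i\<in>{t<..q}. h i)" for h :: "nat \<Rightarrow> nat"
  proof -
    have "{1..q} = {1..t - 1} \<union> {t} \<union> {t<..q}" using assms(2) by auto
    then have "sum h {1..q} = sum h ({1..t - 1} \<union> {t} \<union> {t<..q})" by simp
    also have "\<dots> = sum h ({1..t - 1} \<union> {t}) + sum h {t<..q}"
      by (rule sum.union_disjoint) (use assms(2) in auto)
    also have "sum h ({1..t - 1} \<union> {t}) = sum h {1..t - 1} + sum h {t}"
      by (rule sum.union_disjoint) (use assms(2) in auto)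
    finally show ?thesis by simp
  qed
  have "(\<Sum>i\<in>{1..t - 1}. f i * (n + 1) ^ (i - 1)) < (n + 1) ^ (t - 1)"
    using assms by (intro digit_sum_less) auto
  moreover have "f t * (n + 1) ^ (t - 1) + (n + 1) ^ (t - 1) \<le> g t * (n + 1) ^ (t - 1)"
    using assms(3) mult_right_mono[of "f t + 1" "g t" "(n + 1) ^ (t - 1)"] by (simp add: algebra_simps)
  moreover have "(\<Sum>i\<in>{t<..q}. f i * (n + 1) ^ (i - 1)) = (\<Sum>i\<in>{t<..q}. g i * (n + 1) ^ (i - 1))"
    using assms(4) by (intro sum.cong) auto
  ultimately show ?thesis unfolding split by linarith
qed

lemma col_key_bounds:
  assumes "J \<in> idx n d"
  shows "d * (n + 1) ^ n \<le> col_key n J" "col_key n J < (d + 1) * (n + 1) ^ n"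
proof -
  have "(\<Sum>i\<in>{1..d}. col_entry d J i * (n + 1) ^ (i - 1)) < (n + 1) ^ d"
    by (rule digit_sum_less) (rule col_entry_le[OF assms])
  also have "\<dots> \<le> (n + 1) ^ n" using idxD(4)[OF assms] by (intro power_increasing) auto
  finally show "col_key n J < (d + 1) * (n + 1) ^ n" "d * (n + 1) ^ n \<le> col_key n J"
    using idxD(2)[OF assms] by (simp_all add: col_key_def)
qed

lemma card_le_of_col_key_le:
  assumes "J \<in> idx n q" "L \<in> idx n p" "col_key n J \<le> col_key n L"
  shows "q \<le> p"
proof -
  have "q * (n + 1) ^ n < (p + 1) * (n + 1) ^ n"
    using col_key_bounds[OF assms(1)] col_key_bounds[OF assms(2)] assms(3) by linarith
  then have "q < p + 1" by (rule mult_less_cancel2[THEN iffD1, THEN conjunct2])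
  then show ?thesis by simp
qed

text \<open>The last conclusion covers every \<open>k\<close>-element set \<open>R\<close> that a
  term of the relation can bring back from \<open>L\<close>. If \<open>R\<close> met the part of
  \<open>J\<close> that stays, the exchanged sequence would repeat an index and its variable would
  be zero, hence the disjointness.\<close>

lemma nonstandard_exchange:
  assumes J: "J \<in> idx n q" and L: "L \<in> idx n p" and "q \<le> p" and ns: "nonstandard p q L J"
  obtains js k where "distinct js" "set js = J" "1 \<le> k" "k \<le> q" "set (take k js) \<inter> {q + 1..p} = {}"
    "\<And>R. R \<subseteq> L \<Longrightarrow> card R = k \<Longrightarrow> R \<inter> set (drop k js) = {} \<Longrightarrow>
      col_key n (R \<union> set (drop k js)) < col_key n J"
proof -
  obtain i where i: "i \<in> gaps q J" and b: "p < col_entry q J i"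
    and dom: "\<And>i1. i1 \<in> gaps p L \<Longrightarrow> i \<le> i1 \<Longrightarrow> col_entry p L i1 < col_entry q J i"
    using ns by (auto simp: nonstandard_def)
  define I where "I = {1..<i} \<union> {col_entry q J i..n}"
  have iq: "1 \<le> i" "i \<le> q" using i by (auto simp: gaps_def)
  have cJ: "card (J \<inter> I) = i" unfolding I_def by (rule card_window[OF J i])
  have cL: "card (L \<inter> I) < i"
    unfolding I_def using iq \<open>q \<le> p\<close> b dom by (intro card_window_less[OF L]) auto
  note fJ = idxD[OF J] and fL = idxD[OF L]
  \<comment> \<open>The window elements come first and form the part to be exchanged. They are below
    \<open>i\<close>, hence at most \<open>q\<close>, or exceed \<open>p\<close>; so they avoid
    \<open>{q + 1..p}\<close> and the leading product of the relation is present.\<close>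
  define js where "js = sorted_list_of_set (J \<inter> I) @ sorted_list_of_set (J - I)"
  have js: "distinct js" "set js = J" "set (take i js) = J \<inter> I" "set (drop i js) = J - I"
    using fJ cJ by (auto simp: js_def)
  show thesis
  proof (rule that[of js i])
    show "set (take i js) \<inter> {q + 1..p} = {}" using iq b by (auto simp: js I_def)
    fix R assume R: "R \<subseteq> L" "card R = i" "R \<inter> set (drop i js) = {}"
    have finR: "finite R" using R fL finite_subset by blast
    have "\<not> R \<subseteq> I"
    proof
      assume "R \<subseteq> I"
      then have "card R \<le> card (L \<inter> I)" using R fL by (intro card_mono) auto
      with cL R show False by simp
    qed
    define J' where "J' = R \<union> (J - I)"
    have J': "J' \<in> idx n q"
    proof -
      have "card J' = card R + card (J - I)"
        unfolding J'_def using R finR fJ by (intro card_Un_disjoint) (auto simp: js)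
      also have "\<dots> = card J" using card_Int_Diff[OF fJ(3), of I] cJ R by simp
      finally show ?thesis using fJ fL R by (auto simp: idx_def J'_def)
    qed
    have "J - I \<subset> J' - I" using R \<open>\<not> R \<subseteq> I\<close> by (auto simp: J'_def js)
    then obtain t where t: "t \<in> {1..q}" "col_entry q J' t < col_entry q J t"
      "\<And>t'. t' \<in> {t<..q} \<Longrightarrow> col_entry q J' t' = col_entry q J t'"
      using col_entry_lex_less[OF J J' i] unfolding I_def by blast
    have "(\<Sum>i\<in>{1..q}. col_entry q J' i * (n + 1) ^ (i - 1)) < (\<Sum>i\<in>{1..q}. col_entry q J i * (n + 1) ^ (i - 1))"
      using col_entry_le[OF J'] t by (intro digit_sum_lex_less) auto
    then show "col_key n (R \<union> set (drop i js)) < col_key n J"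
      using idxD(2)[OF J'] fJ by (simp add: col_key_def js J'_def)
  qed (use js iq in auto)
qed

section \<open>Standard columns are determined by their pairs\<close>

text \<open>Rows that keep their own index are left out: given the size of the column, they are the
  rows that do not occur as first components.\<close>

definition col_pairs :: "nat set \<Rightarrow> (nat \<times> nat) set"
  where "col_pairs J = (\<lambda>a. (a, col_entry (card J) J a)) ` gaps (card J) J"

lemma col_pairs_inj:
  assumes "J \<in> idx n d" "J' \<in> idx n d" "col_pairs J = col_pairs J'"
  shows "J = J'"
proof -
  have "J = ({1..d} - fst ` col_pairs J) \<union> snd ` col_pairs J" if "J \<in> idx n d" for J
  proof -
    have "fst ` col_pairs J = gaps d J" "snd ` col_pairs J = tails d J"
      using idxD(2)[OF that] col_entry_image[OF that]
      by (auto simp: col_pairs_def image_image)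
    then show ?thesis by (auto simp: gaps_def tails_def)
  qed
  from this[OF assms(1)] this[OF assms(2)] assms(3) show ?thesis by simp
qed

text \<open>The gaps of a column of size \<open>p\<close> carry entries above \<open>p\<close>. The
  filter discards pairs that cannot come from such a column before maximal elements are
  taken.\<close>

definition max_pairs :: "nat \<Rightarrow> (nat \<times> nat) set \<Rightarrow> (nat \<times> nat) set"
  where "max_pairs p S = {x \<in> S. p < snd x \<and>
    (\<forall>y\<in>S. p < snd y \<and> fst x \<le> fst y \<and> snd x \<le> snd y \<longrightarrow> y = x)}"

text \<open>Entries in the gaps of \<open>C\<close> decrease as the row grows, so its pairs form an
  antichain. Standardness puts every pair with entry above \<open>p\<close> below one of them, so
  they are exactly the maximal ones.\<close>

lemma col_pairs_eq_max_pairs: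
  assumes C: "C \<in> K" "C \<in> idx n p" and K: "\<And>J. J \<in> K \<Longrightarrow> J \<in> idx n (card J)"
    and std: "\<And>J. J \<in> K \<Longrightarrow> \<not> nonstandard p (card J) C J"
  shows "col_pairs C = max_pairs p (\<Union>J\<in>K. col_pairs J)"
proof -
  have cC: "card C = p" using idxD[OF C(2)] by simp
  have dom: "\<exists>y\<in>col_pairs C. fst x \<le> fst y \<and> snd x \<le> snd y"
    if x: "x \<in> col_pairs J" "J \<in> K" "p < snd x" for x J
  proof -
    obtain a where a: "a \<in> gaps (card J) J" "x = (a, col_entry (card J) J a)"
      using x(1) unfolding col_pairs_def by blast
    then obtain i where "i \<in> gaps p C" "a \<le> i" "\<not> col_entry p C i < col_entry (card J) J a"
      using std[OF x(2)] x(3) by (auto simp: nonstandard_def)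
    with a show ?thesis by (intro bexI[of _ "(i, col_entry p C i)"]) (auto simp: col_pairs_def cC)
  qed
  have gt: "p < snd y" if "y \<in> col_pairs C" for y
    using that col_entry_gt[OF C(2)] by (auto simp: col_pairs_def cC)
  have anti: "x = y" if "x \<in> col_pairs C" "y \<in> col_pairs C" "fst x \<le> fst y" "snd x \<le> snd y" for x y
    using that col_entry_le_iff[OF C(2)] by (auto simp: col_pairs_def cC)
  show ?thesis
  proof (intro Set.set_eqI iffI)
    fix x assume x: "x \<in> col_pairs C"
    have "y = x" if y: "y \<in> col_pairs J" "J \<in> K" "p < snd y" and xy: "fst x \<le> fst y" "snd x \<le> snd y" for y J
    proof -
      obtain z where z: "z \<in> col_pairs C" "fst y \<le> fst z" "snd y \<le> snd z" using dom[OF y] by blast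
      then have "x = z" using anti[OF x z(1)] xy by simp
      with z xy show ?thesis by (simp add: prod_eq_iff)
    qed
    with x gt[OF x] C show "x \<in> max_pairs p (\<Union>J\<in>K. col_pairs J)"
      by (auto simp: max_pairs_def)
  next
    fix x assume x: "x \<in> max_pairs p (\<Union>J\<in>K. col_pairs J)"
    then obtain J where "x \<in> col_pairs J" "J \<in> K" "p < snd x"
      by (auto simp: max_pairs_def)
    from dom[OF this] obtain y where y: "y \<in> col_pairs C" "fst x \<le> fst y" "snd x \<le> snd y"
      by blast
    moreover have "y \<in> (\<Union>J\<in>K. col_pairs J)" "p < snd y" using y gt C by auto
    ultimately have "y = x" using x unfolding max_pairs_def by blast
    with y show "x \<in> col_pairs C" by simp
  qed
qed

section \<open>Pluecker coordinates of the orbit\<close>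

text \<open>The matrix with rows \<open>exp(f) v\<^sub>i = v\<^sub>i + \<Sum>\<^bsub>j>d\<^esub> z i j v\<^sub>j\<close> for \<open>i \<le> d\<close>.\<close>

definition orbit_entry :: "nat \<Rightarrow> (nat \<Rightarrow> nat \<Rightarrow> 'a) \<Rightarrow> nat \<Rightarrow> nat \<Rightarrow> 'a::comm_ring_1"
  where "orbit_entry d z i j = (if j \<le> d then (if i = j then 1 else 0) else z i j)"

text \<open>The minor is written transposed: the index \<open>js ! r\<close> labels row
  \<open>r\<close> of \<open>rows_det\<close>, so that exchanging indices is exchanging rows.
  Unsorted lists are allowed because the relations use arbitrary sequences.\<close>

definition orbit_coord :: "nat \<Rightarrow> (nat \<Rightarrow> nat \<Rightarrow> 'a) \<Rightarrow> nat list \<Rightarrow> 'a::comm_ring_1"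
  where "orbit_coord d z js = rows_det d (\<lambda>r i. orbit_entry d z (Suc i) (js ! r))"

lemma orbit_coord_not_distinct:
  assumes "length js = d" "\<not> distinct js"
  shows "orbit_coord d z js = 0"
proof -
  obtain a b where "a < d" "b < d" "a \<noteq> b" "js ! a = js ! b"
    using assms by (auto simp: distinct_conv_nth)
  then show ?thesis
    unfolding orbit_coord_def by (intro rows_det_eq_rows[of a b]) auto
qed

lemma orbit_coord_swap:
  assumes "length xs + length ys + 2 = d"
  shows "orbit_coord d z (xs @ x # y # ys) = - orbit_coord d z (xs @ y # x # ys)"
proof -
  let ?m = "length xs" and ?f = "\<lambda>r i. orbit_entry d z (Suc i) ((xs @ y # x # ys) ! r)"
  have "(\<lambda>r i. orbit_entry d z (Suc i) ((xs @ x # y # ys) ! r)) = ?f(?m := ?f (Suc ?m), Suc ?m := ?f ?m)"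
  proof
    fix m
    consider "m < ?m" | "m = ?m" | "m = Suc ?m" | d where "m = Suc (Suc ?m) + d"
      by (metis Suc_lessI less_iff_Suc_add not_less_eq add_Suc nat_neq_iff)
    then show "(\<lambda>i. orbit_entry d z (Suc i) ((xs @ x # y # ys) ! m)) = (?f(?m := ?f (Suc ?m), Suc ?m := ?f ?m)) m"
      by cases (simp_all add: nth_append)
  qed
  moreover have "rows_det d (?f(?m := ?f (Suc ?m), Suc ?m := ?f ?m)) = - rows_det d ?f"
    using assms by (intro rows_det_swap) auto
  ultimately show ?thesis unfolding orbit_coord_def by (simp only:)
qed

lemma orbit_coord_sort:
  fixes z :: "nat \<Rightarrow> nat \<Rightarrow> complex"
  assumes "distinct js" "length js = d"
  shows "orbit_coord d z js = seq_sign js * orbit_coord d z (sorted_list_of_set (set js))"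
  using alternating_eq_seq_sign[of d "orbit_coord d z" js] orbit_coord_swap assms by blast

lemma orbit_coord_id: "orbit_coord d z [1..<d + 1] = 1"
  unfolding orbit_coord_def by (rule rows_det_id) (simp add: orbit_entry_def del: upt_Suc)

text \<open>For an index above \<open>d\<close> its row is a combination of unit vectors, and the
  unit vector with 1 in place \<open>a\<close> is the row of the index \<open>a\<close>. Linearity
  in one row thus gives the Laplace expansion with all signs hidden in the replaced list.\<close>

lemma orbit_coord_expand:
  assumes "r < length js" "length js = d" "d < js ! r"
  shows "orbit_coord d z js = (\<Sum>a\<in>{1..d}. z a (js ! r) * orbit_coord d z (js[r := a]))"
proof -
  let ?f = "\<lambda>r i. orbit_entry d z (Suc i) (js ! r)"
  have "rows_det d ?f = rows_det d (?f(r := \<lambda>i. \<Sum>a\<in>{1..d}. z a (js ! r) * orbit_entry d z (Suc i) a))"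
  proof (rule rows_det_cong)
    fix s i assume "s < d" "i < d"
    have "(\<Sum>a\<in>{1..d}. z a (js ! r) * orbit_entry d z (Suc i) a)
        = (\<Sum>a\<in>{1..d}. if a = Suc i then z a (js ! r) else 0)"
      by (rule sum.cong) (auto simp: orbit_entry_def)
    also have "\<dots> = z (Suc i) (js ! r)" using \<open>i < d\<close> by simp
    finally show "?f s i = (?f(r := \<lambda>i. \<Sum>a\<in>{1..d}. z a (js ! r) * orbit_entry d z (Suc i) a)) s i"
      using assms by (auto simp: orbit_entry_def)
  qed
  also have "\<dots> = (\<Sum>a\<in>{1..d}. z a (js ! r) * rows_det d (?f(r := \<lambda>i. orbit_entry d z (Suc i) a)))"
    using assms by (intro rows_det_linear) auto
  also have "\<dots> = (\<Sum>a\<in>{1..d}. z a (js ! r) * orbit_coord d z (js[r := a]))"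
  proof (rule sum.cong)
    fix a
    have "?f(r := \<lambda>i. orbit_entry d z (Suc i) a) = (\<lambda>s i. orbit_entry d z (Suc i) (js[r := a] ! s))"
      using assms by (auto simp: fun_eq_iff)
    then show "z a (js ! r) * rows_det d (?f(r := \<lambda>i. orbit_entry d z (Suc i) a))
        = z a (js ! r) * orbit_coord d z (js[r := a])"
      by (simp add: orbit_coord_def)
  qed simp
  finally show ?thesis by (simp add: orbit_coord_def)
qed

lemma poly_orbit_coord: "poly (orbit_coord d z js) t = orbit_coord d (\<lambda>i j. poly (z i j) t) js"
proof -
  have "(\<lambda>r i. poly (orbit_entry d z (Suc i) (js ! r)) t)
      = (\<lambda>r i. orbit_entry d (\<lambda>i j. poly (z i j) t) (Suc i) (js ! r))"
    by (auto simp: orbit_entry_def fun_eq_iff)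
  then show ?thesis by (simp add: orbit_coord_def poly_rows_det)
qed

section \<open>Exchanged index sequences\<close>

lemma length_exch_left [simp]: "length (exch_left L J rs) = length L"
proof -
  have "length (fold (\<lambda>(r, j) M. M[r := j]) xs L) = length L" for xs :: "(nat \<times> nat) list"
    by (induction xs arbitrary: L) auto
  then show ?thesis by (simp add: exch_left_def)
qed

lemma exch_left_notin: "j \<notin> set rs \<Longrightarrow> exch_left L J rs ! j = L ! j"
proof -
  assume "j \<notin> set rs"
  then have "fold (\<lambda>(r, j) M. M[r := j]) (zip rs J) L ! j = L ! j"
    by (induction rs J arbitrary: L rule: list_induct2') auto
  then show ?thesis by (simp add: exch_left_def)
qed

lemma exch_left_nth:
  assumes "distinct rs" "length rs \<le> length J" "set rs \<subseteq> {..<length L}" "m < length rs"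
  shows "exch_left L J rs ! (rs ! m) = J ! m"
  using assms
proof (induction rs J arbitrary: L m rule: list_induct2')
  case (4 r rs j J)
  have step: "exch_left L (j # J) (r # rs) = exch_left (L[r := j]) J rs"
    by (simp add: exch_left_def)
  show ?case
  proof (cases m)
    case 0
    with 4 show ?thesis by (simp add: step exch_left_notin)
  next
    case (Suc m')
    with 4 show ?thesis by (simp add: step)
  qed
qed (auto simp: exch_left_def)

lemma exch_left_eq:
  assumes "distinct rs" "length rs \<le> length J" "set rs \<subseteq> {..<length L}"
  shows "(\<lambda>j. f (exch_left L J rs ! j)) = replace_rows rs (\<lambda>m. f (J ! m)) (\<lambda>j. f (L ! j))"
proof
  fix j
  show "f (exch_left L J rs ! j) = replace_rows rs (\<lambda>m. f (J ! m)) (\<lambda>j. f (L ! j)) j"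
  proof (cases "j \<in> set rs")
    case True
    then obtain m where "m < length rs" "j = rs ! m" by (auto simp: in_set_conv_nth)
    then show ?thesis using assms exch_left_nth[OF assms] by (simp add: replace_rows_def pos_nth)
  qed (simp add: exch_left_notin replace_rows_def)
qed

text \<open>The exchange identity sums over all position sequences. Both the factor in front of the
  leading product and the restriction on \<open>rs\<close> drop exactly the products whose smaller
  minor acquires a zero row by truncation.\<close>

theorem orbit_coord_relation:
  fixes z :: "nat \<Rightarrow> nat \<Rightarrow> complex"
  assumes p: "length L = p" and q: "length J = q" and "q \<le> p" "k \<le> q"
  shows "(if set (take k J) \<inter> {q + 1..p} = {} then orbit_coord p z L * orbit_coord q z J else 0)
    = (\<Sum>rs \<in> {rs. sorted_wrt (<) rs \<and> length rs = k \<and> set rs \<subseteq> {..<p} \<and>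
                  (!) L ` set rs \<inter> {q + 1..p} = {}}.
        orbit_coord p z (exch_left L J rs) * orbit_coord q z (exch_right L J rs))"
proof -
  define l where "l r i = orbit_entry p z (Suc i) (L ! r)" for r i
  define w where "w m i = orbit_entry p z (Suc i) (J ! m)" for m i
  define y where "y j i = orbit_entry q z (Suc i) (J ! j)" for j i
  define V where "V = {rs \<in> index_seqs p k. (!) L ` set rs \<inter> {q + 1..p} = {}}"
  \<comment> \<open>An index in \<open>{q + 1..p}\<close> labels a unit row of the larger minor
    whose 1 lies beyond the first \<open>q\<close> places.\<close>
  have entry: "orbit_entry p z (Suc i) x = (if x \<in> {q + 1..p} then 0 else orbit_entry q z (Suc i) x)"
    if "i < q" for i x
    using that \<open>q \<le> p\<close> by (auto simp: orbit_entry_def)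
  have "rows_det p l * rows_det q (append_rows k w y)
      = (if set (take k J) \<inter> {q + 1..p} = {} then orbit_coord p z L * orbit_coord q z J else 0)"
  proof (cases "set (take k J) \<inter> {q + 1..p} = {}")
    case True
    then have J: "J ! m \<notin> {q + 1..p}" if "m < k" for m
      using that q \<open>k \<le> q\<close> by (auto simp: in_set_conv_nth disjoint_iff)
    have "rows_det q (append_rows k w y) = orbit_coord q z J"
      unfolding orbit_coord_def
    proof (rule rows_det_cong)
      fix j i assume "j < q" "i < q"
      then show "append_rows k w y j i = orbit_entry q z (Suc i) (J ! j)"
        using J[of j] entry[of i "J ! j"] by (cases "j < k") (auto simp: append_rows_def w_def y_def)
    qed
    with True show ?thesis by (simp add: orbit_coord_def l_def[abs_def])
  next
    case False
    then obtain m where "m < k" "J ! m \<in> {q + 1..p}"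
      using q \<open>k \<le> q\<close> by (auto simp: in_set_conv_nth disjoint_iff)
    then have "rows_det q (append_rows k w y) = 0"
      using \<open>k \<le> q\<close> entry by (intro rows_det_zero_row[of m]) (auto simp: append_rows_def w_def)
    with False show ?thesis by simp
  qed
  moreover have "(\<Sum>rs\<in>index_seqs p k.
        rows_det p (replace_rows rs w l) * rows_det q (append_rows k (\<lambda>m. l (rs ! m)) y))
      = (\<Sum>rs\<in>V. rows_det p (replace_rows rs w l) * rows_det q (append_rows k (\<lambda>m. l (rs ! m)) y))"
  proof (rule sum.mono_neutral_right)
    show "\<forall>rs\<in>index_seqs p k - V.
      rows_det p (replace_rows rs w l) * rows_det q (append_rows k (\<lambda>m. l (rs ! m)) y) = 0"
    proof
      fix rs assume rs: "rs \<in> index_seqs p k - V"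
      then obtain m where "m < k" "L ! (rs ! m) \<in> {q + 1..p}"
        by (auto simp: V_def index_seqs_def in_set_conv_nth disjoint_iff)
      then have "rows_det q (append_rows k (\<lambda>m. l (rs ! m)) y) = 0"
        using \<open>k \<le> q\<close> entry by (intro rows_det_zero_row[of m]) (auto simp: append_rows_def l_def)
      then show "rows_det p (replace_rows rs w l) * rows_det q (append_rows k (\<lambda>m. l (rs ! m)) y) = 0"
        by simp
    qed
  qed (auto simp: V_def finite_index_seqs)
  moreover have "\<dots> = (\<Sum>rs\<in>V. orbit_coord p z (exch_left L J rs) * orbit_coord q z (exch_right L J rs))"
  proof (rule sum.cong)
    fix rs assume rs: "rs \<in> V"
    then have rs': "distinct rs" "length rs = k" "set rs \<subseteq> {..<p}"
      "\<And>m. m < k \<Longrightarrow> L ! (rs ! m) \<notin> {q + 1..p}"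
      using index_seqsD[of rs p k] by (auto simp: V_def disjoint_iff)
    have "rows_det p (replace_rows rs w l) = orbit_coord p z (exch_left L J rs)"
      unfolding orbit_coord_def
      using exch_left_eq[of rs J L "\<lambda>x i. orbit_entry p z (Suc i) x"] rs' p q \<open>k \<le> q\<close>
      by (simp add: w_def[abs_def] l_def[abs_def])
    moreover have "rows_det q (append_rows k (\<lambda>m. l (rs ! m)) y) = orbit_coord q z (exch_right L J rs)"
      unfolding orbit_coord_def
    proof (rule rows_det_cong)
      fix j i assume "j < q" "i < q"
      then show "append_rows k (\<lambda>m. l (rs ! m)) y j i = orbit_entry q z (Suc i) (exch_right L J rs ! j)"
        using rs'(2) rs'(4)[of j] entry[of i "L ! (rs ! j)"] \<open>k \<le> q\<close> q
        by (cases "j < k") (auto simp: append_rows_def l_def y_def exch_right_def nth_append)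
    qed
    ultimately show "rows_det p (replace_rows rs w l) * rows_det q (append_rows k (\<lambda>m. l (rs ! m)) y)
      = orbit_coord p z (exch_left L J rs) * orbit_coord q z (exch_right L J rs)" by simp
  qed simp
  moreover have "V = {rs. sorted_wrt (<) rs \<and> length rs = k \<and> set rs \<subseteq> {..<p} \<and>
                  (!) L ` set rs \<inter> {q + 1..p} = {}}"
    by (auto simp: V_def index_seqs_def)
  ultimately show ?thesis
    using exchange_defect_zero[OF \<open>k \<le> q\<close> \<open>q \<le> p\<close>, of l y w] by (simp add: exchange_defect_def)
qed

section \<open>Leading terms\<close>

text \<open>A lexicographic position: a smaller row ranks higher, and within one row a larger entry
  does. The factor \<open>n + 1\<close> exceeds every entry, so distinct pairs get distinct
  exponents. Rows come first in this order so that the earliest deviation of a filling decides its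
  weight.\<close>

definition pair_rank :: "nat \<Rightarrow> nat \<times> nat \<Rightarrow> nat"
  where "pair_rank n x = snd x + (n + 1) * (n - fst x)"

lemma pair_rank_less:
  assumes "b \<le> b'" "b' \<le> n" "a' \<le> a" "a \<le> n" "(a, b) \<noteq> (a', b')"
  shows "pair_rank n (a, b) < pair_rank n (a', b')"
proof (cases "a = a'")
  case False
  then have "(n + 1) * (n - a) + (n + 1) \<le> (n + 1) * (n - a')"
    using assms mult_le_mono2[of "n - a + 1" "n - a'" "n + 1"] by (simp add: algebra_simps)
  then show ?thesis using assms by (simp add: pair_rank_def)
qed (use assms in \<open>auto simp: pair_rank_def\<close>)

lemma inj_on_pair_rank: "inj_on (pair_rank n) ({1..n} \<times> {1..n})"
proof (rule inj_onI, clarify)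
  fix a b a' b' assume *: "pair_rank n (a, b) = pair_rank n (a', b')" "a \<in> {1..n}" "b \<in> {1..n}" "a' \<in> {1..n}" "b' \<in> {1..n}"
  then have "(b + (n + 1) * (n - a)) div (n + 1) = (b' + (n + 1) * (n - a')) div (n + 1)"
    by (simp add: pair_rank_def)
  then have "n - a = n - a'" using * by (simp only: div_mult_self2) simp
  with * show "a = a' \<and> b = b'" by (auto simp: pair_rank_def)
qed

definition col_weight :: "nat \<Rightarrow> nat \<Rightarrow> nat set \<Rightarrow> nat"
  where "col_weight n Q J = (\<Sum>x\<in>col_pairs J. Q ^ pair_rank n x)"

lemma col_weight_eq:
  assumes "J \<in> idx n d"
  shows "col_weight n Q J = (\<Sum>a\<in>gaps d J. Q ^ pair_rank n (a, col_entry d J a))"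
  unfolding col_weight_def col_pairs_def using idxD(2)[OF assms]
  by (subst sum.reindex) (auto simp: inj_on_def)

lemma bij_betw_col_entry:
  assumes "J \<in> idx n d"
  shows "bij_betw (col_entry d J) {1..d} J"
proof -
  have "col_entry d J ` {1..d} = J"
  proof
    show "col_entry d J ` {1..d} \<subseteq> J"
      using col_entry_mem[OF assms] by (force simp: col_entry_def gaps_def tails_def split: if_splits)
    show "J \<subseteq> col_entry d J ` {1..d}"
    proof
      fix x assume x: "x \<in> J"
      show "x \<in> col_entry d J ` {1..d}"
      proof (cases "x \<in> {1..d}")
        case True
        with x show ?thesis by (intro image_eqI[of _ _ x]) (auto simp: col_entry_def)
      next
        case False
        with x have "x \<in> col_entry d J ` gaps d J" by (simp add: col_entry_image[OF assms] tails_def)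
        then show ?thesis by (auto simp: gaps_def)
      qed
    qed
  qed
  moreover have "inj_on (col_entry d J) {1..d}"
    using calculation idxD(2)[OF assms] by (intro eq_card_imp_inj_on) auto
  ultimately show ?thesis by (simp add: bij_betw_def)
qed

text \<open>The first gap in which another filling deviates from the PBW column gets a smaller entry, and this
  outweighs all later gaps.\<close>

lemma filling_weight_less:
  assumes J: "J \<in> idx n d" and bij: "bij_betw \<beta> {1..d} J"
    and fixed: "\<And>i. i \<in> {1..d} \<Longrightarrow> \<beta> i \<le> d \<Longrightarrow> \<beta> i = i"
    and Q: "n < Q" and neq: "\<exists>i\<in>{1..d}. \<beta> i \<noteq> col_entry d J i"
  shows "(\<Sum>i\<in>{1..d}. if \<beta> i \<le> d then 0 else Q ^ pair_rank n (i, \<beta> i)) < col_weight n Q J"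
proof -
  let ?T = "col_entry d J" and ?A = "gaps d J"
  note fJ = idxD[OF J]
  have stay: "\<beta> i = i" if "i \<in> {1..d}" "i \<in> J" for i
  proof -
    have "i \<in> \<beta> ` {1..d}" using bij that by (simp add: bij_betw_def)
    then obtain j where "j \<in> {1..d}" "\<beta> j = i" by blast
    with fixed[of j] that show ?thesis by auto
  qed
  have gap: "\<beta> i > d" if "i \<in> ?A" for i
  proof (rule ccontr)
    assume "\<not> \<beta> i > d"
    then have "\<beta> i = i" using that fixed[of i] by (auto simp: gaps_def)
    moreover have "\<beta> i \<in> J" using that bij by (auto simp: gaps_def bij_betw_def)
    ultimately show False using that by (simp add: gaps_def)
  qed
  have tail: "\<beta> i \<in> tails d J" if "i \<in> ?A" for i
    using gap[OF that] that bij by (auto simp: gaps_def tails_def bij_betw_def)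
  have W: "(\<Sum>i\<in>{1..d}. if \<beta> i \<le> d then 0 else Q ^ pair_rank n (i, \<beta> i))
      = (\<Sum>i\<in>?A. Q ^ pair_rank n (i, \<beta> i))"
  proof -
    have "(\<Sum>i\<in>{1..d}. if \<beta> i \<le> d then 0 else Q ^ pair_rank n (i, \<beta> i))
        = (\<Sum>i\<in>?A. if \<beta> i \<le> d then 0 else Q ^ pair_rank n (i, \<beta> i))"
      using stay by (intro sum.mono_neutral_right) (auto simp: gaps_def)
    also have "\<dots> = (\<Sum>i\<in>?A. Q ^ pair_rank n (i, \<beta> i))"
      by (rule sum.cong) (use gap in force)+
    finally show ?thesis .
  qed
  define S where "S = {i \<in> ?A. \<beta> i \<noteq> ?T i}"
  have finA: "finite ?A" by (simp add: gaps_def)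
  then have "finite S" by (simp add: S_def)
  moreover have "S \<noteq> {}"
    using neq stay by (force simp: S_def gaps_def col_entry_def)
  ultimately have "Min S \<in> S" "\<And>j. j \<in> S \<Longrightarrow> Min S \<le> j" by auto
  moreover define i where "i = Min S"
  ultimately have i: "i \<in> ?A" "\<beta> i \<noteq> ?T i" and imin: "\<And>j. j \<in> ?A \<Longrightarrow> j < i \<Longrightarrow> \<beta> j = ?T j"
    unfolding S_def by force+
  have later: "\<exists>j'\<in>?A. i \<le> j' \<and> \<beta> j = ?T j'" if j: "j \<in> ?A" "i \<le> j" for j
  proof -
    obtain j' where j': "j' \<in> ?A" "\<beta> j = ?T j'" using tail[OF j(1)] col_entry_image[OF J] by auto
    have "i \<le> j'"
    proof (rule ccontr)
      assume "\<not> i \<le> j'"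
      then have "\<beta> j' = \<beta> j" using imin[OF j'(1)] j' by simp
      moreover have "inj_on \<beta> {1..d}" "j \<in> {1..d}" "j' \<in> {1..d}"
        using bij j(1) j'(1) by (auto simp: bij_betw_def gaps_def)
      ultimately have "j' = j" by (blast dest: inj_onD)
      with \<open>\<not> i \<le> j'\<close> j show False by simp
    qed
    with j' show ?thesis by blast
  qed
  define G where "G = pair_rank n (i, ?T i)"
  have rank: "pair_rank n (j, \<beta> j) < G" if j: "j \<in> ?A" "i \<le> j" for j
    unfolding G_def
  proof (rule pair_rank_less)
    obtain j' where j': "j' \<in> ?A" "i \<le> j'" "\<beta> j = ?T j'" using later[OF j] by blast
    then show "\<beta> j \<le> ?T i" using col_entry_le_iff[OF J j'(1) i(1)] by simp
    show "?T i \<le> n" using col_entry_le[OF J, of i] i by (simp add: gaps_def)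
    show "j \<le> n" using j fJ by (simp add: gaps_def)
    show "(j, \<beta> j) \<noteq> (i, ?T i)" using i by auto
  qed (use j in simp)
  let ?U = "{j \<in> ?A. i \<le> j}" and ?L = "{j \<in> ?A. j < i}"
  have split: "(\<Sum>j\<in>?A. h j) = (\<Sum>j\<in>?L. h j) + (\<Sum>j\<in>?U. h j)" for h :: "nat \<Rightarrow> nat"
  proof -
    have "?A = ?L \<union> ?U" by auto
    then have "sum h ?A = sum h (?L \<union> ?U)" by simp
    also have "\<dots> = sum h ?L + sum h ?U" using finA by (intro sum.union_disjoint) auto
    finally show ?thesis .
  qed
  have "0 < G" using rank[OF i(1)] by simp
  have "(\<Sum>j\<in>?U. Q ^ pair_rank n (j, \<beta> j)) \<le> (\<Sum>j\<in>?U. Q ^ (G - 1))"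
    using rank Q by (intro sum_mono power_increasing) force+
  also have "\<dots> = card ?U * Q ^ (G - 1)" by simp
  also have "\<dots> < Q * Q ^ (G - 1)"
  proof -
    have "card ?U \<le> card {1..d}" by (rule card_mono) (auto simp: gaps_def)
    then show ?thesis using Q fJ by (intro mult_strict_right_mono) auto
  qed
  also have "Q * Q ^ (G - 1) = Q ^ G" using \<open>0 < G\<close> by (simp flip: power_Suc)
  also have "Q ^ G \<le> (\<Sum>j\<in>?U. Q ^ pair_rank n (j, ?T j))"
    using finA i member_le_sum[of i ?U "\<lambda>j. Q ^ pair_rank n (j, ?T j)"] by (simp add: G_def)
  finally have "(\<Sum>j\<in>?U. Q ^ pair_rank n (j, \<beta> j)) < (\<Sum>j\<in>?U. Q ^ pair_rank n (j, ?T j))" .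
  moreover have "(\<Sum>j\<in>?L. Q ^ pair_rank n (j, \<beta> j)) = (\<Sum>j\<in>?L. Q ^ pair_rank n (j, ?T j))"
    using imin by (intro sum.cong) auto
  ultimately show ?thesis unfolding W col_weight_eq[OF J] split by linarith
qed

section \<open>The leading term of a minor\<close>

lemma prod_monom_1: "finite A \<Longrightarrow> (\<Prod>r\<in>A. monom (1::'a::comm_semiring_1) (e r)) = monom 1 (\<Sum>r\<in>A. e r)"
  by (induction A rule: finite_induct) (simp_all add: mult_monom one_pCons monom_0)

definition monomial_matrix :: "nat \<Rightarrow> nat \<Rightarrow> nat \<Rightarrow> nat \<Rightarrow> complex poly"
  where "monomial_matrix n Q a b = monom 1 (Q ^ pair_rank n (a, b))"

text \<open>In the Leibniz expansion each nonzero term is, up to sign, one power of the variable,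
  whose exponent is the weight of a filling of the column. By \<open>filling_weight_less\<close> the
  PBW filling alone has the largest weight, so the top term cannot cancel.\<close>

lemma degree_orbit_coord:
  assumes J: "J \<in> idx n d" and Q: "n < Q"
  defines "P \<equiv> orbit_coord d (monomial_matrix n Q) (sorted_list_of_set J)"
  shows "degree P = col_weight n Q J" "P \<noteq> 0"
proof -
  define js where "js = sorted_list_of_set J"
  define f where "f r i = orbit_entry d (monomial_matrix n Q) (Suc i) (js ! r)" for r i
  define N where "N = col_weight n Q J"
  define T where "T = col_entry d J"
  note fJ = idxD[OF J]
  have js: "length js = d" "set js = J" "distinct js" using fJ by (auto simp: js_def)
  have jsb: "bij_betw (\<lambda>r. js ! r) {0..<d} J"
    using bij_betw_nth[OF js(3), of "{..<length js}" J] js by (simp add: lessThan_atLeast0)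
  have T: "bij_betw T {1..d} J" unfolding T_def by (rule bij_betw_col_entry[OF J])
  define \<pi>0 where "\<pi>0 r = (if r < d then inv_into {1..d} T (js ! r) - 1 else r)" for r
  have \<pi>0T: "T (Suc (\<pi>0 r)) = js ! r \<and> \<pi>0 r < d" if "r < d" for r
  proof -
    have "js ! r \<in> J" using that js nth_mem by blast
    then have "inv_into {1..d} T (js ! r) \<in> {1..d}" "T (inv_into {1..d} T (js ! r)) = js ! r"
      using T by (metis bij_betw_imp_surj_on inv_into_into) (metis T \<open>js ! r \<in> J\<close> bij_betw_inv_into_right)
    then show ?thesis using that by (auto simp: \<pi>0_def)
  qed
  have \<pi>0: "\<pi>0 permutes {0..<d}"
  proof (rule bij_imp_permutes)
    have "inj_on \<pi>0 {0..<d}"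
    proof (rule inj_onI)
      fix r s assume "r \<in> {0..<d}" "s \<in> {0..<d}" "\<pi>0 r = \<pi>0 s"
      then have "js ! r = js ! s" using \<pi>0T[of r] \<pi>0T[of s] by simp
      then show "r = s" using js \<open>r \<in> _\<close> \<open>s \<in> _\<close> by (simp add: nth_eq_iff_index_eq)
    qed
    moreover have "\<pi>0 ` {0..<d} \<subseteq> {0..<d}" using \<pi>0T by auto
    ultimately show "bij_betw \<pi>0 {0..<d} {0..<d}"
      by (auto simp: bij_betw_def endo_inj_surj)
  qed (auto simp: \<pi>0_def)
  \<comment> \<open>An index up to \<open>d\<close> labels a unit row, so a permutation gives a
    nonzero product only if it sends that index to its own row.\<close>
  define ok where "ok \<pi> \<longleftrightarrow> (\<forall>r<d. js ! r \<le> d \<longrightarrow> Suc (\<pi> r) = js ! r)" for \<pi>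
  define W where "W \<pi> = (\<Sum>r\<in>{0..<d}. if js ! r \<le> d then 0 else Q ^ pair_rank n (Suc (\<pi> r), js ! r))" for \<pi>
  have prod_ok: "(\<Prod>r\<in>{0..<d}. f r (\<pi> r)) = monom 1 (W \<pi>)" if "ok \<pi>" for \<pi>
  proof -
    have "(\<Prod>r\<in>{0..<d}. f r (\<pi> r))
        = (\<Prod>r\<in>{0..<d}. monom 1 (if js ! r \<le> d then 0 else Q ^ pair_rank n (Suc (\<pi> r), js ! r)))"
      using that by (intro prod.cong) (auto simp: f_def orbit_entry_def monomial_matrix_def ok_def one_pCons monom_0)
    then show ?thesis by (simp add: prod_monom_1 W_def)
  qed
  have prod_not_ok: "(\<Prod>r\<in>{0..<d}. f r (\<pi> r)) = 0" if "\<not> ok \<pi>" for \<pi>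
  proof -
    obtain r where "r < d" "js ! r \<le> d" "Suc (\<pi> r) \<noteq> js ! r" using \<open>\<not> ok \<pi>\<close> by (auto simp: ok_def)
    then have "f r (\<pi> r) = 0" by (simp add: f_def orbit_entry_def)
    with \<open>r < d\<close> show ?thesis by (intro prod_zero) auto
  qed
  \<comment> \<open>Summing over the rows of the column instead of list positions turns a
    permutation into a filling \<beta>, the form in which \<open>filling_weight_less\<close>
    compares weights.\<close>
  have reindex: "W \<pi> = (\<Sum>i\<in>{1..d}. if \<beta> i \<le> d then 0 else Q ^ pair_rank n (i, \<beta> i))"
    if "\<pi> permutes {0..<d}" and \<beta>: "\<And>r. r < d \<Longrightarrow> \<beta> (Suc (\<pi> r)) = js ! r" for \<pi> \<beta>
  proof -
    have "bij_betw (\<lambda>r. Suc (\<pi> r)) {0..<d} {1..d}"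
    proof -
      have "bij_betw Suc {0..<d} {1..d}" by (simp add: bij_betw_def image_Suc_atLeastLessThan atLeastLessThanSuc_atLeastAtMost)
      from bij_betw_trans[OF permutes_imp_bij[OF that(1)] this] show ?thesis by (simp add: comp_def)
    qed
    have "(\<Sum>r\<in>{0..<d}. if \<beta> (Suc (\<pi> r)) \<le> d then 0 else Q ^ pair_rank n (Suc (\<pi> r), \<beta> (Suc (\<pi> r))))
        = (\<Sum>i\<in>{1..d}. if \<beta> i \<le> d then 0 else Q ^ pair_rank n (i, \<beta> i))"
      by (rule sum.reindex_bij_betw[OF \<open>bij_betw (\<lambda>r. Suc (\<pi> r)) {0..<d} {1..d}\<close>])
    moreover have "W \<pi> = (\<Sum>r\<in>{0..<d}. if \<beta> (Suc (\<pi> r)) \<le> d then 0 else Q ^ pair_rank n (Suc (\<pi> r), \<beta> (Suc (\<pi> r))))"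
      unfolding W_def by (rule sum.cong) (simp_all add: \<beta>)
    ultimately show ?thesis by simp
  qed
  have ok0: "ok \<pi>0"
    unfolding ok_def
  proof (intro allI impI)
    fix r assume r: "r < d" "js ! r \<le> d"
    then have "T (Suc (\<pi>0 r)) \<le> d" "Suc (\<pi>0 r) \<in> {1..d}" using \<pi>0T[of r] by auto
    then have "T (Suc (\<pi>0 r)) = Suc (\<pi>0 r)"
      using col_entry_gt[OF J, of "Suc (\<pi>0 r)"] by (auto simp: T_def col_entry_def gaps_def split: if_splits)
    then show "Suc (\<pi>0 r) = js ! r" using \<pi>0T[of r] r by simp
  qed
  have W0: "W \<pi>0 = N"
  proof -
    have "W \<pi>0 = (\<Sum>i\<in>{1..d}. if T i \<le> d then 0 else Q ^ pair_rank n (i, T i))"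
      by (rule reindex[OF \<pi>0]) (use \<pi>0T in blast)
    also have "\<dots> = (\<Sum>i\<in>gaps d J. if T i \<le> d then 0 else Q ^ pair_rank n (i, T i))"
      by (intro sum.mono_neutral_right) (auto simp: gaps_def T_def col_entry_def)
    also have "\<dots> = (\<Sum>i\<in>gaps d J. Q ^ pair_rank n (i, T i))"
      using col_entry_gt[OF J] by (intro sum.cong) (force simp: T_def)+
    finally show ?thesis by (simp add: N_def col_weight_eq[OF J] T_def)
  qed
  have Wless: "W \<pi> < N" if \<pi>: "\<pi> permutes {0..<d}" "ok \<pi>" "\<pi> \<noteq> \<pi>0" for \<pi>
  proof -
    define \<beta> where "\<beta> i = js ! (inv_into UNIV \<pi> (i - 1))" for i
    have \<beta>: "\<beta> (Suc (\<pi> r)) = js ! r" for r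
      using permutes_inverses(2)[OF \<pi>(1)] by (simp add: \<beta>_def)
    have "bij_betw \<beta> {1..d} J"
    proof -
      have "bij_betw (\<lambda>i. i - 1) {1..d} {0..<d}"
        by (rule bij_betwI[of _ _ _ Suc]) auto
      from bij_betw_trans[OF this permutes_imp_bij[OF permutes_inv[OF \<pi>(1)]]]
      have "bij_betw (inv_into UNIV \<pi> \<circ> (\<lambda>i. i - 1)) {1..d} {0..<d}" .
      from bij_betw_trans[OF this jsb] show ?thesis by (simp add: \<beta>_def[abs_def] comp_def)
    qed
    moreover have "\<beta> i = i" if "i \<in> {1..d}" "\<beta> i \<le> d" for i
    proof -
      have r: "inv_into UNIV \<pi> (i - 1) < d"
        using permutes_in_image[OF permutes_inv[OF \<pi>(1)], of "i - 1"] that by auto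
      have "\<pi> (inv_into UNIV \<pi> (i - 1)) = i - 1" by (rule permutes_inverses(1)[OF \<pi>(1)])
      then show ?thesis using \<pi>(2) that r unfolding ok_def by (auto simp: \<beta>_def)
    qed
    moreover have "\<exists>i\<in>{1..d}. \<beta> i \<noteq> col_entry d J i"
    proof (rule ccontr)
      assume "\<not> ?thesis"
      then have \<beta>T: "\<beta> i = T i" if "i \<in> {1..d}" for i using that by (auto simp: T_def)
      have "\<pi> r = \<pi>0 r" for r
      proof (cases "r < d")
        case True
        then have "\<pi> r < d" using permutes_in_image[OF \<pi>(1), of r] by auto
        then have "T (Suc (\<pi> r)) = T (Suc (\<pi>0 r))" using \<beta>[of r] \<beta>T[of "Suc (\<pi> r)"] \<pi>0T[OF True] by auto
        moreover have "inj_on T {1..d}" "Suc (\<pi> r) \<in> {1..d}" "Suc (\<pi>0 r) \<in> {1..d}"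
          using T \<open>\<pi> r < d\<close> \<pi>0T[OF True] by (auto simp: bij_betw_def)
        ultimately have "Suc (\<pi> r) = Suc (\<pi>0 r)" by (blast dest: inj_onD)
        then show ?thesis by simp
      next
        case False
        then show ?thesis using permutes_not_in[OF \<pi>(1), of r] by (simp add: \<pi>0_def)
      qed
      with \<pi>(3) show False by auto
    qed
    ultimately show ?thesis
      using filling_weight_less[OF J _ _ Q] reindex[OF \<pi>(1) \<beta>] by (simp add: N_def)
  qed
  have coeff_term: "coeff (signof \<pi> * (\<Prod>r = 0..<d. f r (\<pi> r))) M = (if \<pi> = \<pi>0 \<and> M = N then signof \<pi> else 0)"
    if "\<pi> permutes {0..<d}" "N \<le> M" for \<pi> M
  proof (cases "ok \<pi>")
    case True
    have "W \<pi> = M \<longleftrightarrow> \<pi> = \<pi>0 \<and> M = N"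
      using Wless[OF that(1) True] W0 that(2) by force
    then show ?thesis using prod_ok[OF True]
      by (cases \<pi> rule: sign_cases) (auto simp: coeff_monom)
  next
    case False
    with ok0 show ?thesis by (auto simp: prod_not_ok)
  qed
  have coeff: "coeff P M = (if M = N then signof \<pi>0 else 0)" if "N \<le> M" for M
  proof -
    have "P = rows_det d f" by (simp add: P_def orbit_coord_def f_def[abs_def] js_def)
    then have "coeff P M = (\<Sum>\<pi> | \<pi> permutes {0..<d}. if \<pi> = \<pi>0 \<and> M = N then signof \<pi> else 0)"
      unfolding \<open>P = rows_det d f\<close> rows_det_expand coeff_sum
      by (intro sum.cong refl coeff_term) (use that in auto)
    also have "\<dots> = (if M = N then \<Sum>\<pi> | \<pi> permutes {0..<d}. if \<pi> = \<pi>0 then signof \<pi> else 0 else 0)"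
      by (simp cong: if_cong)
    also have "\<dots> = (if M = N then signof \<pi>0 else 0)"
      using \<pi>0 by (simp add: finite_permutations)
    finally show ?thesis .
  qed
  have "coeff P N \<noteq> 0" using coeff[of N] by (cases \<pi>0 rule: sign_cases) auto
  then show "P \<noteq> 0" by auto
  show "degree P = col_weight n Q J"
  proof (rule antisym)
    show "degree P \<le> col_weight n Q J" using coeff by (intro degree_le) (auto simp: N_def)
    show "col_weight n Q J \<le> degree P" using \<open>coeff P N \<noteq> 0\<close> by (simp add: le_degree N_def)
  qed
qed

section \<open>Uniqueness of expansions in base Q\<close>

lemma base_sum_less:
  fixes f g :: "'a \<Rightarrow> nat"
  assumes "finite A" "inj_on g A" "\<And>x. x \<in> A \<Longrightarrow> f x < Q" "\<And>x. x \<in> A \<Longrightarrow> g x < G" "0 < Q"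
  shows "(\<Sum>x\<in>A. f x * Q ^ g x) < Q ^ G"
proof -
  have "(\<Sum>x\<in>A. f x * Q ^ g x) \<le> (\<Sum>x\<in>A. (Q - 1) * Q ^ g x)"
    using assms(3) by (intro sum_mono mult_right_mono) force+
  also have "\<dots> = (\<Sum>k\<in>g ` A. (Q - 1) * Q ^ k)" using assms by (simp add: sum.reindex)
  also have "\<dots> \<le> (\<Sum>k<G. (Q - 1) * Q ^ k)" using assms by (intro sum_mono2) auto
  also have "\<dots> < Q ^ G"
  proof (induction G)
    case (Suc G)
    have "(\<Sum>k<Suc G. (Q - 1) * Q ^ k) < Q ^ G + (Q - 1) * Q ^ G" using Suc by simp
    also have "\<dots> = Q ^ Suc G" using \<open>0 < Q\<close> by (cases Q) simp_all
    finally show ?case .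
  qed simp
  finally show ?thesis .
qed

text \<open>At the highest position where the digits differ, a difference of one outweighs all lower
  digits together, by \<open>base_sum_less\<close>.\<close>

lemma base_digits_unique:
  fixes f f' g :: "'a \<Rightarrow> nat"
  assumes fin: "finite S" and inj: "inj_on g S" and less: "\<And>x. x \<in> S \<Longrightarrow> f x < Q \<and> f' x < Q"
    and eq: "(\<Sum>x\<in>S. f x * Q ^ g x) = (\<Sum>x\<in>S. f' x * Q ^ g x)" and "x \<in> S"
  shows "f x = f' x"
proof (rule ccontr)
  assume neq: "f x \<noteq> f' x"
  have "0 < Q" using less[OF \<open>x \<in> S\<close>] by simp
  define D where "D = {x \<in> S. f x \<noteq> f' x}"
  have D: "finite D" "D \<noteq> {}" "D \<subseteq> S" using fin neq \<open>x \<in> S\<close> by (auto simp: D_def)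
  have "Max (g ` D) \<in> g ` D" using D by (intro Max_in) auto
  then obtain y where y: "y \<in> D" "g y = Max (g ` D)" by auto
  have gy: "g w < g y" if "w \<in> D - {y}" for w
  proof -
    have "g w \<le> g y" using that D y by simp
    moreover have "g w \<noteq> g y" using that D(3) y(1) inj_onD[OF inj, of w y] by blast
    ultimately show ?thesis by simp
  qed
  have split: "(\<Sum>x\<in>S. h x * Q ^ g x) = (\<Sum>x\<in>S - D. h x * Q ^ g x) + (h y * Q ^ g y + (\<Sum>x\<in>D - {y}. h x * Q ^ g x))"
    for h :: "'a \<Rightarrow> nat"
    using D y fin by (simp add: sum.subset_diff[of D S] sum.remove[of D y])
  have contra: False if h: "\<And>x. x \<in> S \<Longrightarrow> h x < Q" "h y < h' y"
    and heq: "(\<Sum>x\<in>S. h x * Q ^ g x) = (\<Sum>x\<in>S. h' x * Q ^ g x)"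
    and same: "\<And>x. x \<in> S - D \<Longrightarrow> h x = h' x" for h h' :: "'a \<Rightarrow> nat"
  proof -
    have "(\<Sum>x\<in>D - {y}. h x * Q ^ g x) < Q ^ g y"
      using D gy h(1) \<open>0 < Q\<close> inj by (intro base_sum_less) (auto intro: inj_on_subset)
    moreover have "h y * Q ^ g y + Q ^ g y \<le> h' y * Q ^ g y"
      using h(2) mult_right_mono[of "h y + 1" "h' y" "Q ^ g y"] by simp
    moreover have "(\<Sum>x\<in>S - D. h x * Q ^ g x) = (\<Sum>x\<in>S - D. h' x * Q ^ g x)"
      using same by (intro sum.cong) auto
    ultimately show False using heq unfolding split by linarith
  qed
  have "f y \<noteq> f' y" using y by (simp add: D_def)
  then consider "f y < f' y" | "f' y < f y" by linarith
  then show False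
  proof cases
    case 1
    show False by (rule contra[of f f']) (use 1 less eq in \<open>auto simp: D_def\<close>)
  next
    case 2
    show False by (rule contra[of f' f]) (use 2 less eq in \<open>auto simp: D_def\<close>)
  qed
qed

section \<open>Standard monomials\<close>

text \<open>Summing over all subsets of \<open>{1..n}\<close>, a set independent of
  \<open>m\<close>, makes this degree and the two counts below additive in \<open>m\<close> without
  any side condition on supports.\<close>

definition total_deg :: "nat \<Rightarrow> (nat set \<Rightarrow>\<^sub>0 nat) \<Rightarrow> nat"
  where "total_deg n m = (\<Sum>J\<in>Pow {1..n}. lookup m J)"

definition multi_deg :: "nat \<Rightarrow> (nat set \<Rightarrow>\<^sub>0 nat) \<Rightarrow> nat \<Rightarrow> nat"
  where "multi_deg n m d = (\<Sum>J\<in>{J \<in> Pow {1..n}. card J = d}. lookup m J)"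

definition pair_count :: "nat \<Rightarrow> (nat set \<Rightarrow>\<^sub>0 nat) \<Rightarrow> nat \<times> nat \<Rightarrow> nat"
  where "pair_count n m x = (\<Sum>J\<in>{J \<in> Pow {1..n}. x \<in> col_pairs J}. lookup m J)"

text \<open>Comparing all pairs of columns by their keys avoids arranging the columns in a tableau.
  The key order also ensures that the column in the role of \<open>J\<close> is not the longer
  one.\<close>

definition standard :: "nat \<Rightarrow> (nat set \<Rightarrow>\<^sub>0 nat) \<Rightarrow> bool"
  where "standard n m \<longleftrightarrow> (\<forall>J\<in>keys m. \<forall>L\<in>keys m.
    col_key n J \<le> col_key n L \<longrightarrow> \<not> nonstandard (card L) (card J) L J)"

lemma standard_mono: "keys m1 \<subseteq> keys m \<Longrightarrow> standard n m \<Longrightarrow> standard n m1"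
  by (simp add: standard_def subset_iff)

lemma idx_card: "J \<subseteq> {1..n} \<Longrightarrow> J \<in> idx n (card J)"
  by (simp add: idx_def)

lemma multi_deg_pos_iff: "multi_deg n m d \<noteq> 0 \<longleftrightarrow> (\<exists>J\<in>keys m. J \<subseteq> {1..n} \<and> card J = d)"
  by (auto simp: multi_deg_def in_keys_iff)

lemma pair_count_pos_iff: "pair_count n m x \<noteq> 0 \<longleftrightarrow> (\<exists>J\<in>keys m. J \<subseteq> {1..n} \<and> x \<in> col_pairs J)"
  by (auto simp: pair_count_def in_keys_iff)

lemma multi_deg_add: "multi_deg n (m + m') d = multi_deg n m d + multi_deg n m' d"
  by (simp add: multi_deg_def lookup_add sum.distrib)

lemma pair_count_add: "pair_count n (m + m') x = pair_count n m x + pair_count n m' x"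
  by (simp add: pair_count_def lookup_add sum.distrib)

lemma total_deg_add: "total_deg n (m + m') = total_deg n m + total_deg n m'"
  by (simp add: total_deg_def lookup_add sum.distrib)

lemma total_deg_single: "C \<subseteq> {1..n} \<Longrightarrow> total_deg n (single C k) = k"
  by (simp add: total_deg_def lookup_single when_def)

lemma total_deg_eq_sum: "total_deg n m = (\<Sum>d\<le>n. multi_deg n m d)"
proof -
  have "card J \<le> n" if "J \<in> Pow {1..n}" for J using that card_mono[of "{1..n}" J] by auto
  then have "(\<Sum>d\<le>n. \<Sum>J\<in>{J \<in> Pow {1..n}. card J = d}. lookup m J)
      = (\<Sum>J\<in>Pow {1..n}. lookup m J)"
    by (intro sum.group) auto
  then show ?thesis by (simp add: total_deg_def multi_deg_def)
qed

lemma pair_count_le: "pair_count n m x \<le> total_deg n m"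
  unfolding pair_count_def total_deg_def by (rule sum_mono2) auto

lemma monomial_split:
  assumes "C \<in> keys m"
  obtains m1 :: "nat set \<Rightarrow>\<^sub>0 nat" where "m = single C 1 + m1"
    "keys m1 \<subseteq> keys m"
proof
  show "m = single C 1 + (m - single C 1)"
    using assms by (intro poly_mapping_eqI) (auto simp: lookup_add lookup_minus lookup_single when_def in_keys_iff)
  show "keys (m - single C 1) \<subseteq> keys m"
    by (auto simp: in_keys_iff lookup_minus)
qed

lemma obtains_max_key:
  fixes m :: "nat set \<Rightarrow>\<^sub>0 nat"
  assumes "m \<noteq> 0"
  obtains C where "C \<in> keys m"
    "\<And>J. J \<in> keys m \<Longrightarrow> col_key n J \<le> col_key n C"
proof -
  have "Max (col_key n ` keys m) \<in> col_key n ` keys m"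
    using assms by (intro Max_in) auto
  then obtain C where "C \<in> keys m" "col_key n C = Max (col_key n ` keys m)" by auto
  then show thesis by (intro that[of C]) auto
qed

text \<open>The pairs of the largest column are the maximal elements among all pairs of the monomial that
  fit into a column of its size; hence the columns can be read off one by one.\<close>

lemma standard_unique:
  assumes "keys m \<subseteq> Pow {1..n}" "keys m' \<subseteq> Pow {1..n}"
    and "standard n m" "standard n m'"
    and "\<And>d. multi_deg n m d = multi_deg n m' d" "\<And>x. pair_count n m x = pair_count n m' x"
  shows "m = m'"
  using assms
proof (induction "total_deg n m" arbitrary: m m' rule: less_induct)
  case less
  have tot: "total_deg n m = total_deg n m'"
    unfolding total_deg_eq_sum using less.prems(5) by simp
  have zero: "m = 0" if "total_deg n m = 0" "keys m \<subseteq> Pow {1..n}" for m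
    using that by (intro poly_mapping_eqI) (force simp: total_deg_def in_keys_iff)
  show ?case
  proof (cases "total_deg n m = 0")
    case True
    then show ?thesis using zero less.prems tot by metis
  next
    case False
    have "m \<noteq> 0" using False by (auto simp: total_deg_def)
    then obtain C where C: "C \<in> keys m"
      "\<And>J. J \<in> keys m \<Longrightarrow> col_key n J \<le> col_key n C" using obtains_max_key by blast
    have "m' \<noteq> 0" using False tot by (auto simp: total_deg_def)
    then obtain C' where C': "C' \<in> keys m'"
      "\<And>J. J \<in> keys m' \<Longrightarrow> col_key n J \<le> col_key n C'" using obtains_max_key by blast
    have sub: "C \<subseteq> {1..n}" "C' \<subseteq> {1..n}" using C C' less.prems by auto
    \<comment> \<open>A column with the largest key also has the largest size, and the multi-degree
      shows which sizes occur.\<close>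
    have le: "card C \<le> card C'"
      if C: "C \<in> keys m" "C \<subseteq> {1..n}" and m': "\<And>d. multi_deg n m d = multi_deg n m' d"
        and C': "C' \<subseteq> {1..n}" "\<And>J. J \<in> keys m' \<Longrightarrow> col_key n J \<le> col_key n C'"
      for m m' :: "nat set \<Rightarrow>\<^sub>0 nat" and C C'
    proof -
      have "multi_deg n m' (card C) \<noteq> 0"
        using C m'[of "card C"] multi_deg_pos_iff[of n m "card C"] by metis
      then obtain J where "J \<in> keys m'" "J \<subseteq> {1..n}" "card J = card C"
        using multi_deg_pos_iff[of n m' "card C"] by blast
      then show ?thesis
        using card_le_of_col_key_le[OF idx_card[of J n] idx_card[of C' n]] C' by simp
    qed
    have card: "card C = card C'"
      using le[OF C(1) sub(1) less.prems(5) sub(2) C'(2)]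
        le[OF C'(1) sub(2) less.prems(5)[symmetric] sub(1) C(2)] by simp
    have pairs: "col_pairs C = max_pairs (card C) {x. pair_count n m x \<noteq> 0}"
      if C: "C \<in> keys m" "\<And>J. J \<in> keys m \<Longrightarrow> col_key n J \<le> col_key n C"
        and m: "keys m \<subseteq> Pow {1..n}" "standard n m" for C m
    proof -
      have "{x. pair_count n m x \<noteq> 0} = (\<Union>J\<in>keys m. col_pairs J)"
        unfolding pair_count_pos_iff using m(1) by blast
      moreover have "col_pairs C = max_pairs (card C) (\<Union>J\<in>keys m. col_pairs J)"
        by (rule col_pairs_eq_max_pairs[of _ _ n])
          (use C m in \<open>auto simp: standard_def idx_def\<close>)
      ultimately show ?thesis by simp
    qed
    have "col_pairs C = col_pairs C'"
      using pairs[OF C less.prems(1,3)] pairs[OF C' less.prems(2,4)] less.prems(6) card by simp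
    then have CC: "C = C'"
      using col_pairs_inj[of C n "card C" C'] sub card by (simp add: idx_def)
    obtain m1 where m1: "m = single C 1 + m1" "keys m1 \<subseteq> keys m"
      using monomial_split[OF C(1)] .
    obtain m1' where m1': "m' = single C 1 + m1'" "keys m1' \<subseteq> keys m'"
      using monomial_split[OF C'(1)] CC by metis
    have "m1 = m1'"
    proof (rule less.hyps)
      show "total_deg n m1 < total_deg n m"
        using sub by (simp add: m1 total_deg_add total_deg_single)
      show "keys m1 \<subseteq> Pow {1..n}" "keys m1' \<subseteq> Pow {1..n}"
        using m1 m1' less.prems by auto
      show "standard n m1" "standard n m1'"
        using standard_mono[OF m1(2) less.prems(3)] standard_mono[OF m1'(2) less.prems(4)] .
      show "multi_deg n m1 d = multi_deg n m1' d" for d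
        using less.prems(5)[of d] by (simp add: m1(1) m1'(1) multi_deg_add)
      show "pair_count n m1 x = pair_count n m1' x" for x
        using less.prems(6)[of x] by (simp add: m1(1) m1'(1) pair_count_add)
    qed
    then show ?thesis by (simp add: m1(1) m1'(1))
  qed
qed

section \<open>Independence of standard monomials on the orbit\<close>

lemma col_pairs_subset: "J \<subseteq> {1..n} \<Longrightarrow> col_pairs J \<subseteq> {1..n} \<times> {1..n}"
proof
  fix x assume J: "J \<subseteq> {1..n}" and "x \<in> col_pairs J"
  then obtain a where a: "a \<in> gaps (card J) J" "x = (a, col_entry (card J) J a)" by (auto simp: col_pairs_def)
  note idx = idx_card[OF J]
  show "x \<in> {1..n} \<times> {1..n}"
    using a col_entry_le[OF idx, of a] col_entry_gt[OF idx a(1)] idxD(4)[OF idx] by (auto simp: gaps_def)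
qed

text \<open>Double counting of columns and the pairs in them. It exhibits the pair counts as digits
  in base \<open>Q\<close>.\<close>

lemma sum_col_weight:
  assumes "keys m \<subseteq> Pow {1..n}"
  shows "(\<Sum>J\<in>keys m. lookup m J * col_weight n Q J)
    = (\<Sum>x\<in>{1..n} \<times> {1..n}. pair_count n m x * Q ^ pair_rank n x)"
proof -
  let ?P = "{1..n} \<times> {1..n}"
  have "(\<Sum>J\<in>keys m. lookup m J * col_weight n Q J)
      = (\<Sum>J\<in>Pow {1..n}. lookup m J * col_weight n Q J)"
    using assms by (intro sum.mono_neutral_left) (auto simp: in_keys_iff)
  also have "\<dots> = (\<Sum>J\<in>Pow {1..n}. \<Sum>x\<in>?P. if x \<in> col_pairs J then lookup m J * Q ^ pair_rank n x else 0)"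
  proof (rule sum.cong)
    fix J assume "J \<in> Pow {1..n}"
    then have "?P \<inter> col_pairs J = col_pairs J" using col_pairs_subset by blast
    then have "(\<Sum>x\<in>?P. if x \<in> col_pairs J then lookup m J * Q ^ pair_rank n x else 0)
        = (\<Sum>x\<in>col_pairs J. lookup m J * Q ^ pair_rank n x)"
      using sum.inter_restrict[of ?P "\<lambda>x. lookup m J * Q ^ pair_rank n x" "col_pairs J"] by simp
    then show "lookup m J * col_weight n Q J
        = (\<Sum>x\<in>?P. if x \<in> col_pairs J then lookup m J * Q ^ pair_rank n x else 0)"
      by (simp add: col_weight_def sum_distrib_left)
  qed simp
  also have "\<dots> = (\<Sum>x\<in>?P. \<Sum>J\<in>Pow {1..n}. if x \<in> col_pairs J then lookup m J * Q ^ pair_rank n x else 0)"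
    by (rule sum.swap)
  also have "\<dots> = (\<Sum>x\<in>?P. pair_count n m x * Q ^ pair_rank n x)"
  proof (rule sum.cong)
    fix x
    show "(\<Sum>J\<in>Pow {1..n}. if x \<in> col_pairs J then lookup m J * Q ^ pair_rank n x else 0)
        = pair_count n m x * Q ^ pair_rank n x"
      unfolding pair_count_def sum_distrib_right
      by (subst sum.inter_filter[symmetric]) auto
  qed simp
  finally show ?thesis .
qed

abbreviation orbit_point :: "(nat \<Rightarrow> nat \<Rightarrow> 'a) \<Rightarrow> nat set \<Rightarrow> 'a::comm_ring_1"
  where "orbit_point z J \<equiv> orbit_coord (card J) z (sorted_list_of_set J)"

text \<open>The substitution turns each standard monomial into a nonzero polynomial in one variable
  whose degree determines its pair counts. With the multi-degree fixed these determine the monomial,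
  so all degrees are distinct and the largest one survives.\<close>

theorem standard_independent:
  assumes std: "\<And>m. m \<in> keys q \<Longrightarrow> standard n m"
    and sub: "\<And>m. m \<in> keys q \<Longrightarrow> keys m \<subseteq> Pow {1..n}"
    and mdeg: "\<And>m d. m \<in> keys q \<Longrightarrow> multi_deg n m d = e d"
    and zero: "\<And>z. eval_mpoly (orbit_point z) q = 0"
  shows "q = 0"
proof (rule ccontr)
  assume "q \<noteq> 0"
  \<comment> \<open>\<open>Q\<close> exceeds \<open>n\<close>, as \<open>degree_orbit_coord\<close>
    requires, and exceeds every pair count, since those are bounded by the total degree.\<close>
  define Q where "Q = Suc (n + (\<Sum>d\<le>n. e d))"
  define P where "P = orbit_point (monomial_matrix n Q)"
  define R where "R m = (\<Prod>J\<in>keys m. P J ^ lookup m J)" for m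
  have P: "degree (P J) = col_weight n Q J" "P J \<noteq> 0" if "J \<subseteq> {1..n}" for J
    unfolding P_def using degree_orbit_coord[OF idx_card[OF that], of Q] by (simp_all add: Q_def)
  have R: "R m \<noteq> 0" "degree (R m) = (\<Sum>x\<in>{1..n} \<times> {1..n}. pair_count n m x * Q ^ pair_rank n x)"
    if "m \<in> keys q" for m
  proof -
    have K: "J \<subseteq> {1..n}" if "J \<in> keys m" for J using sub[OF \<open>m \<in> _\<close>] that by auto
    show "R m \<noteq> 0" using P K by (simp add: R_def)
    have "degree (R m) = (\<Sum>J\<in>keys m. degree (P J ^ lookup m J))"
      unfolding R_def using P K by (intro degree_prod_eq_sum_degree) auto
    also have "\<dots> = (\<Sum>J\<in>keys m. lookup m J * col_weight n Q J)"
      using P K by (intro sum.cong) (auto simp: degree_power_eq)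
    finally show "degree (R m) = (\<Sum>x\<in>{1..n} \<times> {1..n}. pair_count n m x * Q ^ pair_rank n x)"
      using sum_col_weight[OF sub[OF that]] by simp
  qed
  have count: "pair_count n m x < Q" if "m \<in> keys q" for m x
    using pair_count_le[of n m x] mdeg[OF that] by (simp add: total_deg_eq_sum Q_def)
  have inj: "m = m'" if m: "m \<in> keys q" "m' \<in> keys q"
    and deg: "degree (R m) = degree (R m')" for m m'
  proof (rule standard_unique[OF sub[OF m(1)] sub[OF m(2)] std[OF m(1)] std[OF m(2)]])
    show "multi_deg n m d = multi_deg n m' d" for d using mdeg m by simp
    show "pair_count n m x = pair_count n m' x" for x
    proof (cases "x \<in> {1..n} \<times> {1..n}")
      case True
      show ?thesis
        by (rule base_digits_unique[OF _ inj_on_pair_rank[of n] _ _ True, of _ Q])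
          (use count m deg R in auto)
    next
      case False
      then have "pair_count n m x = 0" for m
        using pair_count_pos_iff[of n m x] col_pairs_subset by blast
      then show ?thesis by simp
    qed
  qed
  define F where "F = (\<Sum>m\<in>keys q. Polynomial.smult (lookup q m) (R m))"
  have "poly F t = 0" for t
  proof -
    have "poly F t = eval_mpoly (orbit_point (\<lambda>i j. poly (monomial_matrix n Q i j) t)) q"
      by (simp add: F_def R_def P_def eval_mpoly_def poly_sum poly_prod poly_orbit_coord)
    then show ?thesis by (simp add: zero)
  qed
  then have "F = 0" using poly_all_0_iff_0 by blast
  define N where "N = Max ((\<lambda>m. degree (R m)) ` keys q)"
  have "N \<in> (\<lambda>m. degree (R m)) ` keys q"
    unfolding N_def using \<open>q \<noteq> 0\<close> by (intro Max_in) auto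
  then obtain M where M: "M \<in> keys q" "degree (R M) = N" by auto
  have other: "coeff (R m) N = 0" if "m \<in> keys q - {M}" for m
  proof -
    have "degree (R m) \<le> N" using that by (auto simp: N_def)
    moreover have "degree (R m) \<noteq> N" using inj[of m M] that M by auto
    ultimately show ?thesis by (intro coeff_eq_0) simp
  qed
  have "coeff F N = lookup q M * coeff (R M) N"
    unfolding F_def coeff_sum using M other
    by (subst sum.remove[of _ M]) auto
  moreover have "coeff (R M) N \<noteq> 0" using R(1)[OF M(1)] M(2) by auto
  moreover have "lookup q M \<noteq> 0" using M by (simp add: in_keys_iff)
  ultimately show False using \<open>F = 0\<close> by simp
qed

section \<open>The PBW filtration in coordinates\<close>

text \<open>The replaced index is named by its value rather than its position in the list, so the
  sum runs over the set \<open>K\<close> and can be compared across different sets.\<close>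

definition act_basis :: "nat \<Rightarrow> (nat \<Rightarrow> nat \<Rightarrow> complex) \<Rightarrow> nat set \<Rightarrow> ext"
  where "act_basis n x K = (let ks = sorted_list_of_set K in
    \<Sum>a\<in>K. \<Sum>i\<in>{1..n}. ext_scale (x i a) (wedge (map (\<lambda>y. if y = a then i else y) ks)))"

lemma ext_act_eq:
  assumes "finite S" "keys v \<subseteq> S" "\<And>K. K \<in> S \<Longrightarrow> finite K"
  shows "ext_act n x v = (\<Sum>K\<in>S. ext_scale (lookup v K) (act_basis n x K))"
proof -
  have *: "(let js = sorted_list_of_set K in
        \<Sum>r<length js. \<Sum>i\<in>{1..n}. ext_scale (x i (js ! r)) (wedge (js[r := i]))) = act_basis n x K"
    if "K \<in> S" for K
  proof -
    let ?ks = "sorted_list_of_set K"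
    define f where "f a = (\<Sum>i\<in>{1..n}. ext_scale (x i a) (wedge (map (\<lambda>y. if y = a then i else y) ?ks)))" for a
    have "bij_betw ((!) ?ks) {..<length ?ks} K"
      by (rule bij_betw_nth) (use assms(3)[OF that] in auto)
    from sum.reindex_bij_betw[OF this, of f]
    have "(\<Sum>r<length ?ks. f (?ks ! r)) = (\<Sum>a\<in>K. f a)" .
    moreover have "map (\<lambda>y. if y = ?ks ! r then i else y) ?ks = ?ks[r := i]" if "r < length ?ks" for r i
      using that by (auto intro!: nth_equalityI simp: nth_list_update nth_eq_iff_index_eq)
    ultimately show ?thesis by (simp add: act_basis_def f_def Let_def)
  qed
  have "ext_act n x v = (\<Sum>K\<in>keys v. ext_scale (lookup v K) (act_basis n x K))"
    unfolding ext_act_def using assms(2) * by (intro sum.cong) auto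
  also have "\<dots> = (\<Sum>K\<in>S. ext_scale (lookup v K) (act_basis n x K))"
    using assms(1,2) by (intro sum.mono_neutral_left) (auto simp: in_keys_iff)
  finally show ?thesis .
qed

lemma finite_idx: "finite (idx n d)"
  by (rule finite_subset[of _ "Pow {1..n}"]) (auto simp: idx_def)

lemma ext_act_idx:
  assumes "keys v \<subseteq> idx n d"
  shows "ext_act n x v = (\<Sum>K\<in>idx n d. ext_scale (lookup v K) (act_basis n x K))"
  using assms idxD(3) by (intro ext_act_eq finite_idx) auto

definition filtr :: "nat \<Rightarrow> nat \<Rightarrow> int \<Rightarrow> ext set"
  where "filtr n d t = {v. \<forall>J\<in>keys v. J \<in> idx n d \<and> int (deg d J) \<le> t}"

lemma subspace_filtr: "ext.subspace (filtr n d t)"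
proof (rule ext.subspaceI)
  fix v w c assume v: "v \<in> filtr n d t"
  show "v + w \<in> filtr n d t" if "w \<in> filtr n d t"
    using v that Poly_Mapping.keys_add[of v w] unfolding filtr_def by blast
  have "keys (ext_scale c v) \<subseteq> keys v" by (auto simp: in_keys_iff)
  then show "ext_scale c v \<in> filtr n d t" using v unfolding filtr_def by blast
qed (simp add: filtr_def)

lemma filtr_mono: "s \<le> t \<Longrightarrow> filtr n d s \<subseteq> filtr n d t"
  by (force simp: filtr_def)

lemma single_in_filtr: "J \<in> idx n d \<Longrightarrow> int (deg d J) \<le> t \<Longrightarrow> single J c \<in> filtr n d t"
  by (simp add: filtr_def)

lemma keys_wedge_replace:
  assumes "K \<in> idx n d" "a \<in> K" "i \<in> {1..n}"
    and "J \<in> keys (wedge (map (\<lambda>y. if y = a then i else y) (sorted_list_of_set K)))"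
  shows "J = insert i (K - {a})" "J \<in> idx n d" "i \<notin> K - {a}"
proof -
  let ?f = "\<lambda>y. if y = a then i else y"
  note fK = idxD[OF assms(1)]
  have d: "distinct (map ?f (sorted_list_of_set K))" "J = ?f ` K"
    using assms(4) fK by (auto simp: wedge_def split: if_splits)
  show J: "J = insert i (K - {a})" using d(2) assms(2) by auto
  have "inj_on ?f K" using d(1) fK by (simp add: distinct_map)
  then have "card J = card K" unfolding d(2) by (rule card_image)
  moreover have "card J = (if i \<in> K - {a} then card K - 1 else card K)"
    using J fK assms(2) card_gt_0_iff[of K] by (auto simp: card_insert_if)
  moreover have "card K > 0" using fK assms(2) card_gt_0_iff by blast
  ultimately show "i \<notin> K - {a}" by (auto split: if_splits)
  show "J \<in> idx n d" using J \<open>card J = card K\<close> fK assms(3) by (auto simp: idx_def)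
qed

lemma act_basis_filtr:
  assumes x: "x \<in> nminus n" and K: "K \<in> idx n d"
  shows "act_basis n x K \<in> filtr n d (int (deg d K) + 1)"
  unfolding act_basis_def Let_def
proof (intro ext.subspace_sum[OF subspace_filtr] ext.subspace_scale[OF subspace_filtr])
  fix a i assume a: "a \<in> K" and i: "i \<in> {1..n}"
  let ?w = "wedge (map (\<lambda>y. if y = a then i else y) (sorted_list_of_set K))"
  have "int (deg d J) \<le> int (deg d K) + 1 \<and> J \<in> idx n d" if "J \<in> keys ?w" for J
  proof -
    note J = keys_wedge_replace[OF K a i that]
    have "{j \<in> J. d < j} \<subseteq> insert i {j \<in> K. d < j}" using J by auto
    then have "deg d J \<le> card (insert i {j \<in> K. d < j})"
      unfolding deg_def using idxD(3)[OF K] by (intro card_mono) auto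
    also have "\<dots> \<le> Suc (deg d K)" unfolding deg_def using idxD(3)[OF K] by (simp add: card_insert_if)
    finally show ?thesis using J by simp
  qed
  then show "?w \<in> filtr n d (int (deg d K) + 1)" by (auto simp: filtr_def)
qed

lemma ext_act_filtr:
  assumes x: "x \<in> nminus n" and v: "v \<in> filtr n d t"
  shows "ext_act n x v \<in> filtr n d (t + 1)"
proof -
  have "ext_act n x v = (\<Sum>K\<in>idx n d. ext_scale (lookup v K) (act_basis n x K))"
    using v by (intro ext_act_idx) (auto simp: filtr_def)
  also have "\<dots> \<in> filtr n d (t + 1)"
  proof (rule ext.subspace_sum[OF subspace_filtr])
    fix K assume K: "K \<in> idx n d"
    show "ext_scale (lookup v K) (act_basis n x K) \<in> filtr n d (t + 1)"
    proof (cases "K \<in> keys v")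
      case True
      then have "int (deg d K) + 1 \<le> t + 1" using v by (auto simp: filtr_def)
      then show ?thesis using act_basis_filtr[OF x K] filtr_mono
        by (intro ext.subspace_scale[OF subspace_filtr]) blast
    next
      case False
      then show ?thesis using ext.subspace_0[OF subspace_filtr] by (simp add: in_keys_iff)
    qed
  qed
  finally show ?thesis .
qed

section \<open>Root vectors reach every basis vector\<close>

lemma ext_act_scale_single:
  assumes "finite K"
  shows "ext_act n x (ext_scale c (single K 1)) = ext_scale c (act_basis n x K)"
  by (subst ext_act_eq[of "{K}"]) (use assms in \<open>auto simp: in_keys_iff lookup_single when_def split: if_splits\<close>)

lemma hw_vec_eq: "hw_vec d = single {1..d} 1"
proof -
  have "set [1..<d + 1] = {1..d}" by auto
  then show ?thesis unfolding hw_vec_def wedge_def by (simp add: seq_sign_sorted del: upt_Suc)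
qed

lemma deg_eq_0_iff:
  assumes "J \<in> idx n d"
  shows "deg d J = 0 \<longleftrightarrow> J = {1..d}"
proof
  assume "deg d J = 0"
  then have "J \<subseteq> {1..d}" using idxD[OF assms] by (force simp: deg_def)
  then show "J = {1..d}" using idxD[OF assms] by (intro card_subset_eq) auto
qed (auto simp: deg_def)

lemma exchange_idx:
  assumes "J \<in> idx n d" "a \<in> {1..n} - J" "b \<in> J"
  shows "insert a (J - {b}) \<in> idx n d"
  using idxD[OF assms(1)] assms(2,3) card_gt_0_iff[of J] by (auto simp: idx_def card_insert_if)

lemma deg_exchange:
  assumes "finite J" "a \<notin> J" "b \<in> J"
  shows "deg d (insert a (J - {b})) + of_bool (d < b) = deg d J + of_bool (d < a)"
proof -
  have "{j \<in> insert a (J - {b}). d < j} = (if d < a then insert a ({j \<in> J. d < j} - {b}) else {j \<in> J. d < j} - {b})"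
    by auto
  moreover have "card ({j \<in> J. d < j} - {b}) + of_bool (d < b) = card {j \<in> J. d < j}"
  proof (cases "d < b")
    case True
    then have "card {j \<in> J. d < j} > 0" using assms by (subst card_gt_0_iff) auto
    then show ?thesis using assms True by (simp add: card_Diff_singleton)
  qed (use assms in auto)
  ultimately show ?thesis using assms by (auto simp: deg_def)
qed

lemma act_basis_root_vec:
  assumes K: "K \<in> idx n d" and "a \<in> K" "1 \<le> b" "b \<in> {1..n} - K"
  shows "act_basis n (root_vec a (b - 1)) K
    = single (insert b (K - {a})) (seq_sign (map (\<lambda>y. if y = a then b else y) (sorted_list_of_set K)))"
proof -
  let ?w = "\<lambda>a i. wedge (map (\<lambda>y. if y = a then i else y) (sorted_list_of_set K))"
  have "act_basis n (root_vec a (b - 1)) K = (\<Sum>a'\<in>K. \<Sum>i\<in>{1..n}. if a' = a \<and> i = b then ?w a b else 0)"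
    unfolding act_basis_def Let_def using assms
    by (intro sum.cong) (auto simp: root_vec_def)
  also have "\<dots> = (\<Sum>a'\<in>K. if a' = a then ?w a b else 0)"
    using assms by (intro sum.cong) auto
  also have "\<dots> = ?w a b" using assms idxD(3)[OF K] by simp
  also have "?w a b = single (insert b (K - {a})) (seq_sign (map (\<lambda>y. if y = a then b else y) (sorted_list_of_set K)))"
  proof -
    have "inj_on (\<lambda>y. if y = a then b else y) K" using assms by (auto simp: inj_on_def)
    moreover have "(\<lambda>y. if y = a then b else y) ` K = insert b (K - {a})" using assms by auto
    ultimately show ?thesis using idxD(3)[OF K] by (simp add: wedge_def distinct_map)
  qed
  finally show ?thesis .
qed

text \<open>If \<open>J\<close> has an index \<open>b\<close> beyond \<open>d\<close>, it also has a
  gap \<open>a\<close>. Trading \<open>b\<close> for \<open>a\<close> lowers the degree by one, and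
  the root vector taking \<open>a\<close> to \<open>b\<close> leads back to \<open>J\<close> up to
  sign with no other summand, since \<open>a\<close> can be replaced in only one way.\<close>

lemma single_reachable:
  assumes "J \<in> idx n d"
  shows "\<exists>xs s. set xs \<subseteq> nminus n \<and> length xs = deg d J \<and> s \<noteq> 0 \<and>
    foldr (ext_act n) xs (hw_vec d) = ext_scale s (single J 1)"
  using assms
proof (induction "deg d J" arbitrary: J)
  case 0
  then show ?case using deg_eq_0_iff[of J n d]
    by (intro exI[of _ "[]"] exI[of _ 1]) (auto simp: hw_vec_eq)
next
  case (Suc k)
  note fJ = idxD[OF Suc.prems]
  have "{j \<in> J. d < j} \<noteq> {}" using Suc.hyps(2) unfolding deg_def by (metis card.empty nat.distinct(1))
  then obtain b where b: "b \<in> J" "d < b" by auto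
  then have "tails d J \<noteq> {}" by (auto simp: tails_def)
  then have "card (tails d J) \<noteq> 0" using finite_tails[OF Suc.prems] by simp
  then have "gaps d J \<noteq> {}" using card_gaps[OF fJ(3,2)] by (metis card.empty)
  then obtain a where a: "a \<in> {1..d}" "a \<notin> J" unfolding gaps_def by blast
  define K where "K = insert a (J - {b})"
  have K: "K \<in> idx n d" unfolding K_def using a b fJ by (intro exchange_idx[OF Suc.prems]) auto
  have "deg d K = k" using deg_exchange[of J a b d] a b fJ Suc.hyps(2) by (simp add: K_def)
  then obtain xs s where xs: "set xs \<subseteq> nminus n" "length xs = k" "s \<noteq> 0"
    "foldr (ext_act n) xs (hw_vec d) = ext_scale s (single K 1)"
    using Suc.hyps(1)[of K] K by metis
  define f where "f = root_vec a (b - 1)"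
  have f: "f \<in> nminus n" using a b fJ by (auto simp: f_def nminus_def root_vec_def split: if_splits)
  have J: "insert b (K - {a}) = J" using a b by (auto simp: K_def)
  have act: "act_basis n f K = single J (seq_sign (map (\<lambda>y. if y = a then b else y) (sorted_list_of_set K)))"
    unfolding f_def J[symmetric] using a b fJ by (intro act_basis_root_vec[OF K]) (auto simp: K_def)
  let ?s = "s * seq_sign (map (\<lambda>y. if y = a then b else y) (sorted_list_of_set K))"
  have "foldr (ext_act n) (f # xs) (hw_vec d) = ext_scale ?s (single J 1)"
  proof -
    have "foldr (ext_act n) (f # xs) (hw_vec d) = ext_scale s (act_basis n f K)"
      using xs(4) idxD(3)[OF K] by (simp add: ext_act_scale_single)
    also have "\<dots> = ext_scale ?s (single J 1)"
      unfolding act by (intro poly_mapping_eqI) (simp add: lookup_single when_def)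
    finally show ?thesis .
  qed
  moreover have "?s \<noteq> 0" using xs(3) seq_sign_nonzero by simp
  ultimately show ?case using xs f Suc.hyps(2)
    by (intro exI[of _ "f # xs"] exI[of _ ?s]) auto
qed

text \<open>A derivation replaces one index at a time, so each factor raises the number of indices
  beyond \<open>d\<close> by at most one. Conversely, \<open>single_reachable\<close> obtains each
  basis vector with exactly as many factors as its degree.\<close>

theorem pbw_eq_filtr:
  assumes "d \<le> n"
  shows "pbw n d t = filtr n d t"
proof
  let ?S = "{foldr (ext_act n) xs (hw_vec d) |xs. set xs \<subseteq> nminus n \<and> int (length xs) \<le> t}"
  have "{1..d} \<in> idx n d" using assms by (auto simp: idx_def)
  then have hw: "hw_vec d \<in> filtr n d 0"
    unfolding hw_vec_eq by (intro single_in_filtr) (auto simp: deg_eq_0_iff)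
  have "foldr (ext_act n) xs (hw_vec d) \<in> filtr n d (int (length xs))" if "set xs \<subseteq> nminus n" for xs
    using that
  proof (induction xs)
    case (Cons x xs)
    then show ?case using ext_act_filtr[of x n _ d "int (length xs)"] by (auto simp: add.commute)
  qed (simp add: hw)
  then have "?S \<subseteq> filtr n d t" using filtr_mono by blast
  then show "pbw n d t \<subseteq> filtr n d t"
    unfolding pbw_def by (rule ext.span_minimal[OF _ subspace_filtr])
  show "filtr n d t \<subseteq> pbw n d t"
  proof
    fix v assume v: "v \<in> filtr n d t"
    have "single J 1 \<in> pbw n d t" if "J \<in> keys v" for J
    proof -
      have J: "J \<in> idx n d" "int (deg d J) \<le> t" using v that by (auto simp: filtr_def)
      obtain xs s where xs: "set xs \<subseteq> nminus n" "length xs = deg d J" "s \<noteq> 0"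
        "foldr (ext_act n) xs (hw_vec d) = ext_scale s (single J 1)"
        using single_reachable[OF J(1)] by blast
      have "ext_scale s (single J 1) \<in> pbw n d t"
        unfolding pbw_def using xs J by (intro ext.span_base) (auto intro!: exI[of _ xs])
      then have "ext_scale (1 / s) (ext_scale s (single J 1)) \<in> pbw n d t"
        unfolding pbw_def by (rule ext.span_scale)
      then show ?thesis using xs(3) by simp
    qed
    then have "(\<Sum>J\<in>keys v. ext_scale (lookup v J) (single J 1)) \<in> pbw n d t"
      unfolding pbw_def by (intro ext.span_sum ext.span_scale) auto
    moreover have "v = (\<Sum>J\<in>keys v. ext_scale (lookup v J) (single J 1))"
      by (intro poly_mapping_eqI) (simp add: lookup_sum lookup_single when_def if_distrib in_keys_iff cong: if_cong)
    ultimately show "v \<in> pbw n d t" by simp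
  qed
qed

section \<open>The graded space in coordinates\<close>

definition graded_part :: "nat \<Rightarrow> nat \<Rightarrow> (nat set \<Rightarrow> complex) \<Rightarrow> nat \<Rightarrow> ext"
  where "graded_part n d y t = (\<Sum>J\<in>{J \<in> idx n d. deg d J = t}. single J (y J))"

text \<open>In every degree the coset gets the representative supported on indices of exactly that
  degree. Operators on the graded space thus become maps on coordinate families.\<close>

definition gr_of :: "nat \<Rightarrow> nat \<Rightarrow> (nat set \<Rightarrow> complex) \<Rightarrow> gr"
  where "gr_of n d y = (\<lambda>t. graded_part n d y t +o pbw n d (int t - 1))"

lemma lookup_graded_part:
  "lookup (graded_part n d y t) J = (if J \<in> idx n d \<and> deg d J = t then y J else 0)"
  by (simp add: graded_part_def lookup_sum lookup_single when_def finite_idx)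

lemma graded_part_filtr: "graded_part n d y t \<in> filtr n d (int t)"
  by (auto simp: filtr_def in_keys_iff lookup_graded_part split: if_splits)

lemma mem_coset: "x \<in> u +o F \<longleftrightarrow> x - u \<in> (F :: ext set)"
  by (auto simp: elt_set_plus_def intro: bexI[of _ "x - u"])

lemma coset_eq_iff:
  assumes "ext.subspace F"
  shows "u +o F = v +o F \<longleftrightarrow> u - v \<in> F"
proof
  assume *: "u +o F = v +o F"
  have "u \<in> u +o F" using ext.subspace_0[OF assms] by (simp add: mem_coset)
  then show "u - v \<in> F" using * by (simp add: mem_coset)
next
  assume uv: "u - v \<in> F"
  have "x - u \<in> F \<longleftrightarrow> x - v \<in> F" for x
    using ext.subspace_add[OF assms _ uv, of "x - u"] ext.subspace_diff[OF assms _ uv, of "x - v"] by auto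
  then show "u +o F = v +o F" by (auto simp: mem_coset)
qed

lemma subspace_add_self:
  assumes "ext.subspace F"
  shows "F + F = F"
proof
  show "F + F \<subseteq> F" using ext.subspace_add[OF assms] by (auto simp: set_plus_def)
  show "F \<subseteq> F + F"
  proof
    fix x assume "x \<in> F"
    then have "0 + x \<in> F + F" using ext.subspace_0[OF assms] by (intro set_plus_intro)
    then show "x \<in> F + F" by simp
  qed
qed

text \<open>The index set must be nonempty because an empty sum of sets is \<open>{0}\<close>, not
  \<open>F\<close>.\<close>

lemma coset_sum:
  assumes "ext.subspace F" "finite A" "A \<noteq> {}"
  shows "(\<Sum>a\<in>A. u a +o F) = (\<Sum>a\<in>A. u a) +o F"
  using assms(2,3)
proof (induction A rule: finite_ne_induct)
  case (insert a A)
  then show ?case using set_plus_rearrange[of "u a" F "sum u A" F] subspace_add_self[OF assms(1)] by simp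
qed simp

context
  fixes n d :: nat
  assumes dn: "d \<le> n"
begin

lemma subspace_pbw: "ext.subspace (pbw n d t)"
  by (simp add: pbw_eq_filtr[OF dn] subspace_filtr)

lemma gr_of_eq_iff: "gr_of n d y = gr_of n d y' \<longleftrightarrow> (\<forall>J\<in>idx n d. y J = y' J)"
proof
  assume eq: "gr_of n d y = gr_of n d y'"
  show "\<forall>J\<in>idx n d. y J = y' J"
  proof
    fix J assume J: "J \<in> idx n d"
    let ?t = "deg d J"
    have "graded_part n d y ?t - graded_part n d y' ?t \<in> filtr n d (int ?t - 1)"
      using fun_cong[OF eq, of ?t] coset_eq_iff[OF subspace_pbw] pbw_eq_filtr[OF dn] by (simp add: gr_of_def)
    moreover have "lookup (graded_part n d y ?t - graded_part n d y' ?t) J = y J - y' J"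
      using J by (simp add: lookup_minus lookup_graded_part)
    ultimately show "y J = y' J" by (force simp: filtr_def in_keys_iff)
  qed
next
  assume "\<forall>J\<in>idx n d. y J = y' J"
  then have "graded_part n d y t = graded_part n d y' t" for t
    unfolding graded_part_def by (intro sum.cong) auto
  then show "gr_of n d y = gr_of n d y'" by (simp add: gr_of_def)
qed

lemma gr_of_in_gr_space: "gr_of n d y \<in> gr_space n d"
proof -
  have "graded_part n d y t \<in> pbw n d (int t)" for t
    by (simp add: pbw_eq_filtr[OF dn] graded_part_filtr)
  moreover have "{t. gr_of n d y t \<noteq> pbw n d (int t - 1)} \<subseteq> deg d ` idx n d"
  proof
    fix t assume t: "t \<in> {t. gr_of n d y t \<noteq> pbw n d (int t - 1)}"
    show "t \<in> deg d ` idx n d"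
    proof (rule ccontr)
      assume "t \<notin> deg d ` idx n d"
      then have "{J \<in> idx n d. deg d J = t} = {}" by auto
      then have "graded_part n d y t = 0" unfolding graded_part_def by (simp only: sum.empty)
      with t show False by (simp add: gr_of_def)
    qed
  qed
  ultimately show ?thesis
    unfolding gr_space_def gr_of_def
    using finite_subset[OF _ finite_imageI[OF finite_idx]] by (auto simp: gr_of_def)
qed

lemma gr_zero_eq: "gr_zero n d = gr_of n d (\<lambda>_. 0)"
  by (simp add: gr_zero_def gr_of_def graded_part_def)

lemma gr_scale_gr_of: "gr_scale n d c (gr_of n d y) = gr_of n d (\<lambda>J. c * y J)"
proof
  fix t
  let ?F = "pbw n d (int t - 1)" and ?u = "graded_part n d y t"
  have "ext_scale c ` (?u +o ?F) + ?F = ext_scale c ?u +o ?F"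
  proof
    show "ext_scale c ` (?u +o ?F) + ?F \<subseteq> ext_scale c ?u +o ?F"
    proof
      fix x assume "x \<in> ext_scale c ` (?u +o ?F) + ?F"
      then obtain f g where fg: "f \<in> ?F" "g \<in> ?F" "x = ext_scale c (?u + f) + g"
        by (auto simp: set_plus_def elt_set_plus_def)
      have "ext_scale c f + g \<in> ?F"
        using fg by (intro ext.subspace_add[OF subspace_pbw] ext.subspace_scale[OF subspace_pbw])
      then show "x \<in> ext_scale c ?u +o ?F"
        using fg by (simp add: mem_coset ext.scale_right_distrib)
    qed
    show "ext_scale c ?u +o ?F \<subseteq> ext_scale c ` (?u +o ?F) + ?F"
    proof
      fix x assume "x \<in> ext_scale c ?u +o ?F"
      then have "x - ext_scale c ?u \<in> ?F" by (simp add: mem_coset)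
      moreover have "ext_scale c ?u \<in> ext_scale c ` (?u +o ?F)"
        using ext.subspace_0[OF subspace_pbw] by (intro imageI) (simp add: mem_coset)
      ultimately have "ext_scale c ?u + (x - ext_scale c ?u) \<in> ext_scale c ` (?u +o ?F) + ?F"
        by (intro set_plus_intro)
      then show "x \<in> ext_scale c ` (?u +o ?F) + ?F" by simp
    qed
  qed
  moreover have "ext_scale c ?u = graded_part n d (\<lambda>J. c * y J) t"
    by (intro poly_mapping_eqI) (simp add: lookup_graded_part)
  ultimately show "gr_scale n d c (gr_of n d y) t = gr_of n d (\<lambda>J. c * y J) t"
    by (simp add: gr_scale_def gr_of_def)
qed

lemma gr_vec_eq:
  assumes "J \<in> idx n d"
  shows "gr_vec n d J = gr_of n d (\<lambda>K. if K = J then 1 else 0)"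
proof -
  have "(if t = deg d J then single J 1 else 0) = graded_part n d (\<lambda>K. if K = J then 1 else 0) t" for t
    using assms by (intro poly_mapping_eqI) (auto simp: lookup_graded_part lookup_single when_def)
  then show ?thesis by (simp add: gr_vec_def gr_of_def)
qed

lemma idx_nonempty: "idx n d \<noteq> {}"
proof -
  have "{1..d} \<in> idx n d" using dn by (auto simp: idx_def)
  then show ?thesis by blast
qed

lemma sum_gr_of:
  assumes "finite A" "A \<noteq> {}"
  shows "(\<Sum>a\<in>A. gr_of n d (y a) t) = gr_of n d (\<lambda>J. \<Sum>a\<in>A. y a J) t"
proof -
  have "(\<Sum>a\<in>A. graded_part n d (y a) t) = graded_part n d (\<lambda>J. \<Sum>a\<in>A. y a J) t"
    by (intro poly_mapping_eqI) (auto simp: lookup_sum lookup_graded_part intro!: sum.neutral)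
  then show ?thesis unfolding gr_of_def using coset_sum[OF subspace_pbw assms] by simp
qed

lemma gr_coord_gr_of: "J \<in> idx n d \<Longrightarrow> gr_coord n d (gr_of n d y) J = y J"
proof -
  have sum: "gr_sum (\<lambda>J. gr_scale n d (c J) (gr_vec n d J)) (idx n d) = gr_of n d c" for c
  proof
    fix t
    have "gr_sum (\<lambda>J. gr_scale n d (c J) (gr_vec n d J)) (idx n d) t
        = (\<Sum>J\<in>idx n d. gr_of n d (\<lambda>K. c J * (if K = J then 1 else 0)) t)"
      unfolding gr_sum_def by (intro sum.cong) (simp_all add: gr_vec_eq gr_scale_gr_of)
    also have "\<dots> = gr_of n d (\<lambda>K. \<Sum>J\<in>idx n d. c J * (if K = J then 1 else 0)) t"
      by (rule sum_gr_of[OF finite_idx idx_nonempty])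
    also have "gr_of n d (\<lambda>K. \<Sum>J\<in>idx n d. c J * (if K = J then 1 else 0)) = gr_of n d c"
      unfolding gr_of_eq_iff by (auto simp: finite_idx if_distrib cong: if_cong)
    finally show "gr_sum (\<lambda>J. gr_scale n d (c J) (gr_vec n d J)) (idx n d) t = gr_of n d c t" .
  qed
  have "gr_coord n d (gr_of n d y) = (\<lambda>J. if J \<in> idx n d then y J else 0)"
    unfolding gr_coord_def sum gr_of_eq_iff by (rule the_equality) (auto simp: fun_eq_iff)
  then show "J \<in> idx n d \<Longrightarrow> gr_coord n d (gr_of n d y) J = y J" by simp
qed

section \<open>Induced operators and their exponential\<close>

definition raise :: "(nat \<Rightarrow> nat \<Rightarrow> complex) \<Rightarrow> (nat set \<Rightarrow> complex) \<Rightarrow> nat set \<Rightarrow> complex"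
  where "raise x y J = (if J \<in> idx n d \<and> 0 < deg d J
    then lookup (ext_act n x (graded_part n d y (deg d J - 1))) J else 0)"

lemma ext_act_graded_part:
  "ext_act n x (graded_part n d y t) = (\<Sum>K\<in>{K \<in> idx n d. deg d K = t}. ext_scale (y K) (act_basis n x K))"
proof -
  have "ext_act n x (graded_part n d y t)
      = (\<Sum>K\<in>{K \<in> idx n d. deg d K = t}. ext_scale (lookup (graded_part n d y t) K) (act_basis n x K))"
    using idxD(3) by (intro ext_act_eq) (auto simp: finite_idx in_keys_iff lookup_graded_part split: if_splits)
  then show ?thesis by (simp add: lookup_graded_part)
qed

text \<open>An element of \<open>nminus n\<close> raises the filtration by one, so the image of a
  coset is determined modulo the next filtration step. All components of the image below the new top
  degree are absorbed there.\<close>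

lemma gr_act_gr_of:
  assumes x: "x \<in> nminus n"
  shows "gr_act n d x (gr_of n d y) = gr_of n d (raise x y)"
proof
  fix t
  show "gr_act n d x (gr_of n d y) t = gr_of n d (raise x y) t"
  proof (cases t)
    case 0
    have "graded_part n d (raise x y) 0 = 0"
      by (intro poly_mapping_eqI) (simp add: lookup_graded_part raise_def)
    then show ?thesis using 0 by (simp add: gr_act_def gr_of_def)
  next
    case (Suc s)
    let ?F = "pbw n d (int s)" and ?u = "graded_part n d y s" and ?E = "pbw n d (int s - 1)"
    \<comment> \<open>\<open>ext_act\<close> is a sum over the support of its argument; additivity
      becomes visible once all the sums run over \<open>idx n d\<close>.\<close>
    have lin: "ext_act n x (?u + f) = ext_act n x ?u + ext_act n x f" if "f \<in> ?E" for f
    proof -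
      have f: "keys f \<subseteq> idx n d" using that by (auto simp: pbw_eq_filtr[OF dn] filtr_def)
      moreover have u: "keys ?u \<subseteq> idx n d" using graded_part_filtr by (auto simp: filtr_def)
      moreover have "keys (?u + f) \<subseteq> idx n d" using Poly_Mapping.keys_add[of ?u f] f u by blast
      ultimately show ?thesis
        by (simp add: ext_act_idx lookup_add ext.scale_left_distrib sum.distrib)
    qed
    have E: "ext_act n x f \<in> ?F" if "f \<in> ?E" for f
      using ext_act_filtr[OF x, of f d "int s - 1"] that by (simp add: pbw_eq_filtr[OF dn])
    have "ext_act n x ` (?u +o ?E) + ?F = ext_act n x ?u +o ?F"
    proof
      show "ext_act n x ` (?u +o ?E) + ?F \<subseteq> ext_act n x ?u +o ?F"
      proof
        fix v assume "v \<in> ext_act n x ` (?u +o ?E) + ?F"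
        then obtain f g where fg: "f \<in> ?E" "g \<in> ?F" "v = ext_act n x (?u + f) + g"
          by (auto simp: set_plus_def elt_set_plus_def)
        have "ext_act n x f + g \<in> ?F" using fg E by (intro ext.subspace_add[OF subspace_pbw]) auto
        then show "v \<in> ext_act n x ?u +o ?F" using fg by (simp add: mem_coset lin)
      qed
      show "ext_act n x ?u +o ?F \<subseteq> ext_act n x ` (?u +o ?E) + ?F"
      proof
        fix v assume "v \<in> ext_act n x ?u +o ?F"
        then have "v - ext_act n x ?u \<in> ?F" by (simp add: mem_coset)
        moreover have "ext_act n x ?u \<in> ext_act n x ` (?u +o ?E)"
          using ext.subspace_0[OF subspace_pbw] by (intro imageI) (simp add: mem_coset)
        ultimately have "ext_act n x ?u + (v - ext_act n x ?u) \<in> ext_act n x ` (?u +o ?E) + ?F"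
          by (intro set_plus_intro)
        then show "v \<in> ext_act n x ` (?u +o ?E) + ?F" by simp
      qed
    qed
    also have "\<dots> = graded_part n d (raise x y) (Suc s) +o ?F"
      unfolding pbw_eq_filtr[OF dn] coset_eq_iff[OF subspace_filtr]
    proof -
      have "ext_act n x ?u \<in> filtr n d (int s + 1)"
        by (rule ext_act_filtr[OF x graded_part_filtr])
      then show "ext_act n x ?u - graded_part n d (raise x y) (Suc s) \<in> filtr n d (int s)"
        unfolding filtr_def mem_Collect_eq
        by (force simp: in_keys_iff lookup_minus lookup_graded_part raise_def split: if_splits)
    qed
    finally show ?thesis using Suc by (simp add: gr_act_def gr_of_def)
  qed
qed

text \<open>The sign is moved from the list of \<open>K\<close> to that of \<open>J\<close>, because
  the Laplace expansion in \<open>raise_orbit_part\<close> runs along the indices of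
  \<open>J\<close>. The condition that \<open>J\<close> differs from \<open>K\<close> rules out
  replacing an index by itself.\<close>

lemma lookup_act_basis:
  assumes K: "K \<in> idx n d" and "J \<noteq> K" "a \<in> K" "i \<in> {1..n}"
  shows "lookup (wedge (map (\<lambda>y. if y = a then i else y) (sorted_list_of_set K))) J
    = (if a \<notin> J \<and> i \<in> J \<and> K = insert a (J - {i})
       then seq_sign (map (\<lambda>y. if y = i then a else y) (sorted_list_of_set J)) else 0)"
proof -
  let ?w = "wedge (map (\<lambda>y. if y = a then i else y) (sorted_list_of_set K))"
  show ?thesis
  proof (cases "a \<notin> J \<and> i \<in> J \<and> K = insert a (J - {i})")
    case True
    then have iK: "i \<notin> K" and J: "J = insert i (K - {a})" using assms by auto
    let ?f = "\<lambda>y. if y = a then i else y"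
    have inj: "inj_on ?f K" using iK by (auto simp: inj_on_def)
    have img: "?f ` K = J" unfolding J using assms(3) by auto
    have "?w = single J (seq_sign (map ?f (sorted_list_of_set K)))"
      unfolding wedge_def using inj img idxD(3)[OF K] by (simp only: distinct_map set_map
        set_sorted_list_of_set distinct_sorted_list_of_set simp_thms if_True)
    moreover have "seq_sign (map ?f (sorted_list_of_set K))
        = seq_sign (map (\<lambda>y. if y = i then a else y) (sorted_list_of_set J))"
      unfolding J by (rule seq_sign_replace[OF idxD(3)[OF K] assms(3) iK])
    ultimately show ?thesis using True by (simp only: lookup_single when_def simp_thms if_True)
  next
    case False
    have "J \<notin> keys ?w"
    proof
      assume "J \<in> keys ?w"
      note J = keys_wedge_replace[OF K assms(3,4) this]
      then have "i \<noteq> a" using \<open>J \<noteq> K\<close> assms by auto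
      with J False assms show False by auto
    qed
    then have "lookup ?w J = 0" by (simp add: in_keys_iff)
    with False show ?thesis by (simp only: if_False)
  qed
qed

definition orbit_part :: "(nat \<Rightarrow> nat \<Rightarrow> complex) \<Rightarrow> nat \<Rightarrow> nat set \<Rightarrow> complex"
  where "orbit_part z k J = (if J \<in> idx n d \<and> deg d J = k then orbit_point z J else 0)"

text \<open>Euler's identity, by Laplace expansion along each of the \<open>k + 1\<close> columns beyond \<open>d\<close>.\<close>

lemma raise_orbit_part:
  assumes z: "\<And>a b. a \<in> {1..d} \<Longrightarrow> b \<in> {d<..n} \<Longrightarrow> x b a = z a b"
  shows "raise x (\<lambda>J. c * orbit_part z k J) = (\<lambda>J. c * of_nat (Suc k) * orbit_part z (Suc k) J)"
proof
  fix J
  show "raise x (\<lambda>J. c * orbit_part z k J) J = c * of_nat (Suc k) * orbit_part z (Suc k) J"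
  proof (cases "J \<in> idx n d \<and> deg d J = Suc k")
    case False
    have "raise x (\<lambda>J. c * orbit_part z k J) J = 0"
    proof (cases "J \<in> idx n d \<and> 0 < deg d J")
      case True
      then have "deg d J - 1 \<noteq> k" using False by auto
      then have "graded_part n d (\<lambda>J. c * orbit_part z k J) (deg d J - 1) = 0"
        by (intro poly_mapping_eqI) (simp add: lookup_graded_part orbit_part_def)
      then show ?thesis by (simp add: raise_def ext_act_def)
    qed (auto simp: raise_def)
    with False show ?thesis by (auto simp: orbit_part_def)
  next
    case True
    then have J: "J \<in> idx n d" and degJ: "deg d J = Suc k" by auto
    note fJ = idxD[OF J]
    define js where "js = sorted_list_of_set J"
    define sgn where "sgn a b = seq_sign (map (\<lambda>y. if y = b then a else y) js)" for a b
    define X where "X K = orbit_coord d z (sorted_list_of_set K)" for K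
    let ?S = "{K \<in> idx n d. deg d K = k}" and ?N = "{1..n}"
    have JS: "J \<notin> ?S" using degJ by simp
    have "raise x (\<lambda>J. c * orbit_part z k J) J
        = (\<Sum>K\<in>?S. c * orbit_part z k K * lookup (act_basis n x K) J)"
      using J degJ by (simp add: raise_def ext_act_graded_part lookup_sum)
    also have "\<dots> = (\<Sum>K\<in>?S. c * X K * lookup (act_basis n x K) J)"
      by (rule sum.cong) (auto simp: orbit_part_def X_def idxD(2))
    also have "\<dots> = (\<Sum>K\<in>?S. \<Sum>a\<in>?N. \<Sum>b\<in>?N. if a \<notin> J \<and> b \<in> J \<and> K = insert a (J - {b}) then c * X K * (x b a * sgn a b) else 0)"
    proof (rule sum.cong)
      fix K assume K: "K \<in> ?S"
      then have K': "K \<in> idx n d" "J \<noteq> K" using JS by auto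
      have "lookup (act_basis n x K) J
          = (\<Sum>a\<in>K. \<Sum>b\<in>?N. if a \<notin> J \<and> b \<in> J \<and> K = insert a (J - {b}) then x b a * sgn a b else 0)"
        unfolding act_basis_def Let_def lookup_sum lookup_ext_scale
        using lookup_act_basis[OF K'] by (intro sum.cong) (auto simp: sgn_def js_def)
      also have "\<dots> = (\<Sum>a\<in>?N. \<Sum>b\<in>?N. if a \<notin> J \<and> b \<in> J \<and> K = insert a (J - {b}) then x b a * sgn a b else 0)"
        using idxD(1)[OF K'(1)] by (intro sum.mono_neutral_left) (auto intro!: sum.neutral)
      finally show "c * X K * lookup (act_basis n x K) J
          = (\<Sum>a\<in>?N. \<Sum>b\<in>?N. if a \<notin> J \<and> b \<in> J \<and> K = insert a (J - {b}) then c * X K * (x b a * sgn a b) else 0)"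
        by (simp add: sum_distrib_left if_distrib cong: if_cong)
    qed simp
    also have "\<dots> = (\<Sum>a\<in>?N. \<Sum>b\<in>?N. \<Sum>K\<in>?S. if a \<notin> J \<and> b \<in> J \<and> K = insert a (J - {b}) then c * X K * (x b a * sgn a b) else 0)"
      by (subst sum.swap) (rule sum.cong[OF refl], rule sum.swap)
    also have "\<dots> = (\<Sum>a\<in>?N. \<Sum>b\<in>?N. if a \<notin> J \<and> b \<in> J \<and> a \<le> d \<and> d < b then c * (z a b * (sgn a b * X (insert a (J - {b})))) else 0)"
    proof (intro sum.cong refl)
      fix a b assume a: "a \<in> ?N" and b: "b \<in> ?N"
      show "(\<Sum>K\<in>?S. if a \<notin> J \<and> b \<in> J \<and> K = insert a (J - {b}) then c * X K * (x b a * sgn a b) else 0)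
          = (if a \<notin> J \<and> b \<in> J \<and> a \<le> d \<and> d < b then c * (z a b * (sgn a b * X (insert a (J - {b})))) else 0)"
      proof (cases "a \<notin> J \<and> b \<in> J")
        case ab: True
        let ?K = "insert a (J - {b})"
        have "(\<Sum>K\<in>?S. if a \<notin> J \<and> b \<in> J \<and> K = ?K then c * X K * (x b a * sgn a b) else 0)
            = (if ?K \<in> ?S then c * X ?K * (x b a * sgn a b) else 0)"
          using ab finite_idx by (simp cong: if_cong)
        \<comment> \<open>Trading \<open>b\<close> for \<open>a\<close> lowers the degree by one
          exactly if it moves an index from beyond \<open>d\<close> to at most \<open>d\<close>.
          Hence only those entries of \<open>x\<close> that are given by \<open>z\<close>
          survive.\<close>
        moreover have "?K \<in> ?S \<longleftrightarrow> a \<le> d \<and> d < b"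
          using deg_exchange[of J a b d] fJ ab degJ exchange_idx[OF J, of a b] a by (auto split: if_splits simp: of_bool_def)
        ultimately show ?thesis using ab z[of a b] a b by (auto simp: mult_ac)
      qed auto
    qed
    also have "\<dots> = (\<Sum>b\<in>?N. \<Sum>a\<in>?N. if a \<notin> J \<and> b \<in> J \<and> a \<le> d \<and> d < b then c * (z a b * (sgn a b * X (insert a (J - {b})))) else 0)"
      by (rule sum.swap)
    also have "\<dots> = (\<Sum>b\<in>?N. if b \<in> J \<and> d < b then c * X J else 0)"
    proof (rule sum.cong[OF refl])
      fix b assume b: "b \<in> ?N"
      show "(\<Sum>a\<in>?N. if a \<notin> J \<and> b \<in> J \<and> a \<le> d \<and> d < b then c * (z a b * (sgn a b * X (insert a (J - {b})))) else 0)
          = (if b \<in> J \<and> d < b then c * X J else 0)"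
      proof (cases "b \<in> J \<and> d < b")
        case bJ: True
        then obtain r where r: "r < length js" "js ! r = b"
          using fJ by (metis in_set_conv_nth js_def set_sorted_list_of_set)
        have js: "length js = d" "distinct js" "set js = J" using fJ by (auto simp: js_def)
        have upd: "js[r := a] = map (\<lambda>y. if y = b then a else y) js" for a
          using r js by (auto intro!: nth_equalityI simp: nth_list_update nth_eq_iff_index_eq)
        have upd_coord: "orbit_coord d z (js[r := a]) = (if a \<notin> J then sgn a b * X (insert a (J - {b})) else 0)"
          if "a \<in> {1..d}" for a
        proof (cases "a \<in> J")
          case False
          then have "distinct (js[r := a])" using js by (simp add: distinct_list_update)
          moreover have "set (js[r := a]) = insert a (J - {b})"
            unfolding upd using js bJ by auto
          ultimately show ?thesis
            using False js orbit_coord_sort[of "js[r := a]" d z] by (simp add: X_def sgn_def upd)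
        next
          case aJ: True
          then obtain s where s: "s < length js" "js ! s = a" using js by (metis in_set_conv_nth)
          have "s \<noteq> r" using s r bJ that by auto
          then have "\<not> distinct (js[r := a])"
            using s r nth_eq_iff_index_eq[of "js[r := a]" s r] by auto
          then show ?thesis using aJ js by (simp add: orbit_coord_not_distinct)
        qed
        have "X J = (\<Sum>a\<in>{1..d}. z a b * orbit_coord d z (js[r := a]))"
          using orbit_coord_expand[of r js d z] r js bJ by (simp add: X_def js_def)
        also have "\<dots> = (\<Sum>a\<in>{1..d}. if a \<notin> J then z a b * (sgn a b * X (insert a (J - {b}))) else 0)"
          by (rule sum.cong) (auto simp: upd_coord)
        also have "\<dots> = (\<Sum>a\<in>?N. if a \<notin> J \<and> a \<le> d then z a b * (sgn a b * X (insert a (J - {b}))) else 0)"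
          using dn by (intro sum.mono_neutral_cong_left) auto
        finally show ?thesis using bJ by (simp add: sum_distrib_left if_distrib cong: if_cong)
      qed auto
    qed
    also have "\<dots> = (\<Sum>b\<in>{b \<in> J. d < b}. c * X J)"
    proof -
      have "{b \<in> ?N. b \<in> J \<and> d < b} = {b \<in> J. d < b}" using fJ by auto
      then show ?thesis using sum.inter_filter[of ?N "\<lambda>_. c * X J" "\<lambda>b. b \<in> J \<and> d < b"] by simp
    qed
    also have "\<dots> = of_nat (Suc k) * (c * X J)" using degJ by (simp add: deg_def)
    finally show ?thesis using J degJ fJ by (simp add: orbit_part_def X_def mult_ac)
  qed
qed

lemma raise_power:
  assumes "x \<in> nminus n" "\<And>a b. a \<in> {1..d} \<Longrightarrow> b \<in> {d<..n} \<Longrightarrow> x b a = z a b"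
  shows "(gr_act n d x ^^ k) (gr_of n d (\<lambda>J. c * orbit_part z 0 J)) = gr_of n d (\<lambda>J. c * fact k * orbit_part z k J)"
proof (induction k)
  case (Suc k)
  have "(gr_act n d x ^^ Suc k) (gr_of n d (\<lambda>J. c * orbit_part z 0 J))
      = gr_of n d (raise x (\<lambda>J. (c * fact k) * orbit_part z k J))"
    using Suc by (simp add: gr_act_gr_of[OF assms(1)])
  also have "\<dots> = gr_of n d (\<lambda>J. c * fact (Suc k) * orbit_part z (Suc k) J)"
    using assms(2) by (subst raise_orbit_part) (auto simp: mult_ac)
  finally show ?case .
qed simp

text \<open>The start is a multiple of the highest weight vector, as \<open>{1..d}\<close> is the
  only index set of degree 0. By \<open>raise_power\<close> the \<open>k\<close>-th power
  contributes the degree \<open>k\<close> part of the orbit vector times \<open>fact k\<close>,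
  which the series cancels. In degree \<open>t\<close> only \<open>k = t\<close> contributes, so the
  cut-off keeps everything.\<close>

lemma gr_exp_gr_of:
  assumes "x \<in> nminus n" "\<And>a b. a \<in> {1..d} \<Longrightarrow> b \<in> {d<..n} \<Longrightarrow> x b a = z a b"
  shows "gr_exp n d x (gr_of n d (\<lambda>J. c * orbit_part z 0 J)) = gr_of n d (\<lambda>J. c * orbit_point z J)"
proof
  fix t
  have "gr_exp n d x (gr_of n d (\<lambda>J. c * orbit_part z 0 J)) t
      = (\<Sum>k\<le>t. gr_of n d (\<lambda>J. 1 / fact k * (c * fact k * orbit_part z k J)) t)"
    unfolding gr_exp_def by (simp only: raise_power[OF assms] gr_scale_gr_of)
  also have "\<dots> = gr_of n d (\<lambda>J. \<Sum>k\<le>t. 1 / fact k * (c * fact k * orbit_part z k J)) t"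
    by (rule sum_gr_of) auto
  also have "\<dots> = gr_of n d (\<lambda>J. c * orbit_point z J) t"
  proof -
    have "graded_part n d (\<lambda>J. \<Sum>k\<le>t. 1 / fact k * (c * fact k * orbit_part z k J)) t
        = graded_part n d (\<lambda>J. c * orbit_point z J) t"
      by (intro poly_mapping_eqI) (auto simp: lookup_graded_part orbit_part_def if_distrib cong: if_cong)
    then show ?thesis by (simp add: gr_of_def)
  qed
  finally show "gr_exp n d x (gr_of n d (\<lambda>J. c * orbit_part z 0 J)) t = gr_of n d (\<lambda>J. c * orbit_point z J) t" .
qed

lemma orbit_point_base: "orbit_point z {1..d} = 1"
proof -
  have "sorted_list_of_set {1..d} = [1..<d + 1]" by (simp add: atLeastLessThanSuc_atLeastAtMost[symmetric] del: upt_Suc)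
  then show ?thesis using orbit_coord_id[of d z] by simp
qed

lemma gr_exp_line:
  assumes "x \<in> nminus n" "\<And>a b. a \<in> {1..d} \<Longrightarrow> b \<in> {d<..n} \<Longrightarrow> x b a = z a b"
  shows "gr_exp n d x ` gr_line n d (gr_vec n d {1..d}) = {gr_of n d (\<lambda>J. c * orbit_point z J) |c. c \<noteq> 0}"
proof -
  have D: "{1..d} \<in> idx n d" using dn by (auto simp: idx_def)
  have "gr_scale n d c (gr_vec n d {1..d}) = gr_of n d (\<lambda>J. c * orbit_part z 0 J)" for c
    unfolding gr_vec_eq[OF D] gr_scale_gr_of gr_of_eq_iff
    using orbit_point_base[of z] by (auto simp: orbit_part_def deg_eq_0_iff)
  then have "gr_exp n d x (gr_scale n d c (gr_vec n d {1..d})) = gr_of n d (\<lambda>J. c * orbit_point z J)" for c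
    using gr_exp_gr_of[OF assms] by simp
  moreover have "gr_line n d v = (\<lambda>c. gr_scale n d c v) ` {c. c \<noteq> 0}" for v
    by (auto simp: gr_line_def)
  ultimately have "gr_exp n d x ` gr_line n d (gr_vec n d {1..d}) = (\<lambda>c. gr_of n d (\<lambda>J. c * orbit_point z J)) ` {c. c \<noteq> 0}"
    by (simp only: image_image)
  then show ?thesis by auto
qed

end

section \<open>Evaluation of polynomials\<close>

definition eval_monom :: "(nat set \<Rightarrow> complex) \<Rightarrow> (nat set \<Rightarrow>\<^sub>0 nat) \<Rightarrow> complex"
  where "eval_monom x m = (\<Prod>J\<in>keys m. x J ^ lookup m J)"

lemma eval_monom_superset:
  assumes "finite S" "keys m \<subseteq> S"
  shows "eval_monom x m = (\<Prod>J\<in>S. x J ^ lookup m J)"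
  unfolding eval_monom_def using assms by (intro prod.mono_neutral_left) (auto simp: in_keys_iff)

lemma eval_monom_add: "eval_monom x (m + m') = eval_monom x m * eval_monom x m'"
proof -
  let ?S = "keys m \<union> keys m'"
  have "keys (m + m') \<subseteq> ?S" using Poly_Mapping.keys_add[of m m'] by simp
  then show ?thesis
    by (simp add: eval_monom_superset[of ?S] lookup_add power_add prod.distrib)
qed

lemma eval_monom_single: "eval_monom x (single J (Suc 0)) = x J"
  by (simp add: eval_monom_def)

lemma eval_mpoly_superset:
  assumes "finite S" "keys p \<subseteq> S"
  shows "eval_mpoly x p = (\<Sum>m\<in>S. lookup p m * eval_monom x m)"
  unfolding eval_mpoly_def eval_monom_def[symmetric]
  using assms by (intro sum.mono_neutral_left) (auto simp: in_keys_iff)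

lemma eval_mpoly_single: "eval_mpoly x (single m c) = c * eval_monom x m"
  by (subst eval_mpoly_superset[of "{m}"]) (auto simp: lookup_single split: if_splits)

lemma eval_mpoly_zero [simp]: "eval_mpoly x 0 = 0"
  by (simp add: eval_mpoly_def)

lemma eval_mpoly_add: "eval_mpoly x (p + q) = eval_mpoly x p + eval_mpoly x q"
proof -
  let ?S = "keys p \<union> keys q"
  have "keys (p + q) \<subseteq> ?S" using Poly_Mapping.keys_add[of p q] by simp
  then show ?thesis
    by (simp add: eval_mpoly_superset[of ?S] lookup_add algebra_simps sum.distrib)
qed

lemma eval_mpoly_sum: "eval_mpoly x (\<Sum>a\<in>A. f a) = (\<Sum>a\<in>A. eval_mpoly x (f a))"
  by (induction A rule: infinite_finite_induct) (simp_all add: eval_mpoly_add)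

lemma eval_mpoly_uminus: "eval_mpoly x (- p) = - eval_mpoly x p"
  using eval_mpoly_add[of x p "- p"] by (simp add: add_eq_0_iff)

lemma eval_mpoly_diff: "eval_mpoly x (p - q) = eval_mpoly x p - eval_mpoly x q"
  using eval_mpoly_add[of x p "- q"] by (simp add: eval_mpoly_uminus)

lemma mpoly_eq_sum_single:
  fixes p :: mpoly
  shows "p = (\<Sum>m\<in>keys p. single m (lookup p m))"
  by (intro poly_mapping_eqI) (simp add: lookup_sum lookup_single when_def in_keys_iff)

lemma eval_mpoly_mult: "eval_mpoly x (p * q) = eval_mpoly x p * eval_mpoly x q"
proof -
  let ?s = "\<lambda>p m. single m (lookup p m) :: mpoly"
  have "p * q = (\<Sum>m\<in>keys p. \<Sum>m'\<in>keys q. ?s p m * ?s q m')"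
    unfolding sum_product[symmetric] by (simp only: mpoly_eq_sum_single[symmetric])
  then have "eval_mpoly x (p * q) = (\<Sum>m\<in>keys p. \<Sum>m'\<in>keys q.
      (lookup p m * eval_monom x m) * (lookup q m' * eval_monom x m'))"
    by (simp add: eval_mpoly_sum mult_single eval_mpoly_single eval_monom_add mult_ac)
  also have "\<dots> = eval_mpoly x p * eval_mpoly x q"
    by (simp add: eval_mpoly_def eval_monom_def sum_product)
  finally show ?thesis .
qed

lemma eval_mpoly_cong:
  assumes "p \<in> carrier (plucker_ring n D)" "\<And>J. J \<in> (\<Union>d\<in>D. idx n d) \<Longrightarrow> x J = x' J"
  shows "eval_mpoly x p = eval_mpoly x' p"
  unfolding eval_mpoly_def using assms
  by (intro sum.cong prod.cong arg_cong2[of _ _ _ _ "(*)"] arg_cong2[of _ _ _ _ "(^)"])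
    (auto simp: plucker_ring_def subset_iff)

section \<open>Values of the degenerate Pluecker relations\<close>

lemma plucker_var_mult:
  "plucker_var L * plucker_var J = (if distinct L \<and> distinct J
    then single (single (set L) 1 + single (set J) 1) (seq_sign L * seq_sign J)
    else 0)"
  by (simp add: plucker_var_def mult_single)

text \<open>Representatives in the projective factors are chosen independently, so there is one
  scalar per column size. All products in a relation have the same pair of lengths and scale
  alike.\<close>

lemma eval_plucker_var_mult:
  fixes z :: "nat \<Rightarrow> nat \<Rightarrow> complex"
  shows "eval_mpoly (\<lambda>J. a (card J) * orbit_point z J) (plucker_var L * plucker_var J)
    = a (length L) * a (length J) * (orbit_coord (length L) z L * orbit_coord (length J) z J)"
proof (cases "distinct L \<and> distinct J")
  case True
  then have "orbit_coord (length L) z L = seq_sign L * orbit_point z (set L)"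
    "orbit_coord (length J) z J = seq_sign J * orbit_point z (set J)"
    using orbit_coord_sort[of L "length L" z] orbit_coord_sort[of J "length J" z] by (simp_all add: distinct_card)
  with True show ?thesis
    by (simp add: plucker_var_mult eval_mpoly_single eval_monom_add eval_monom_single distinct_card mult_ac)
next
  case False
  then have "orbit_coord (length L) z L = 0 \<or> orbit_coord (length J) z J = 0"
    using orbit_coord_not_distinct by blast
  moreover have "plucker_var L * plucker_var J = 0" using False by (auto simp: plucker_var_mult)
  ultimately show ?thesis by auto
qed

lemma length_exch_right:
  "length rs \<le> length J \<Longrightarrow> length (exch_right L J rs) = length J"
  by (simp add: exch_right_def)

lemma eval_plucker_rel:
  fixes z :: "nat \<Rightarrow> nat \<Rightarrow> complex"
  assumes "length J \<le> length L" "k \<le> length J"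
  shows "eval_mpoly (\<lambda>J. a (card J) * orbit_point z J) (plucker_rel k L J) = 0"
proof -
  let ?p = "length L" and ?q = "length J" and ?e = "eval_mpoly (\<lambda>J. a (card J) * orbit_point z J)"
  let ?V = "{rs. sorted_wrt (<) rs \<and> length rs = k \<and> set rs \<subseteq> {..<?p} \<and> (!) L ` set rs \<inter> {?q + 1..?p} = {}}"
  have "?e (\<Sum>rs\<in>?V. plucker_var (exch_left L J rs) * plucker_var (exch_right L J rs))
      = (\<Sum>rs\<in>?V. a ?p * a ?q * (orbit_coord ?p z (exch_left L J rs) * orbit_coord ?q z (exch_right L J rs)))"
    unfolding eval_mpoly_sum using assms
    by (intro sum.cong refl) (simp add: eval_plucker_var_mult length_exch_right)
  also have "\<dots> = a ?p * a ?q * (if set (take k J) \<inter> {?q + 1..?p} = {} then orbit_coord ?p z L * orbit_coord ?q z J else 0)"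
    using orbit_coord_relation[OF refl refl assms, of z] by (simp add: sum_distrib_left)
  also have "\<dots> = ?e (if set (take k J) \<inter> {?q + 1..?p} = {} then plucker_var L * plucker_var J else 0)"
    by (simp add: eval_plucker_var_mult)
  finally show ?thesis by (simp add: plucker_rel_def Let_def eval_mpoly_diff)
qed

lemma set_exch_left:
  assumes "distinct rs" "set rs \<subseteq> {..<length L}" "length rs \<le> length J"
  shows "set (exch_left L J rs) \<subseteq> set L \<union> set J"
proof
  fix x assume "x \<in> set (exch_left L J rs)"
  then obtain j where j: "j < length L" "x = exch_left L J rs ! j" by (auto simp: in_set_conv_nth)
  show "x \<in> set L \<union> set J"
  proof (cases "j \<in> set rs")
    case True
    then obtain m where "m < length rs" "j = rs ! m" by (auto simp: in_set_conv_nth)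
    then show ?thesis using exch_left_nth[OF assms(1,3,2)] j assms(3) by auto
  next
    case False
    then show ?thesis using exch_left_notin[of j rs L J] j by simp
  qed
qed

lemma set_exch_right: "set (exch_right L J rs) = (!) L ` set rs \<union> set (drop (length rs) J)"
  by (simp add: exch_right_def)

section \<open>Straightening\<close>

text \<open>Lowering the key by one triples the weight, and 3 is enough because two columns are
  exchanged at a time. The number subtracted from exceeds the key of every column inside
  \<open>{1..n}\<close>, so the subtraction is not truncated for them.\<close>

definition col_value :: "nat \<Rightarrow> nat set \<Rightarrow> nat"
  where "col_value n J = 3 ^ ((n + 1) * (n + 1) ^ n - col_key n J)"

definition monom_value :: "nat \<Rightarrow> (nat set \<Rightarrow>\<^sub>0 nat) \<Rightarrow> nat"
  where "monom_value n m = (\<Sum>J\<in>Pow {1..n}. lookup m J * col_value n J)"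

lemma monom_value_add: "monom_value n (m + m') = monom_value n m + monom_value n m'"
  by (simp add: monom_value_def lookup_add sum.distrib algebra_simps)

lemma monom_value_single:
  assumes "J \<subseteq> {1..n}"
  shows "monom_value n (single J (Suc 0)) = col_value n J"
proof -
  have "monom_value n (single J (Suc 0)) = (\<Sum>K\<in>Pow {1..n}. if K = J then col_value n J else 0)"
    unfolding monom_value_def by (intro sum.cong) (auto simp: lookup_single when_def)
  then show ?thesis using assms by simp
qed

lemma col_value_le: "col_value n J \<le> 3 ^ ((n + 1) * (n + 1) ^ n)"
  unfolding col_value_def by (intro power_increasing) auto

lemma monom_value_le: "monom_value n m \<le> total_deg n m * 3 ^ ((n + 1) * (n + 1) ^ n)"
  unfolding monom_value_def total_deg_def sum_distrib_right
  using col_value_le by (intro sum_mono mult_left_mono) auto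

lemma multi_deg_single: "J \<subseteq> {1..n} \<Longrightarrow> multi_deg n (single J (Suc 0)) d = of_bool (card J = d)"
  by (auto simp: multi_deg_def lookup_single when_def)

lemma not_nonstandard_self: "\<not> nonstandard p p J J"
  by (auto simp: nonstandard_def)

lemma keys_add_nat: "keys (m + m' :: nat set \<Rightarrow>\<^sub>0 nat) = keys m \<union> keys m'"
  by (auto simp: in_keys_iff lookup_add)

locale plucker =
  fixes n :: nat and D :: "nat set"
begin

abbreviation "R \<equiv> plucker_ring n D"
abbreviation "vars \<equiv> \<Union>d\<in>D. idx n d"
abbreviation "I \<equiv> plucker_ideal n D"

sublocale cring R by (rule cring_plucker_ring)

definition rels :: "mpoly set"
  where "rels = {plucker_rel k L J |k L J.
      length L \<in> D \<and> length J \<in> D \<and> length J \<le> length L \<and> 1 \<le> k \<and> k \<le> length J \<and>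
      distinct L \<and> distinct J \<and> set L \<subseteq> {1..n} \<and> set J \<subseteq> {1..n}}"

lemma carrier_iff: "p \<in> carrier R \<longleftrightarrow> (\<forall>m\<in>keys p. keys m \<subseteq> vars)"
  by (simp add: plucker_ring_def)

lemma R_simps [simp]: "x \<otimes>\<^bsub>R\<^esub> y = x * y" "x \<oplus>\<^bsub>R\<^esub> y = x + y" "\<zero>\<^bsub>R\<^esub> = 0" "\<one>\<^bsub>R\<^esub> = 1"
  by (simp_all add: plucker_ring_def)

lemma carrier_single: "keys m \<subseteq> vars \<Longrightarrow> single m c \<in> carrier R"
  by (auto simp: carrier_iff)

lemma vars_subset: "J \<in> vars \<Longrightarrow> J \<subseteq> {1..n}" "J \<in> vars \<Longrightarrow> J \<in> idx n (card J)" "J \<in> vars \<Longrightarrow> card J \<in> D"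
  by (auto simp: idx_def)

text \<open>This one fact about supports yields both that the relations lie in the ring and that
  they are multi-homogeneous.\<close>

lemma keys_plucker_rel:
  assumes "length L \<in> D" "length J \<in> D" "k \<le> length J" "set L \<subseteq> {1..n}" "set J \<subseteq> {1..n}"
    and "m \<in> keys (plucker_rel k L J)"
  obtains A B where "m = single A 1 + single B 1"
    "A \<in> idx n (length L)" "B \<in> idx n (length J)"
proof -
  let ?p = "length L" and ?q = "length J"
  let ?M = "{single A (1::nat) + single B 1 |A B. A \<in> idx n ?p \<and> B \<in> idx n ?q}"
  let ?V = "{rs. sorted_wrt (<) rs \<and> length rs = k \<and> set rs \<subseteq> {..<?p} \<and> (!) L ` set rs \<inter> {?q + 1..?p} = {}}"
  define H where "H = {f :: mpoly. keys f \<subseteq> ?M}"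
  have prod: "plucker_var L' * plucker_var J' \<in> H"
    if "length L' = ?p" "length J' = ?q" "set L' \<subseteq> {1..n}" "set J' \<subseteq> {1..n}" for L' J'
  proof (cases "distinct L' \<and> distinct J'")
    case True
    then have "set L' \<in> idx n ?p" "set J' \<in> idx n ?q"
      using that by (auto simp: idx_def distinct_card)
    then have "single (set L') 1 + single (set J') 1 \<in> ?M" by blast
    then show ?thesis using True by (simp add: H_def plucker_var_mult)
  qed (auto simp: H_def plucker_var_mult)
  have zero: "0 \<in> H" by (simp add: H_def)
  have diff: "f - g \<in> H" if "f \<in> H" "g \<in> H" for f g
    using that keys_diff[of f g] unfolding H_def by blast
  have sum: "(\<Sum>a\<in>A. f a) \<in> H" if "\<And>a. a \<in> A \<Longrightarrow> f a \<in> H" for A :: "nat list set" and f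
    using that
  proof (induction A rule: infinite_finite_induct)
    case (insert a A)
    then have "f a \<in> H" "sum f A \<in> H" by auto
    then have "f a + sum f A \<in> H"
      using Poly_Mapping.keys_add[of "f a" "sum f A"] unfolding H_def by blast
    then show ?case using insert by simp
  qed (simp_all add: zero)
  have "plucker_var (exch_left L J rs) * plucker_var (exch_right L J rs) \<in> H" if "rs \<in> ?V" for rs
  proof (rule prod)
    have rs: "distinct rs" "set rs \<subseteq> {..<?p}" "length rs \<le> ?q" using that assms by (auto simp: strict_sorted_iff)
    show "length (exch_left L J rs) = ?p" by simp
    show "length (exch_right L J rs) = ?q" using rs by (simp add: length_exch_right)
    show "set (exch_left L J rs) \<subseteq> {1..n}" using set_exch_left[OF rs] assms by blast
    have "(!) L ` set rs \<subseteq> set L" using rs by auto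
    then show "set (exch_right L J rs) \<subseteq> {1..n}"
      unfolding set_exch_right using assms set_drop_subset[of "length rs" J] by blast
  qed
  then have "plucker_rel k L J \<in> H"
    unfolding plucker_rel_def Let_def using assms prod zero by (intro diff sum) auto
  then have "m \<in> ?M" using assms(6) by (auto simp: H_def)
  then show thesis using that by blast
qed

lemma rels_carrier: "rels \<subseteq> carrier R"
proof
  fix f assume "f \<in> rels"
  then obtain k L J where f: "f = plucker_rel k L J" "length L \<in> D" "length J \<in> D" "k \<le> length J"
    "set L \<subseteq> {1..n}" "set J \<subseteq> {1..n}" unfolding rels_def by blast
  show "f \<in> carrier R"
    unfolding carrier_iff
  proof
    fix m assume "m \<in> keys f"
    then obtain A B where "m = single A 1 + single B 1"
      "A \<in> idx n (length L)" "B \<in> idx n (length J)" using keys_plucker_rel[OF f(2-6), of m] f(1) by metis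
    then show "keys m \<subseteq> vars" using f by (auto simp: keys_add_nat)
  qed
qed

lemma I_eq: "I = Idl\<^bsub>R\<^esub> rels"
  by (simp add: plucker_ideal_def rels_def)

lemma ideal_I: "ideal I R"
  unfolding I_eq by (rule genideal_ideal[OF rels_carrier])

lemma rels_I: "rels \<subseteq> I"
  unfolding I_eq by (rule genideal_self[OF rels_carrier])

lemma I_add: "f \<in> I \<Longrightarrow> g \<in> I \<Longrightarrow> f + g \<in> I"
  using additive_subgroup.a_closed[OF ideal.axioms(1)[OF ideal_I]] by simp

lemma I_mult: "f \<in> I \<Longrightarrow> g \<in> carrier R \<Longrightarrow> g * f \<in> I"
  using ideal.I_l_closed[OF ideal_I] by simp

lemma I_zero: "0 \<in> I"
  using additive_subgroup.zero_closed[OF ideal.axioms(1)[OF ideal_I]] by simp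

section \<open>Normal forms modulo the ideal\<close>

definition good :: "(nat \<Rightarrow> nat) \<Rightarrow> mpoly set"
  where "good e = {q. \<forall>m\<in>keys q. standard n m \<and> keys m \<subseteq> vars \<and> multi_deg n m = e}"

definition straightened :: "(nat \<Rightarrow> nat) \<Rightarrow> mpoly set"
  where "straightened e = {f. \<exists>q\<in>good e. f - q \<in> I}"

lemma good_add: "p \<in> good e \<Longrightarrow> q \<in> good e \<Longrightarrow> p + q \<in> good e"
  using Poly_Mapping.keys_add[of p q] unfolding good_def by blast

lemma good_scale:
  assumes "q \<in> good e"
  shows "single 0 c * q \<in> good e"
proof -
  have "keys (single 0 c * q) \<subseteq> keys q"
    using keys_mult[of "single 0 c" q] by (auto split: if_splits)
  then show ?thesis using assms unfolding good_def by blast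
qed

lemma straightened_add:
  assumes "f \<in> straightened e" "g \<in> straightened e"
  shows "f + g \<in> straightened e"
proof -
  obtain p q where pq: "p \<in> good e" "f - p \<in> I" "q \<in> good e" "g - q \<in> I"
    using assms by (auto simp: straightened_def)
  then have "f + g - (p + q) \<in> I" using I_add[OF pq(2,4)] by (simp add: algebra_simps)
  then show ?thesis using good_add[OF pq(1,3)] by (auto simp: straightened_def)
qed

lemma straightened_scale:
  assumes "f \<in> straightened e"
  shows "single 0 c * f \<in> straightened e"
proof -
  obtain q where q: "q \<in> good e" "f - q \<in> I" using assms by (auto simp: straightened_def)
  then have "single 0 c * (f - q) \<in> I" by (intro I_mult carrier_single) auto
  then have "single 0 c * f - single 0 c * q \<in> I" by (simp add: right_diff_distrib)
  then show ?thesis using good_scale[OF q(1)] by (auto simp: straightened_def)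
qed

lemma straightened_I: "f \<in> I \<Longrightarrow> f \<in> straightened e"
  unfolding straightened_def good_def mem_Collect_eq by (rule bexI[of _ 0]) simp_all

lemma straightened_sum: "(\<And>a. a \<in> A \<Longrightarrow> f a \<in> straightened e) \<Longrightarrow> (\<Sum>a\<in>A. f a) \<in> straightened e"
  by (induction A rule: infinite_finite_induct)
    (auto intro: straightened_add straightened_I I_zero)

text \<open>Each rewriting step keeps the multi-degree and raises \<open>monom_value\<close>, which
  is bounded for fixed total degree; the induction is on the distance to this bound.\<close>

lemma straightened_monomial:
  assumes "keys m \<subseteq> vars"
  shows "single m c \<in> straightened (multi_deg n m)"
  using assms
proof (induction "total_deg n m * 3 ^ ((n + 1) * (n + 1) ^ n) - monom_value n m" arbitrary: m c rule: less_induct)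
  case less
  show ?case
  proof (cases "standard n m")
    case True
    then have "single m c \<in> good (multi_deg n m)"
      using less.prems by (auto simp: good_def)
    then show ?thesis using I_zero unfolding straightened_def by (auto intro!: bexI[of _ "single m c"])
  next
    case False
    then obtain J L where JL: "J \<in> keys m" "L \<in> keys m"
      "col_key n J \<le> col_key n L" "nonstandard (card L) (card J) L J"
      by (auto simp: standard_def)
    define p q where "p = card L" and "q = card J"
    have JV: "J \<in> vars" "L \<in> vars" using JL less.prems by auto
    have J: "J \<in> idx n q" and L: "L \<in> idx n p" and pq: "p \<in> D" "q \<in> D"
      using vars_subset[OF JV(1)] vars_subset[OF JV(2)] by (simp_all add: p_def q_def)
    note fJ = idxD[OF J] and fL = idxD[OF L]
    have "q \<le> p" by (rule card_le_of_col_key_le[OF J L JL(3)])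
    have "J \<noteq> L" using JL(4) not_nonstandard_self by auto
    obtain m0 where m0: "m = single L 1 + m0" "keys m0 \<subseteq> keys m"
      using monomial_split[OF JL(2)] .
    have "J \<in> keys m0" using JL(1) \<open>J \<noteq> L\<close> by (auto simp: m0(1) keys_add_nat)
    then obtain m1 where m1: "m0 = single J 1 + m1" "keys m1 \<subseteq> keys m0"
      using monomial_split by metis
    have m: "m = single L 1 + single J 1 + m1"
      using m0 m1 by (simp add: add.assoc)
    have m1V: "keys m1 \<subseteq> vars" using m0 m1 less.prems by blast
    obtain js k where js: "distinct js" "set js = J" "1 \<le> k" "k \<le> q" "set (take k js) \<inter> {q + 1..p} = {}"
      and exch: "\<And>S. S \<subseteq> L \<Longrightarrow> card S = k \<Longrightarrow> S \<inter> set (drop k js) = {} \<Longrightarrow>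
        col_key n (S \<union> set (drop k js)) < col_key n J"
      using nonstandard_exchange[OF J L \<open>q \<le> p\<close>] JL(4) unfolding p_def q_def by metis
    define ls where "ls = sorted_list_of_set L"
    have ls: "distinct ls" "set ls = L" "length ls = p" "seq_sign ls = 1"
      using fL by (simp_all add: ls_def seq_sign_sorted)
    have lenjs: "length js = q" using js fJ distinct_card[of js] by simp
    define V where "V = {rs. sorted_wrt (<) rs \<and> length rs = k \<and> set rs \<subseteq> {..<p} \<and> (!) ls ` set rs \<inter> {q + 1..p} = {}}"
    define t where "t rs = plucker_var (exch_left ls js rs) * plucker_var (exch_right ls js rs)" for rs
    define X where "X = (single m1 1 :: mpoly)"
    have rel: "plucker_rel k ls js = plucker_var ls * plucker_var js - (\<Sum>rs\<in>V. t rs)"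
      using js(5) by (simp add: plucker_rel_def Let_def lenjs ls V_def t_def)
    have "plucker_rel k ls js \<in> rels"
      unfolding rels_def mem_Collect_eq using js ls lenjs pq \<open>q \<le> p\<close> fJ fL
      by (intro exI[of _ k] exI[of _ ls] exI[of _ js]) simp
    then have relI: "X * plucker_rel k ls js \<in> I"
      using rels_I by (intro I_mult) (auto simp: X_def intro!: carrier_single m1V)
    have terms: "X * t rs \<in> straightened (multi_deg n m)" if rs: "rs \<in> V" for rs
    proof (cases "distinct (exch_left ls js rs) \<and> distinct (exch_right ls js rs)")
      case False
      then have "X * t rs = 0" by (auto simp: t_def plucker_var_mult)
      then show ?thesis using straightened_I[OF I_zero] by simp
    next
      case True
      define A B where "A = set (exch_left ls js rs)" and "B = set (exch_right ls js rs)"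
      define m' where "m' = single A 1 + single B 1 + m1"
      have rs': "distinct rs" "length rs = k" "set rs \<subseteq> {..<p}" using rs by (auto simp: V_def strict_sorted_iff)
      define S where "S = (!) ls ` set rs"
      have SL: "S \<subseteq> L" using rs' ls by (auto simp: S_def)
      have "inj_on ((!) ls) (set rs)" using rs' ls by (auto simp: inj_on_def nth_eq_iff_index_eq subset_iff)
      then have cS: "card S = k" using rs' by (simp add: S_def card_image distinct_card)
      have B: "B = S \<union> set (drop k js)" using rs' by (simp add: B_def set_exch_right S_def)
      have disj: "S \<inter> set (drop k js) = {}"
        using True rs' by (simp add: exch_right_def S_def)
      have keyB: "col_key n B < col_key n J" unfolding B by (rule exch[OF SL cS disj])
      have A_idx: "A \<in> idx n p"
      proof -
        have "card A = p" using True ls by (simp add: A_def distinct_card)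
        moreover have "A \<subseteq> L \<union> J"
          using set_exch_left[of rs ls js] rs' ls js lenjs by (simp add: A_def)
        ultimately show ?thesis using fJ fL by (auto simp: idx_def)
      qed
      have B_idx: "B \<in> idx n q"
      proof -
        have "card B = q" using True rs' js lenjs by (simp add: B_def distinct_card length_exch_right)
        moreover have "B \<subseteq> L \<union> J" using SL js set_drop_subset[of k js] by (auto simp: B)
        ultimately show ?thesis using fJ fL by (auto simp: idx_def)
      qed
      note fA = idxD[OF A_idx] and fB = idxD[OF B_idx]
      have "multi_deg n m' = multi_deg n m"
        using fA fB fJ fL by (intro ext) (simp add: m m'_def multi_deg_add multi_deg_single)
      moreover have "single m' c \<in> straightened (multi_deg n m')" for c
      proof (rule less.hyps)
        show "keys m' \<subseteq> vars"
          using A_idx B_idx pq m1V by (auto simp: m'_def keys_add_nat)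
        have tot: "total_deg n m' = total_deg n m"
          using fA fB fJ fL by (simp add: m m'_def total_deg_add total_deg_single)
        have "col_value n L \<le> col_value n J"
          unfolding col_value_def using JL(3) by (intro power_increasing) auto
        \<comment> \<open>The key of \<open>B\<close> is smaller than that of \<open>J\<close>, so
          its weight is at least tripled. The weight of \<open>L\<close> is at most that of
          \<open>J\<close>; hence \<open>B\<close> alone beats the old pair, whatever
          \<open>A\<close> is.\<close>
        moreover have "3 * col_value n J \<le> col_value n B"
        proof -
          have "col_key n J < (q + 1) * (n + 1) ^ n" by (rule col_key_bounds(2)[OF J])
          also have "\<dots> \<le> (n + 1) * (n + 1) ^ n" using fJ by (intro mult_right_mono) auto
          finally have "Suc ((n + 1) * (n + 1) ^ n - col_key n J) \<le> (n + 1) * (n + 1) ^ n - col_key n B"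
            using keyB by linarith
          then have "(3::nat) ^ Suc ((n + 1) * (n + 1) ^ n - col_key n J) \<le> col_value n B"
            unfolding col_value_def by (intro power_increasing) auto
          then show ?thesis by (simp add: col_value_def)
        qed
        moreover have "col_value n J > 0" by (simp add: col_value_def)
        ultimately have "monom_value n m < monom_value n m'"
          using fA fB fJ fL by (simp add: m m'_def monom_value_add monom_value_single)
        moreover have "monom_value n m' \<le> total_deg n m * 3 ^ ((n + 1) * (n + 1) ^ n)"
          using monom_value_le[of n m'] tot by simp
        ultimately show "total_deg n m' * 3 ^ ((n + 1) * (n + 1) ^ n) - monom_value n m'
            < total_deg n m * 3 ^ ((n + 1) * (n + 1) ^ n) - monom_value n m"
          unfolding tot by (metis diff_less_mono2 less_le_trans)
      qed
      moreover have "X * t rs = single m' (seq_sign (exch_left ls js rs) * seq_sign (exch_right ls js rs))"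
        using True by (simp add: X_def t_def plucker_var_mult mult_single A_def B_def m'_def add.commute)
      ultimately show ?thesis by simp
    qed
    have "single m (seq_sign js) = X * plucker_rel k ls js + (\<Sum>rs\<in>V. X * t rs)"
    proof -
      have "X * (plucker_var ls * plucker_var js) = single m (seq_sign js)"
        using js ls by (simp add: X_def plucker_var_mult mult_single m add.commute)
      then show ?thesis by (simp add: rel right_diff_distrib sum_distrib_left)
    qed
    also have "\<dots> \<in> straightened (multi_deg n m)"
      by (rule straightened_add[OF straightened_I[OF relI] straightened_sum[OF terms]])
    finally have "single 0 (c * seq_sign js) * single m (seq_sign js) \<in> straightened (multi_deg n m)"
      by (rule straightened_scale)
    then show ?thesis by (simp add: mult_single mult.assoc seq_sign_square)
  qed
qed

section \<open>The ideal and vanishing on the orbit\<close>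

lemma kernel_ideal: "ideal {f \<in> carrier R. eval_mpoly x f = 0} R"
proof (rule idealI)
  show "ring R" by (rule ring_axioms)
  show "subgroup {f \<in> carrier R. eval_mpoly x f = 0} (add_monoid R)"
  proof (rule add.subgroupI)
    show "{f \<in> carrier R. eval_mpoly x f = 0} \<noteq> {}" using zero_closed by force
    fix f assume f: "f \<in> {f \<in> carrier R. eval_mpoly x f = 0}"
    have "\<ominus>\<^bsub>R\<^esub> f = - f"
      by (rule minus_equality) (use f in \<open>auto simp: carrier_iff\<close>)
    then show "\<ominus>\<^bsub>R\<^esub> f \<in> {f \<in> carrier R. eval_mpoly x f = 0}"
      using f a_inv_closed[of f] by (auto simp: eval_mpoly_uminus)
    fix g assume "g \<in> {f \<in> carrier R. eval_mpoly x f = 0}"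
    then show "f \<oplus>\<^bsub>R\<^esub> g \<in> {f \<in> carrier R. eval_mpoly x f = 0}"
      using f a_closed[of f g] by (simp add: eval_mpoly_add)
  qed auto
  fix a y assume "a \<in> {f \<in> carrier R. eval_mpoly x f = 0}" "y \<in> carrier R"
  then show "y \<otimes>\<^bsub>R\<^esub> a \<in> {f \<in> carrier R. eval_mpoly x f = 0}" "a \<otimes>\<^bsub>R\<^esub> y \<in> {f \<in> carrier R. eval_mpoly x f = 0}"
    using m_closed[of y a] m_closed[of a y] by (auto simp: eval_mpoly_mult)
qed

lemma eval_I: "f \<in> I \<Longrightarrow> eval_mpoly (orbit_point z) f = 0"
proof -
  have "rels \<subseteq> {f \<in> carrier R. eval_mpoly (orbit_point z) f = 0}"
  proof
    fix f assume f: "f \<in> rels"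
    then obtain k L J where "f = plucker_rel k L J" "length J \<le> length L" "k \<le> length J"
      unfolding rels_def by blast
    then have "eval_mpoly (orbit_point z) f = 0"
      using eval_plucker_rel[of J L k "\<lambda>_. 1" z] by simp
    then show "f \<in> {f \<in> carrier R. eval_mpoly (orbit_point z) f = 0}" using f rels_carrier by auto
  qed
  then have "I \<subseteq> {f \<in> carrier R. eval_mpoly (orbit_point z) f = 0}"
    unfolding I_eq by (intro genideal_minimal kernel_ideal)
  then show "f \<in> I \<Longrightarrow> eval_mpoly (orbit_point z) f = 0" by auto
qed

text \<open>Modulo the ideal \<open>p\<close> equals a combination of standard monomials of its
  multi-degree. This combination vanishes on the orbit along with \<open>p\<close> and the ideal, so
  it is zero by independence.\<close>

theorem mem_I:
  assumes "\<And>m. m \<in> keys p \<Longrightarrow> keys m \<subseteq> vars \<and> multi_deg n m = e"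
    and "\<And>z. eval_mpoly (orbit_point z) p = 0"
  shows "p \<in> I"
proof -
  have "(\<Sum>m\<in>keys p. single m (lookup p m)) \<in> straightened e"
    using assms(1) straightened_monomial by (intro straightened_sum) metis
  then have "p \<in> straightened e" using mpoly_eq_sum_single[of p] by simp
  then obtain q where q: "q \<in> good e" "p - q \<in> I" by (auto simp: straightened_def)
  have "q = 0"
  proof (rule standard_independent)
    fix m assume m: "m \<in> keys q"
    then show "standard n m" "multi_deg n m d = e d" for d using q(1) by (auto simp: good_def)
    show "keys m \<subseteq> Pow {1..n}" using q(1) m vars_subset(1) by (fastforce simp: good_def)
  next
    show "eval_mpoly (orbit_point z) q = 0" for z
      using eval_I[OF q(2), of z] assms(2)[of z] by (simp add: eval_mpoly_diff)
  qed
  with q show ?thesis by simp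
qed

end

section \<open>The orbit and its closure\<close>

lemma group_elt_eq:
  assumes "a \<in> {1..d}" "b \<in> {d<..n}"
  shows "group_elt n c b a = c a (b - 1)"
proof -
  have "group_elt n c b a = (\<Sum>j\<in>{1..n - 1}. \<Sum>i\<in>{1..j}. if b = j + 1 \<and> a = i then c i j else 0)"
    unfolding group_elt_def root_vec_def by (intro sum.cong refl) auto
  also have "\<dots> = (\<Sum>j\<in>{1..n - 1}. if j = b - 1 then c a (b - 1) else 0)"
  proof (rule sum.cong[OF refl])
    fix j assume "j \<in> {1..n - 1}"
    show "(\<Sum>i\<in>{1..j}. if b = j + 1 \<and> a = i then c i j else 0) = (if j = b - 1 then c a (b - 1) else 0)"
    proof (cases "b = j + 1")
      case True
      then have "(\<Sum>i\<in>{1..j}. if b = j + 1 \<and> a = i then c i j else 0) = (\<Sum>i\<in>{1..j}. if a = i then c i j else 0)"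
        by simp
      then show ?thesis using True assms by simp
    qed (use assms in auto)
  qed
  also have "\<dots> = c a (b - 1)" using assms by auto
  finally show ?thesis .
qed

lemma group_elt_nminus: "group_elt n c \<in> nminus n"
  unfolding nminus_def mem_Collect_eq
proof (intro allI impI)
  fix a b assume nz: "group_elt n c a b \<noteq> 0"
  show "1 \<le> b \<and> b < a \<and> a \<le> n"
  proof (rule ccontr)
    assume *: "\<not> ?thesis"
    have "group_elt n c a b = 0"
      unfolding group_elt_def using * by (intro sum.neutral ballI) (auto simp: root_vec_def)
    with nz show False ..
  qed
qed

lemma orbit_point_cong:
  assumes "\<And>a b. 0 < b \<Longrightarrow> z a b = z' a b"
  shows "orbit_point z J = orbit_point z' J"
  using assms unfolding orbit_coord_def
  by (intro rows_det_cong) (auto simp: orbit_entry_def)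

locale orbit_plucker = plucker +
  assumes D: "\<And>d. d \<in> D \<Longrightarrow> d \<le> n"
begin

definition point :: "(nat \<Rightarrow> nat \<Rightarrow> complex) \<Rightarrow> nat \<Rightarrow> gr set"
  where "point z = (\<lambda>d\<in>D. {gr_of n d (\<lambda>J. c * orbit_point z J) |c. c \<noteq> 0})"

lemma orbit_eq: "orbit n D = range point"
proof -
  have "group_act n D c (base_point n D) = point (\<lambda>a b. c a (b - 1))" for c
  proof -
    have "gr_exp n d (group_elt n c) ` gr_line n d (gr_vec n d {1..d})
        = {gr_of n d (\<lambda>J. a * orbit_point (\<lambda>a b. c a (b - 1)) J) |a. a \<noteq> 0}" if "d \<in> D" for d
      by (rule gr_exp_line[OF D[OF that] group_elt_nminus]) (rule group_elt_eq)
    then show ?thesis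
      unfolding group_act_def point_def base_point_def by (intro restrict_ext) simp
  qed
  \<comment> \<open>The coefficient of \<open>root_vec i j\<close> becomes the matrix entry in
    column \<open>j + 1\<close>. Every \<open>z\<close> is reached except for its column 0, which
    \<open>orbit_entry\<close> does not read.\<close>
  moreover have "point z \<in> range (\<lambda>c. point (\<lambda>a b. c a (b - 1)))" for z
  proof
    have "orbit_point z J = orbit_point (\<lambda>a b. z a (Suc (b - 1))) J" for J
      by (rule orbit_point_cong) simp
    then show "point z = point (\<lambda>a b. (\<lambda>i j. z i (Suc j)) a (b - 1))" by (simp add: point_def)
  qed simp
  ultimately show ?thesis unfolding orbit_def by auto
qed

text \<open>Choosing a representative of each line amounts to one nonzero scalar per column size,
  which turns vanishing at a point into a statement about \<open>eval_mpoly\<close> alone.\<close>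

lemma vanishes_at_point:
  assumes "p \<in> carrier R"
  shows "vanishes_at n D p (point z) \<longleftrightarrow>
    (\<forall>a. (\<forall>d\<in>D. a d \<noteq> 0) \<longrightarrow> eval_mpoly (\<lambda>J. a (card J) * orbit_point z J) p = 0)"
proof -
  have coord: "eval_mpoly (\<lambda>J. gr_coord n (card J) (x (card J)) J) p = eval_mpoly (\<lambda>J. a (card J) * orbit_point z J) p"
    if "\<And>d. d \<in> D \<Longrightarrow> x d = gr_of n d (\<lambda>J. a d * orbit_point z J)" for x a
  proof (rule eval_mpoly_cong[OF assms])
    fix J assume J: "J \<in> vars"
    note J' = vars_subset(2,3)[OF J]
    show "gr_coord n (card J) (x (card J)) J = a (card J) * orbit_point z J"
      using that[OF J'(2)] gr_coord_gr_of[OF D[OF J'(2)] J'(1)] by simp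
  qed
  show ?thesis
  proof
    assume v: "vanishes_at n D p (point z)"
    show "\<forall>a. (\<forall>d\<in>D. a d \<noteq> 0) \<longrightarrow> eval_mpoly (\<lambda>J. a (card J) * orbit_point z J) p = 0"
    proof (intro allI impI)
      fix a :: "nat \<Rightarrow> complex" assume a: "\<forall>d\<in>D. a d \<noteq> 0"
      let ?x = "\<lambda>d. gr_of n d (\<lambda>J. a d * orbit_point z J)"
      have "\<forall>d\<in>D. ?x d \<in> point z d" using a by (auto simp: point_def)
      with v[unfolded vanishes_at_def, THEN spec, of ?x]
      have "eval_mpoly (\<lambda>J. gr_coord n (card J) (?x (card J)) J) p = 0" by (rule mp)
      then show "eval_mpoly (\<lambda>J. a (card J) * orbit_point z J) p = 0" using coord[of ?x a] by simp
    qed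
  next
    assume v: "\<forall>a. (\<forall>d\<in>D. a d \<noteq> 0) \<longrightarrow> eval_mpoly (\<lambda>J. a (card J) * orbit_point z J) p = 0"
    show "vanishes_at n D p (point z)"
      unfolding vanishes_at_def
    proof (intro allI impI)
      fix x assume x: "\<forall>d\<in>D. x d \<in> point z d"
      then have "\<forall>d\<in>D. \<exists>c. c \<noteq> 0 \<and> x d = gr_of n d (\<lambda>J. c * orbit_point z J)"
        by (auto simp: point_def)
      then obtain a where a: "\<forall>d\<in>D. a d \<noteq> 0 \<and> x d = gr_of n d (\<lambda>J. a d * orbit_point z J)"
        by (metis bchoice)
      then show "eval_mpoly (\<lambda>J. gr_coord n (card J) (x (card J)) J) p = 0"
        using coord[of x a] v by simp
    qed
  qed
qed

lemma point_in_proj_prod: "point z \<in> proj_prod n D"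
  unfolding proj_prod_def
proof (rule PiE_I)
  fix d assume d: "d \<in> D"
  note dn = D[OF d]
  let ?x = "gr_of n d (orbit_point z)"
  have "point z d = gr_line n d ?x"
    using d by (simp add: point_def gr_line_def gr_scale_gr_of[OF dn])
  moreover have "?x \<noteq> gr_zero n d"
  proof -
    have "{1..d} \<in> idx n d" using dn by (auto simp: idx_def)
    then show ?thesis using orbit_point_base[OF dn, of z]
      unfolding gr_zero_eq[OF dn] gr_of_eq_iff[OF dn] by force
  qed
  ultimately show "point z d \<in> proj_space n d"
    unfolding proj_space_def using gr_of_in_gr_space[OF dn] by blast
qed (simp add: point_def)

lemma multi_deg_homogeneous:
  assumes "p \<in> carrier R" "m \<in> keys p"
  shows "(\<Sum>J\<in>{J \<in> keys m. card J = d}. lookup m J) = multi_deg n m d"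
proof -
  have "keys m \<subseteq> Pow {1..n}" using assms vars_subset(1) by (fastforce simp: carrier_iff)
  then have "{J \<in> keys m. card J = d} \<subseteq> {J \<in> Pow {1..n}. card J = d}" by blast
  then show ?thesis
    unfolding multi_deg_def by (rule sum.mono_neutral_left[rotated]) (auto simp: in_keys_iff)
qed

lemma multi_deg_outside:
  assumes "p \<in> carrier R" "m \<in> keys p" "d \<notin> D"
  shows "multi_deg n m d = 0"
proof (rule ccontr)
  assume "multi_deg n m d \<noteq> 0"
  then obtain J where "J \<in> keys m" "card J = d" using multi_deg_pos_iff[of n m d] by blast
  then show False using assms vars_subset(3)[of J] by (auto simp: carrier_iff)
qed

definition vanishing :: "mpoly set"
  where "vanishing = {p \<in> mh_polys n D. \<forall>\<pi>\<in>orbit n D. vanishes_at n D p \<pi>}"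

lemma vanishing_carrier: "vanishing \<subseteq> carrier R"
  by (auto simp: vanishing_def mh_polys_def)

lemma vanishing_subset_I: "vanishing \<subseteq> I"
proof
  fix p assume p: "p \<in> vanishing"
  then have pR: "p \<in> carrier R" using vanishing_carrier by blast
  obtain e where e: "\<And>m d. m \<in> keys p \<Longrightarrow> d \<in> D \<Longrightarrow> multi_deg n m d = e d"
    using p multi_deg_homogeneous[OF pR] by (auto simp: vanishing_def mh_polys_def multi_homogeneous_def)
  show "p \<in> I"
  proof (rule mem_I)
    fix m assume m: "m \<in> keys p"
    \<comment> \<open>Homogeneity fixes the degrees only for sizes in \<open>D\<close>; in every
      other size there are no variables and the degree is 0. \<open>mem_I\<close> asks for the whole
      function.\<close>
    have "multi_deg n m = (\<lambda>d. if d \<in> D then e d else 0)"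
      using e[OF m] multi_deg_outside[OF pR m] by auto
    with m pR show "keys m \<subseteq> vars \<and> multi_deg n m = (\<lambda>d. if d \<in> D then e d else 0)"
      by (auto simp: carrier_iff)
  next
    fix z
    have "vanishes_at n D p (point z)" using p by (auto simp: vanishing_def orbit_eq)
    then have "eval_mpoly (\<lambda>J. (\<lambda>_. 1) (card J) * orbit_point z J) p = 0"
      unfolding vanishes_at_point[OF pR] by (rule allE[of _ "\<lambda>_. 1"]) simp
    then show "eval_mpoly (orbit_point z) p = 0" by simp
  qed
qed

lemma rels_subset_vanishing: "rels \<subseteq> vanishing"
proof
  fix f assume f: "f \<in> rels"
  then have fR: "f \<in> carrier R" using rels_carrier by blast
  obtain k L J where rel: "f = plucker_rel k L J" "length L \<in> D" "length J \<in> D" "k \<le> length J"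
    "set L \<subseteq> {1..n}" "set J \<subseteq> {1..n}" "length J \<le> length L"
    using f unfolding rels_def by blast
  have "multi_homogeneous D f"
    unfolding multi_homogeneous_def
  proof (intro exI[of _ "\<lambda>d. of_bool (length L = d) + of_bool (length J = d)"] ballI)
    fix m d assume m: "m \<in> keys f"
    then obtain A B where AB: "m = single A 1 + single B 1"
      "A \<in> idx n (length L)" "B \<in> idx n (length J)"
      using keys_plucker_rel[OF rel(2-6), of m] rel(1) by metis
    have "multi_deg n m d = of_bool (length L = d) + of_bool (length J = d)"
      using idxD(1,2)[OF AB(2)] idxD(1,2)[OF AB(3)] by (simp add: AB(1) multi_deg_add multi_deg_single)
    then show "(\<Sum>J\<in>{J \<in> keys m. card J = d}. lookup m J)
        = of_bool (length L = d) + of_bool (length J = d)"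
      by (simp only: multi_deg_homogeneous[OF fR m])
  qed
  moreover have "vanishes_at n D f (point z)" for z
    unfolding vanishes_at_point[OF fR] unfolding rel(1)
    using eval_plucker_rel[OF rel(7,4)] by blast
  ultimately show "f \<in> vanishing" using fR by (auto simp: vanishing_def mh_polys_def orbit_eq)
qed

lemma vanishing_ideal_orbit: "vanishing_ideal n D (orbit n D) = I"
proof -
  have "Idl\<^bsub>R\<^esub> vanishing = I"
  proof
    show "Idl\<^bsub>R\<^esub> vanishing \<subseteq> I"
      by (rule genideal_minimal[OF ideal_I vanishing_subset_I])
    show "I \<subseteq> Idl\<^bsub>R\<^esub> vanishing"
      unfolding I_eq
      using genideal_self[OF vanishing_carrier] rels_subset_vanishing
      by (intro genideal_minimal genideal_ideal[OF vanishing_carrier]) blast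
  qed
  then show ?thesis by (simp add: vanishing_ideal_def vanishing_def)
qed

text \<open>The zero set of a single multi-homogeneous polynomial is closed, so it contains the
  closure as soon as it contains the orbit. Hence both ideals have the same generators.\<close>

lemma vanishing_ideal_closure:
  "vanishing_ideal n D (degenerate_flag_variety n D) = vanishing_ideal n D (orbit n D)"
proof -
  have "(\<forall>\<pi>\<in>degenerate_flag_variety n D. vanishes_at n D p \<pi>) \<longleftrightarrow> (\<forall>\<pi>\<in>orbit n D. vanishes_at n D p \<pi>)"
    if p: "p \<in> mh_polys n D" for p
  proof
    assume "\<forall>\<pi>\<in>degenerate_flag_variety n D. vanishes_at n D p \<pi>"
    moreover have "orbit n D \<subseteq> degenerate_flag_variety n D"
      unfolding degenerate_flag_variety_def by (rule hull_subset)
    ultimately show "\<forall>\<pi>\<in>orbit n D. vanishes_at n D p \<pi>" by blast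
  next
    assume v: "\<forall>\<pi>\<in>orbit n D. vanishes_at n D p \<pi>"
    let ?Z = "{\<pi> \<in> proj_prod n D. \<forall>p\<in>{p}. vanishes_at n D p \<pi>}"
    have "degenerate_flag_variety n D \<subseteq> ?Z"
      unfolding degenerate_flag_variety_def
    proof (rule hull_minimal)
      show "orbit n D \<subseteq> ?Z" using v point_in_proj_prod by (auto simp: orbit_eq)
      show "zariski_closed n D ?Z" unfolding zariski_closed_def using p by blast
    qed
    then show "\<forall>\<pi>\<in>degenerate_flag_variety n D. vanishes_at n D p \<pi>" by blast
  qed
  then have "{p \<in> mh_polys n D. \<forall>\<pi>\<in>degenerate_flag_variety n D. vanishes_at n D p \<pi>}
      = {p \<in> mh_polys n D. \<forall>\<pi>\<in>orbit n D. vanishes_at n D p \<pi>}" by blast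
  then show ?thesis by (simp only: vanishing_ideal_def)
qed

end

theorem theorem5p6:
  fixes n s :: nat and d :: "nat \<Rightarrow> nat"
  assumes "2 \<le> n" and "1 \<le> s"
    and "\<And>r. r \<in> {1..s} \<Longrightarrow> 1 \<le> d r \<and> d r \<le> n - 1"
    and "strict_mono_on {1..s} d"
  shows "vanishing_ideal n (d ` {1..s}) (orbit n (d ` {1..s})) = plucker_ideal n (d ` {1..s}) \<and>
    vanishing_ideal n (d ` {1..s}) (degenerate_flag_variety n (d ` {1..s}))
      = plucker_ideal n (d ` {1..s})"
proof -
  interpret orbit_plucker n "d ` {1..s}"
  proof
    fix d' assume "d' \<in> d ` {1..s}"
    then show "d' \<le> n" using assms(3) by force
  qed
  show ?thesis using vanishing_ideal_orbit vanishing_ideal_closure by simp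
qed

end
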